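(* Let $T>0$. Suppose that $\varphi\in C^3(\mathbb{R})$ satisfies, for some constant $c\in\mathbb{R}$, $\varphi(c-x)=\varphi(c+x)$ for all $x\in\mathbb{R}$ and is monotone on $[c,\infty)$, that $\varphi$ and $\varphi'$ have at most polynomial growth, and that $(Y_t,Z_t)$ is the unique solution of the BSDE $$Y_t=\varphi(B_T)+\int_t^Tk|Z_s|\,ds-\int_t^TZ_s\,dB_s,\qquad 0\le t\le T,$$ where $k$ is a real constant. (1) If $\varphi'\ge0$ and $\varphi'\not\equiv0$ on $(c,\infty)$, then $\operatorname{sgn}(Z_t)=\operatorname{sgn}(B_t-c)$ for $t\in[0,T]$. (2) If $\varphi'\le0$ and $\varphi'\not\equiv0$ on $(c,\infty)$, then $\operatorname{sgn}(-Z_t)=\operatorname{sgn}(B_t-c)$ for $t\in[0,T]$.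
   Context: $(B_t)_{t\ge0}$ is a standard one-dimensional Brownian motion on a probability space $(\Omega,\mathcal{F},P)$, and $\mathcal{F}_t=\sigma\{B_s:0\le s\le t\}$. $\mathcal{M}(0,T,\mathbb{R})$ denotes the set of real-valued $(\mathcal{F}_t)$-adapted processes $(v_t)_{t\in[0,T]}$ with $E\big[\int_0^T|v_t|^2dt\big]<\infty$. A solution of the BSDE (backward stochastic differential equation) is a pair $Y,Z\in\mathcal{M}(0,T,\mathbb{R})$ satisfying the integral equation for all $t\in[0,T]$. $\operatorname{sgn}(x)$ equals $1$, $0$, $-1$ for $x>0$, $x=0$, $x<0$ respectively. *)

theory Defs
  imports "HOL-Probability.Probability"
begin

section \<open>Brownian motion and its natural filtration\<close>

text \<open>Only the time set $[0,\infty)$ is relevant; the values \<open>B t\<close> for \<open>t < 0\<close> are arbitrary.\<close>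

locale std_brownian_motion = prob_space M for M :: "'a measure" +
  fixes B :: "real \<Rightarrow> 'a \<Rightarrow> real"
  assumes measurable_B: "\<And>t. 0 \<le> t \<Longrightarrow> B t \<in> borel_measurable M"
    and start_zero: "AE \<omega> in M. B 0 \<omega> = 0"
    and indep_increments:
      "\<And>(n::nat) \<tau>. 0 \<le> \<tau> 0 \<Longrightarrow> (\<And>i. i < n \<Longrightarrow> \<tau> i \<le> \<tau> (Suc i)) \<Longrightarrow>
         indep_vars (\<lambda>_. borel) (\<lambda>i \<omega>. B (\<tau> (Suc i)) \<omega> - B (\<tau> i) \<omega>) {..<n}"
    and normal_increments:
      "\<And>s t. 0 \<le> s \<Longrightarrow> s < t \<Longrightarrow>
         distributed M lborel (\<lambda>\<omega>. B t \<omega> - B s \<omega>) (normal_density 0 (sqrt (t - s)))"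
    and continuous_paths: "AE \<omega> in M. continuous_on {0..} (\<lambda>t. B t \<omega>)"

definition natural_filtration ::
    "'a measure \<Rightarrow> (real \<Rightarrow> 'a \<Rightarrow> real) \<Rightarrow> real \<Rightarrow> 'a measure" where
  "natural_filtration M B t =
     sigma (space M) {B s -` A \<inter> space M | s A. 0 \<le> s \<and> s \<le> t \<and> A \<in> sets borel}"

section \<open>Square-integrable adapted processes\<close>

text \<open>Joint measurability in time and scenario is part of the notion of a process here: it is
  what gives the iterated integral its meaning.\<close>

definition M2_process ::
    "'a measure \<Rightarrow> (real \<Rightarrow> 'a \<Rightarrow> real) \<Rightarrow> real \<Rightarrow> (real \<Rightarrow> 'a \<Rightarrow> real) \<Rightarrow> bool" where
  "M2_process M B T v \<longleftrightarrow>
     (\<lambda>(t, \<omega>). v t \<omega>) \<in> borel_measurable (restrict_space lborel {0..T} \<Otimes>\<^sub>M M) \<and>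
     (\<forall>t\<in>{0..T}. v t \<in> borel_measurable (natural_filtration M B t)) \<and>
     (\<integral>\<^sup>+\<omega>. (\<integral>\<^sup>+t\<in>{0..T}. ennreal (\<bar>v t \<omega>\<bar>\<^sup>2) \<partial>lborel) \<partial>M) < \<infinity>"

section \<open>The Ito integral\<close>

text \<open>A step integrand on \<open>[a, b]\<close> consists of a partition
  \<open>a = \<tau> 0 < \<dots> < \<tau> m = b\<close> and of bounded coefficients \<open>\<xi> i\<close> that are measurable at the left
  endpoint \<open>\<tau> i\<close> of the interval they belong to.\<close>

definition step_integrand ::
    "'a measure \<Rightarrow> (real \<Rightarrow> 'a \<Rightarrow> real) \<Rightarrow> real \<Rightarrow> real \<Rightarrow>
     nat \<Rightarrow> (nat \<Rightarrow> real) \<Rightarrow> (nat \<Rightarrow> 'a \<Rightarrow> real) \<Rightarrow> bool" where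
  "step_integrand M B a b m \<tau> \<xi> \<longleftrightarrow>
     \<tau> 0 = a \<and> \<tau> m = b \<and> (\<forall>i<m. \<tau> i < \<tau> (Suc i)) \<and>
     (\<forall>i<m. \<xi> i \<in> borel_measurable (natural_filtration M B (\<tau> i)) \<and>
            (\<exists>C. \<forall>\<omega>\<in>space M. \<bar>\<xi> i \<omega>\<bar> \<le> C))"

definition step_process ::
    "nat \<Rightarrow> (nat \<Rightarrow> real) \<Rightarrow> (nat \<Rightarrow> 'a \<Rightarrow> real) \<Rightarrow> real \<Rightarrow> 'a \<Rightarrow> real" where
  "step_process m \<tau> \<xi> s \<omega> = (\<Sum>i<m. \<xi> i \<omega> * indicator {\<tau> i<..\<tau> (Suc i)} s)"

definition step_integral ::
    "(real \<Rightarrow> 'a \<Rightarrow> real) \<Rightarrow> nat \<Rightarrow> (nat \<Rightarrow> real) \<Rightarrow> (nat \<Rightarrow> 'a \<Rightarrow> real) \<Rightarrow> 'a \<Rightarrow> real" where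
  "step_integral B m \<tau> \<xi> \<omega> = (\<Sum>i<m. \<xi> i \<omega> * (B (\<tau> (Suc i)) \<omega> - B (\<tau> i) \<omega>))"

text \<open>\<open>has_ito_integral M B a b v X\<close>: the random variable \<open>X\<close> is a version of
  $\int_a^b v_s\,dB_s$, i.e. the $L^2(P)$-limit of the integrals of step integrands that approximate
  \<open>v\<close> in $L^2([a,b] \times \Omega, ds \otimes P)$. The limit is unique only up to null sets, hence a
  relation rather than a function.\<close>

definition has_ito_integral ::
    "'a measure \<Rightarrow> (real \<Rightarrow> 'a \<Rightarrow> real) \<Rightarrow> real \<Rightarrow> real \<Rightarrow>
     (real \<Rightarrow> 'a \<Rightarrow> real) \<Rightarrow> ('a \<Rightarrow> real) \<Rightarrow> bool" where
  "has_ito_integral M B a b v X \<longleftrightarrow>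
     X \<in> borel_measurable M \<and>
     (\<exists>m \<tau> \<xi>.
        (\<forall>n::nat. step_integrand M B a b (m n) (\<tau> n) (\<xi> n)) \<and>
        (\<lambda>n. \<integral>\<^sup>+\<omega>. (\<integral>\<^sup>+s\<in>{a..b}.
               ennreal (\<bar>v s \<omega> - step_process (m n) (\<tau> n) (\<xi> n) s \<omega>\<bar>\<^sup>2) \<partial>lborel) \<partial>M)
          \<longlonglongrightarrow> 0 \<and>
        (\<lambda>n. \<integral>\<^sup>+\<omega>. ennreal (\<bar>X \<omega> - step_integral B (m n) (\<tau> n) (\<xi> n) \<omega>\<bar>\<^sup>2) \<partial>M)
          \<longlonglongrightarrow> 0)"

section \<open>The backward stochastic differential equation\<close>

definition bsde_solution ::
    "'a measure \<Rightarrow> (real \<Rightarrow> 'a \<Rightarrow> real) \<Rightarrow> real \<Rightarrow> real \<Rightarrow> (real \<Rightarrow> real) \<Rightarrow>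
     (real \<Rightarrow> 'a \<Rightarrow> real) \<Rightarrow> (real \<Rightarrow> 'a \<Rightarrow> real) \<Rightarrow> bool" where
  "bsde_solution M B T k \<phi> Y Z \<longleftrightarrow>
     M2_process M B T Y \<and> M2_process M B T Z \<and>
     (\<forall>t\<in>{0..T}. \<exists>I. has_ito_integral M B t T Z I \<and>
        (AE \<omega> in M. Y t \<omega> = \<phi> (B T \<omega>) + (LBINT s:{t..T}. k * \<bar>Z s \<omega>\<bar>) - I \<omega>))"

section \<open>Regularity and growth of the terminal function\<close>

definition C_k :: "nat \<Rightarrow> (real \<Rightarrow> real) \<Rightarrow> bool" where
  "C_k n f \<longleftrightarrow>
     (\<forall>i<n. \<forall>x. (deriv ^^ i) f field_differentiable at x) \<and> continuous_on UNIV ((deriv ^^ n) f)"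

definition polynomial_growth :: "(real \<Rightarrow> real) \<Rightarrow> bool" where
  "polynomial_growth f \<longleftrightarrow> (\<exists>C (p::nat). \<forall>x. \<bar>f x\<bar> \<le> C * (1 + \<bar>x\<bar> ^ p))"

end

theory Submission
  imports Defs "HOL-Real_Asymp.Real_Asymp"
begin

text \<open>Why the theorem is true. Let $\sigma = 1$ in case (1), $\sigma = -1$ in case (2), and
  $\kappa = \sigma k$. If $\sigma Z$ has the sign of $B - c$, then $k|Z| = \kappa\,
  \mathrm{sgn}(B - c)\, Z$ and the equation is linear. The value function of the linear equation
  satisfies $u_t + \frac12 u_{xx} + \kappa\, \mathrm{sgn}(x - c)\, u_x = 0$ with $u(T, \cdot) = \varphi$. It is even
  about $c$, so on either side of $c$ the gradient $v = u_x$ solves an equation with constant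
  coefficients and boundary value $0$ at $c$; multiplying by $e^{\kappa|x - c|}$ removes the drift, and
  reflection turns the boundary condition into oddness. Hence
  \[ v(s, x) = e^{-\kappa|x - c| - \kappa^2 (T - s)/2}\; E\, g(x - c + \sqrt{T - s}\, N), \qquad
     g(y) = e^{\kappa|y|} \varphi'(c + y), \]
  where $N$ is standard normal. The function $g$ is odd and $\sigma g \ge 0$, not identically $0$, on
  the positive half-line, so $\sigma v(s, x)$ has strictly the sign of $x - c$ for $s < T$
  (\<open>gauss_average_odd_pos\<close>, \<open>value_grad_sign\<close>). It remains to show
  $Z_s = v(s, B_s)$ almost everywhere (\<open>gradient_sign\<close>).

  This is a uniqueness statement. An Ito integral over $[t, T]$ is an isometric image of its integrand and
  orthogonal to the past of $t$ (\<open>ito_limit_isometry\<close>, \<open>ito_limit_orthogonal\<close>).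
  If $\varphi(B_T) + \int_t^T \kappa\,\mathrm{sgn}(B_s - c) V_s\,ds - \int_t^T V_s\,dB_s$ depends on the past of $t$
  only, as the corresponding expression for the solution does, then subtracting the two equations gives
  \[ \|Z - V\|_{L^2([t,T] \times \Omega)} \le
     \Big\|\int_t^T \big(k|Z_s| - \kappa\,\mathrm{sgn}(B_s - c) V_s\big)\,ds\Big\|_{L^2(\Omega)}. \]
  For $V_s = v(s, B_s)$ the integrand on the right is $k(|Z_s| - |V_s|)$, so the right-hand side is at most
  $|k| \sqrt{T - t}\,\|Z - V\|$: the difference vanishes on a short interval before $T$, and then,
  interval by interval, on all of $[0, T]$ (\<open>backward_uniqueness\<close>).

  That the expression depends on the past only is proved for functions $g$ that are sums of sines
  (\<open>represented_sine_sum\<close>). For $g(y) = \sin(l y)$ the value function separates,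
  $u(s, x) = e^{-\beta(T - s)} w(x)$ with $\beta = (\kappa^2 + l^2)/2$ and an explicit eigenfunction $w$ of the generator
  (\<open>eigen_equation\<close>). The kink of $|x - c|$ does not destroy twofold
  differentiability because $w'(c) = 0$, and Ito's formula for such separated functions
  (\<open>ito_formula\<close>) is an elementary estimate along partitions. Every continuous odd function of
  exponential growth is the pointwise limit of sums of sines with a common exponential bound
  (\<open>sine_sum_approximation\<close>). Under dominated convergence $v(\cdot, B)$ and the terminal
  value converge, and the displayed inequality, which for the sums of sines contains the error of the
  terminal value as a further term, passes to the limit (\<open>gradient_comparison\<close>).\<close>

section \<open>Square-integrable functions\<close>

text \<open>Square-integrability is a predicate on functions, and the norm a real number. Everything below
  holds up to null sets without passing to equivalence classes.\<close>

definition L2 :: "'b measure \<Rightarrow> ('b \<Rightarrow> real) \<Rightarrow> bool" where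
  "L2 N f \<longleftrightarrow> f \<in> borel_measurable N \<and> integrable N (\<lambda>x. (f x)\<^sup>2)"

definition l2norm :: "'b measure \<Rightarrow> ('b \<Rightarrow> real) \<Rightarrow> real" where
  "l2norm N f = sqrt (\<integral>x. (f x)\<^sup>2 \<partial>N)"

lemma L2_measurable: "L2 N f \<Longrightarrow> f \<in> borel_measurable N"
  by (simp add: L2_def)

lemma l2norm_nonneg[simp]: "0 \<le> l2norm N f"
  by (simp add: l2norm_def)

lemma l2norm_power2: "(l2norm N f)\<^sup>2 = (\<integral>x. (f x)\<^sup>2 \<partial>N)"
  by (simp add: l2norm_def)

lemma L2_bound:
  assumes "f \<in> borel_measurable N" "L2 N g" "AE x in N. \<bar>f x\<bar> \<le> \<bar>g x\<bar>"
  shows "L2 N f"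
  unfolding L2_def
proof (intro conjI)
  show "integrable N (\<lambda>x. (f x)\<^sup>2)"
  proof (rule Bochner_Integration.integrable_bound)
    show "integrable N (\<lambda>x. (g x)\<^sup>2)" using assms(2) by (simp add: L2_def)
    show "(\<lambda>x. (f x)\<^sup>2) \<in> borel_measurable N" using assms(1) by measurable
    show "AE x in N. norm ((f x)\<^sup>2) \<le> norm ((g x)\<^sup>2)"
      using assms(3) by eventually_elim (simp add: abs_le_square_iff)
  qed
qed fact

lemma l2norm_mono:
  assumes "f \<in> borel_measurable N" "L2 N g" "AE x in N. \<bar>f x\<bar> \<le> \<bar>g x\<bar>"
  shows "l2norm N f \<le> l2norm N g"
  unfolding l2norm_def
proof (intro real_sqrt_le_mono integral_mono_AE)
  show "integrable N (\<lambda>x. (f x)\<^sup>2)" using L2_bound[OF assms] by (simp add: L2_def)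
  show "integrable N (\<lambda>x. (g x)\<^sup>2)" using assms(2) by (simp add: L2_def)
  show "AE x in N. (f x)\<^sup>2 \<le> (g x)\<^sup>2"
    using assms(3) by eventually_elim (simp add: abs_le_square_iff)
qed

lemma L2_mult_integrable:
  assumes "L2 N f" "L2 N g"
  shows "integrable N (\<lambda>x. f x * g x)"
proof (rule Bochner_Integration.integrable_bound)
  show "integrable N (\<lambda>x. (f x)\<^sup>2 + (g x)\<^sup>2)" using assms by (simp add: L2_def)
  show "(\<lambda>x. f x * g x) \<in> borel_measurable N" using assms[THEN L2_measurable] by measurable
  have "\<bar>a * b\<bar> \<le> \<bar>a\<^sup>2 + b\<^sup>2\<bar>" for a b :: real
    using sum_squares_bound[of a b] sum_squares_bound[of a "-b"]
    by (auto simp: abs_if power2_eq_square)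
  then show "AE x in N. norm (f x * g x) \<le> norm ((f x)\<^sup>2 + (g x)\<^sup>2)" by simp
qed

lemma L2_add: assumes "L2 N f" "L2 N g" shows "L2 N (\<lambda>x. f x + g x)"
proof -
  have "integrable N (\<lambda>x. (f x)\<^sup>2 + (g x)\<^sup>2 + 2 * (f x * g x))"
    using assms L2_mult_integrable[OF assms] by (auto simp: L2_def)
  then show ?thesis using assms
    by (auto simp: L2_def power2_sum mult.assoc intro!: borel_measurable_add)
qed

lemma L2_cmult: "L2 N f \<Longrightarrow> L2 N (\<lambda>x. a * f x)"
  by (auto simp: L2_def power_mult_distrib intro!: borel_measurable_times)

lemma L2_minus: "L2 N f \<Longrightarrow> L2 N (\<lambda>x. - f x)"
  by (simp add: L2_def)

lemma L2_diff: "L2 N f \<Longrightarrow> L2 N g \<Longrightarrow> L2 N (\<lambda>x. f x - g x)"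
  using L2_add[OF _ L2_minus] by fastforce

lemma L2_zero[simp]: "L2 N (\<lambda>x. 0)"
  by (simp add: L2_def)

lemma L2_sum: "(\<And>i. i \<in> I \<Longrightarrow> L2 N (f i)) \<Longrightarrow> L2 N (\<lambda>x. \<Sum>i\<in>I. f i x)"
  by (induction I rule: infinite_finite_induct) (auto intro: L2_add)

lemma l2norm_zero[simp]: "l2norm N (\<lambda>x. 0) = 0"
  by (simp add: l2norm_def)

lemma l2norm_cmult: "l2norm N (\<lambda>x. a * f x) = \<bar>a\<bar> * l2norm N f"
  by (simp add: l2norm_def power_mult_distrib real_sqrt_mult)

lemma l2norm_minus: "l2norm N (\<lambda>x. - f x) = l2norm N f"
  by (simp add: l2norm_def)

lemma l2norm_minus_commute: "l2norm N (\<lambda>x. f x - g x) = l2norm N (\<lambda>x. g x - f x)"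
  by (simp add: l2norm_def power2_commute)

lemma l2norm_cong_AE:
  assumes "f \<in> borel_measurable N" "g \<in> borel_measurable N" "AE x in N. f x = g x"
  shows "l2norm N f = l2norm N g"
proof -
  have "(\<integral>x. (f x)\<^sup>2 \<partial>N) = (\<integral>x. (g x)\<^sup>2 \<partial>N)"
    using assms by (intro integral_cong_AE) (auto elim: eventually_mono)
  then show ?thesis by (simp add: l2norm_def)
qed

lemma l2norm_eq_0_iff:
  assumes "L2 N f" shows "l2norm N f = 0 \<longleftrightarrow> (AE x in N. f x = 0)"
  using assms integral_nonneg_eq_0_iff_AE[of N "\<lambda>x. (f x)\<^sup>2"] by (simp add: L2_def l2norm_def)

lemma Cauchy_Schwarz_L2:
  assumes "L2 N f" "L2 N g"
  shows "\<bar>\<integral>x. f x * g x \<partial>N\<bar> \<le> l2norm N f * l2norm N g"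
proof -
  define F where "F = (\<integral>x. (f x)\<^sup>2 \<partial>N)"
  define G where "G = (\<integral>x. (g x)\<^sup>2 \<partial>N)"
  define P where "P = (\<integral>x. f x * g x \<partial>N)"
  have nn: "F \<ge> 0" "G \<ge> 0" by (simp_all add: F_def G_def)
  have quad: "0 \<le> F + 2 * t * P + t\<^sup>2 * G" for t
  proof -
    have "0 \<le> (\<integral>x. (f x + t * g x)\<^sup>2 \<partial>N)" by simp
    also have "\<dots> = (\<integral>x. (f x)\<^sup>2 + 2 * t * (f x * g x) + t\<^sup>2 * (g x)\<^sup>2 \<partial>N)"
      by (intro Bochner_Integration.integral_cong) (auto simp: power2_sum power_mult_distrib algebra_simps)
    also have "\<dots> = F + 2 * t * P + t\<^sup>2 * G"
      using assms L2_mult_integrable[OF assms] by (simp add: L2_def F_def G_def P_def)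
    finally show ?thesis .
  qed
  have "P\<^sup>2 \<le> F * G"
  proof (cases "G = 0")
    case True
    have "P = 0"
    proof (rule ccontr)
      assume "P \<noteq> 0"
      then show False using quad[of "-(F+1)/(2*P)"] True by (simp add: field_simps)
    qed
    then show ?thesis using True by simp
  next
    case False
    then have "G > 0" using nn by simp
    then show ?thesis using quad[of "-P/G"] by (simp add: field_simps power2_eq_square)
  qed
  then have "sqrt (P\<^sup>2) \<le> sqrt (F * G)" by (rule real_sqrt_le_mono)
  then show ?thesis by (simp add: l2norm_def F_def G_def P_def real_sqrt_mult)
qed

lemma l2norm_triangle:
  assumes "L2 N f" "L2 N g"
  shows "l2norm N (\<lambda>x. f x + g x) \<le> l2norm N f + l2norm N g"
proof -
  have "(l2norm N (\<lambda>x. f x + g x))\<^sup>2 = (\<integral>x. (f x)\<^sup>2 + 2 * (f x * g x) + (g x)\<^sup>2 \<partial>N)"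
    unfolding l2norm_power2
    by (intro Bochner_Integration.integral_cong) (auto simp: power2_sum algebra_simps)
  also have "\<dots> = (l2norm N f)\<^sup>2 + 2 * (\<integral>x. f x * g x \<partial>N) + (l2norm N g)\<^sup>2"
    using assms L2_mult_integrable[OF assms] by (simp add: L2_def l2norm_power2)
  also have "\<dots> \<le> (l2norm N f)\<^sup>2 + 2 * (l2norm N f * l2norm N g) + (l2norm N g)\<^sup>2"
    using Cauchy_Schwarz_L2[OF assms] by simp
  also have "\<dots> = (l2norm N f + l2norm N g)\<^sup>2" by (simp add: power2_sum)
  finally show ?thesis by (rule power2_le_imp_le) simp
qed

lemma l2norm_triangle_diff:
  assumes "L2 N f" "L2 N g"
  shows "\<bar>l2norm N f - l2norm N g\<bar> \<le> l2norm N (\<lambda>x. f x - g x)"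
  using l2norm_triangle[OF L2_diff[OF assms] assms(2)]
    l2norm_triangle[OF L2_diff[OF assms(2,1)] assms(1)] l2norm_minus_commute[of N f g]
  by simp

lemma l2norm_sum:
  assumes "\<And>i. i \<in> I \<Longrightarrow> L2 N (f i)"
  shows "l2norm N (\<lambda>x. \<Sum>i\<in>I. f i x) \<le> (\<Sum>i\<in>I. l2norm N (f i))"
  using assms
proof (induction I rule: infinite_finite_induct)
  case (insert i I)
  have "l2norm N (\<lambda>x. f i x + (\<Sum>i\<in>I. f i x)) \<le> l2norm N (f i) + l2norm N (\<lambda>x. \<Sum>i\<in>I. f i x)"
    using insert.prems by (intro l2norm_triangle L2_sum) auto
  then show ?case using insert by fastforce
qed simp_all

lemma l2norm_tendsto:
  assumes "\<And>n. L2 N (f n)" "L2 N g" "(\<lambda>n. l2norm N (\<lambda>x. f n x - g x)) \<longlonglongrightarrow> 0"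
  shows "(\<lambda>n. l2norm N (f n)) \<longlonglongrightarrow> l2norm N g"
proof (rule LIM_zero_cancel, rule Lim_null_comparison[OF _ assms(3)])
  show "\<forall>\<^sub>F n in sequentially. norm (l2norm N (f n) - l2norm N g) \<le> l2norm N (\<lambda>x. f n x - g x)"
    using l2norm_triangle_diff[OF assms(1) assms(2)] by auto
qed

lemma L2_inner_tendsto:
  assumes "\<And>n. L2 N (f n)" "L2 N g" "(\<lambda>n. l2norm N (\<lambda>x. f n x - g x)) \<longlonglongrightarrow> 0" "L2 N h"
  shows "(\<lambda>n. \<integral>x. f n x * h x \<partial>N) \<longlonglongrightarrow> (\<integral>x. g x * h x \<partial>N)"
proof (rule LIM_zero_cancel, rule Lim_null_comparison)
  show "(\<lambda>n. l2norm N (\<lambda>x. f n x - g x) * l2norm N h) \<longlonglongrightarrow> 0"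
    using tendsto_mult_left_zero[OF assms(3)] by blast
  show "\<forall>\<^sub>F n in sequentially. norm ((\<integral>x. f n x * h x \<partial>N) - (\<integral>x. g x * h x \<partial>N))
      \<le> l2norm N (\<lambda>x. f n x - g x) * l2norm N h"
  proof (rule always_eventually, rule allI)
    fix n
    have "(\<integral>x. f n x * h x \<partial>N) - (\<integral>x. g x * h x \<partial>N) = (\<integral>x. (f n x - g x) * h x \<partial>N)"
      using L2_mult_integrable[OF assms(1,4)] L2_mult_integrable[OF assms(2,4)]
      by (simp add: left_diff_distrib)
    then show "norm ((\<integral>x. f n x * h x \<partial>N) - (\<integral>x. g x * h x \<partial>N))
      \<le> l2norm N (\<lambda>x. f n x - g x) * l2norm N h"
      using Cauchy_Schwarz_L2[OF L2_diff[OF assms(1) assms(2)] assms(4), of n] by simp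
  qed
qed

lemma l2norm_dominated_convergence:
  assumes f: "\<And>n. f n \<in> borel_measurable N" and g: "g \<in> borel_measurable N" and h: "L2 N h"
    and bd: "\<And>n. AE x in N. \<bar>f n x\<bar> \<le> h x" and lim: "AE x in N. (\<lambda>n. f n x) \<longlonglongrightarrow> g x"
  shows "L2 N g" "(\<lambda>n. l2norm N (\<lambda>x. f n x - g x)) \<longlonglongrightarrow> 0"
proof -
  have "AE x in N. \<forall>n. \<bar>f n x\<bar> \<le> h x" using bd by (simp add: AE_all_countable)
  with lim have gb: "AE x in N. \<bar>g x\<bar> \<le> \<bar>h x\<bar>"
  proof eventually_elim
    case (elim x)
    then have "\<bar>g x\<bar> \<le> h x"
      by (intro LIMSEQ_le_const2[OF tendsto_rabs]) auto
    then show ?case by simp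
  qed
  then show "L2 N g" using L2_bound g h by blast
  have "(\<lambda>n. \<integral>x. (f n x - g x)\<^sup>2 \<partial>N) \<longlonglongrightarrow> (\<integral>x. 0 \<partial>N)"
  proof (rule integral_dominated_convergence[where w="\<lambda>x. (2 * h x)\<^sup>2"])
    show "integrable N (\<lambda>x. (2 * h x)\<^sup>2)" using L2_cmult[OF h, of 2] by (simp add: L2_def)
    show "AE x in N. (\<lambda>n. (f n x - g x)\<^sup>2) \<longlonglongrightarrow> 0"
      using lim by eventually_elim (auto intro: tendsto_eq_intros LIM_zero)
    fix n
    show "AE x in N. norm ((f n x - g x)\<^sup>2) \<le> (2 * h x)\<^sup>2"
      using bd[of n] gb
    proof eventually_elim
      case (elim x)
      then have "\<bar>f n x - g x\<bar> \<le> \<bar>2 * h x\<bar>" by linarith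
      then show ?case by (simp add: abs_le_square_iff)
    qed
  qed (use f g in measurable)
  then show "(\<lambda>n. l2norm N (\<lambda>x. f n x - g x)) \<longlonglongrightarrow> 0"
    unfolding l2norm_def using tendsto_real_sqrt by fastforce
qed

lemma (in finite_measure) L2_const: "L2 M (\<lambda>x. a)"
  by (simp add: L2_def)

lemma (in finite_measure) L2_integrable:
  assumes "L2 M f" shows "integrable M f"
  using L2_mult_integrable[OF assms L2_const[of 1]] by simp

lemma L2_nn_integral:
  assumes "f \<in> borel_measurable N" "(\<integral>\<^sup>+x. ennreal ((f x)\<^sup>2) \<partial>N) < \<infinity>"
  shows "L2 N f"
  unfolding L2_def by (intro conjI integrableI_bounded) (use assms in auto)

lemma nn_integral_l2norm:
  assumes "L2 N f"
  shows "(\<integral>\<^sup>+x. ennreal ((f x)\<^sup>2) \<partial>N) = ennreal ((l2norm N f)\<^sup>2)"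
  using assms by (simp add: L2_def l2norm_power2 nn_integral_eq_integral)

lemma l2norm_tendsto_0_nn:
  assumes "\<And>n. L2 N (f n)" "(\<lambda>n. \<integral>\<^sup>+x. ennreal ((f n x)\<^sup>2) \<partial>N) \<longlonglongrightarrow> 0"
  shows "(\<lambda>n. l2norm N (f n)) \<longlonglongrightarrow> 0"
proof -
  have "(\<lambda>n. (l2norm N (f n))\<^sup>2) \<longlonglongrightarrow> 0"
    using assms(2) unfolding nn_integral_l2norm[OF assms(1)]
    by (subst (asm) ennreal_0[symmetric], subst (asm) tendsto_ennreal_iff) auto
  from tendsto_real_sqrt[OF this] show ?thesis by simp
qed

section \<open>Exponential moments of the normal distribution\<close>

definition gauss_exp_moment :: "real \<Rightarrow> nat \<Rightarrow> real" where
  "gauss_exp_moment K p = (\<integral>x. exp (K * \<bar>x\<bar>) * \<bar>x\<bar> ^ p \<partial>std_normal_distribution)"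

lemma prob_space_std_normal: "prob_space std_normal_distribution"
  using real_dist_normal_dist by (simp add: real_distribution_def)

lemma integrable_exp_std_normal: "integrable std_normal_distribution (\<lambda>x. exp (a * x))"
proof -
  have "std_normal_density x * exp (a * x) = exp (a\<^sup>2 / 2) * normal_density a 1 x" for x
  proof -
    have "- x\<^sup>2 / 2 + a * x = a\<^sup>2 / 2 + (- (x - a)\<^sup>2 / 2)"
      by (simp add: power2_diff field_simps)
    then have "exp (- x\<^sup>2 / 2) * exp (a * x) = exp (a\<^sup>2 / 2) * exp (- (x - a)\<^sup>2 / 2)"
      by (simp only: exp_add[symmetric])
    then show ?thesis by (simp add: normal_density_def)
  qed
  then show ?thesis
    by (subst integrable_density) auto
qed

lemma power_le_fact_exp:
  fixes x :: real assumes "0 \<le> x" shows "x ^ p \<le> fact p * exp x"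
proof -
  have "x ^ p / fact p \<le> (\<Sum>n. x ^ n / fact n)"
    using summable_exp[of x] assms
    by (intro sum_le_suminf[of "\<lambda>n. x ^ n / fact n" "{p}", simplified]) (auto simp: field_simps)
  then have "x ^ p / fact p \<le> exp x"
    by (simp add: exp_def scaleR_conv_of_real field_simps)
  then show ?thesis by (simp add: field_simps)
qed

lemma exp_abs_le: "exp (a * \<bar>x\<bar>) \<le> exp (a * x) + exp (- a * x)" for a x :: real
proof (cases "0 \<le> x")
  case True
  then have "exp (a * \<bar>x\<bar>) = exp (a * x)" by simp
  then show ?thesis using exp_gt_zero[of "- a * x"] by linarith
next
  case False
  then have "exp (a * \<bar>x\<bar>) = exp (- a * x)" by simp
  then show ?thesis using exp_gt_zero[of "a * x"] by linarith
qed

lemma integrable_gauss_exp_moment: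
  "integrable std_normal_distribution (\<lambda>x. exp (K * \<bar>x\<bar>) * \<bar>x\<bar> ^ p)"
proof (rule Bochner_Integration.integrable_bound)
  show "integrable std_normal_distribution (\<lambda>x. fact p * (exp ((\<bar>K\<bar> + 1) * x) + exp (- (\<bar>K\<bar> + 1) * x)))"
    using integrable_exp_std_normal[of "\<bar>K\<bar> + 1"] integrable_exp_std_normal[of "- (\<bar>K\<bar> + 1)"] by auto
  show "(\<lambda>x. exp (K * \<bar>x\<bar>) * \<bar>x\<bar> ^ p) \<in> borel_measurable std_normal_distribution" by simp
  have "norm (exp (K * \<bar>x\<bar>) * \<bar>x\<bar> ^ p)
      \<le> norm (fact p * (exp ((\<bar>K\<bar> + 1) * x) + exp (- (\<bar>K\<bar> + 1) * x)))" for x :: real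
  proof -
    have "exp (K * \<bar>x\<bar>) * \<bar>x\<bar> ^ p \<le> exp (\<bar>K\<bar> * \<bar>x\<bar>) * (fact p * exp \<bar>x\<bar>)"
      by (intro mult_mono power_le_fact_exp) (auto intro: mult_right_mono)
    also have "\<dots> = fact p * exp ((\<bar>K\<bar> + 1) * \<bar>x\<bar>)"
      by (simp add: exp_add[symmetric] algebra_simps)
    also have "\<dots> \<le> fact p * (exp ((\<bar>K\<bar> + 1) * x) + exp (- (\<bar>K\<bar> + 1) * x))"
      by (intro mult_left_mono exp_abs_le) simp
    finally show ?thesis by (simp add: add_nonneg_nonneg)
  qed
  then show "AE x in std_normal_distribution. norm (exp (K * \<bar>x\<bar>) * \<bar>x\<bar> ^ p)
      \<le> norm (fact p * (exp ((\<bar>K\<bar> + 1) * x) + exp (- (\<bar>K\<bar> + 1) * x)))" by simp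
qed

lemma gauss_exp_moment_nonneg: "0 \<le> gauss_exp_moment K p"
  by (simp add: gauss_exp_moment_def)

text \<open>This is the characteristic function of the normal distribution: averaging multiplies the sine of
  frequency $l$ by a constant, so sines remain sines under the heat flow.\<close>

lemma gauss_expectation_sin:
  "(\<integral>y. sin (l * (x + r * y)) \<partial>std_normal_distribution) = exp (- (l\<^sup>2 * r\<^sup>2) / 2) * sin (l * x)"
proof -
  interpret real_distribution std_normal_distribution by (rule real_dist_normal_dist)
  have "(\<integral>y. sin (l * (x + r * y)) \<partial>std_normal_distribution)
      = (\<integral>y. Im (iexp (l * x) * iexp (l * r * y)) \<partial>std_normal_distribution)"
    by (intro Bochner_Integration.integral_cong refl) (simp add: exp_add[symmetric] ring_distribs Im_exp mult.assoc)
  also have "\<dots> = Im (iexp (l * x) * char std_normal_distribution (l * r))"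
  proof -
    have "integrable std_normal_distribution (\<lambda>y. iexp (l * r * y))"
      by (rule integrable_iexp) auto
    then show ?thesis by (simp add: char_def)
  qed
  also have "\<dots> = exp (- (l\<^sup>2 * r\<^sup>2) / 2) * sin (l * x)"
    by (simp add: char_std_normal_distribution Im_exp power_mult_distrib Re_exp exp_of_real
      del: of_real_exp of_real_mult)
  finally show ?thesis .
qed

section \<open>Independence of increments from the past\<close>

context std_brownian_motion
begin

abbreviation F :: "real \<Rightarrow> 'a measure" where
  "F t \<equiv> natural_filtration M B t"

lemma space_F: "space (F t) = space M"
  by (simp add: natural_filtration_def space_measure_of_conv)

lemma sets_F: "sets (F t) = sigma_sets (space M)
    {B s -` A \<inter> space M | s A. 0 \<le> s \<and> s \<le> t \<and> A \<in> sets borel}"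
  unfolding natural_filtration_def by (rule sets_measure_of) auto

lemma sets_F_subset: "sets (F t) \<subseteq> sets M"
  unfolding sets_F using measurable_sets[OF measurable_B] by (intro sets.sigma_sets_subset) auto

lemma measurable_F_M: "f \<in> borel_measurable (F t) \<Longrightarrow> f \<in> borel_measurable M"
  using sets_F_subset[of t] by (auto simp: measurable_def space_F)

lemma measurable_F_mono: "f \<in> borel_measurable (F s) \<Longrightarrow> s \<le> t \<Longrightarrow> f \<in> borel_measurable (F t)"
proof -
  assume "s \<le> t"
  then have "sets (F s) \<subseteq> sets (F t)"
    unfolding sets_F by (intro sigma_sets_mono') force
  moreover assume "f \<in> borel_measurable (F s)"
  ultimately show ?thesis by (auto simp: measurable_def space_F)
qed

lemma measurable_B_F: "0 \<le> s \<Longrightarrow> s \<le> t \<Longrightarrow> B s \<in> borel_measurable (F t)"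
  by (rule measurableI) (auto simp: sets_F space_F intro!: sigma_sets.Basic)

text \<open>Finitely many values \<open>B r\<close> with \<open>r \<le> s\<close> are, almost surely, partial sums of increments over a
  partition of \<open>[0, s]\<close>, because \<open>B 0 = 0\<close>; these are independent of the increment over \<open>[s, t]\<close>.\<close>

lemma prob_cylinder_increment:
  assumes "finite S" "S \<subseteq> {0..s}" "0 \<le> s" "s < t" "\<And>r. A r \<in> sets borel" "D \<in> sets borel"
  shows "prob ({\<omega>\<in>space M. \<forall>r\<in>S. B r \<omega> \<in> A r} \<inter> ((\<lambda>\<omega>. B t \<omega> - B s \<omega>) -` D \<inter> space M))
    = prob {\<omega>\<in>space M. \<forall>r\<in>S. B r \<omega> \<in> A r} * prob ((\<lambda>\<omega>. B t \<omega> - B s \<omega>) -` D \<inter> space M)"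
proof -
  \<comment> \<open>The partition consists of \<open>0\<close>, the times in \<open>S\<close> and \<open>s\<close>, followed by \<open>t\<close>; its last
    increment is the one over \<open>[s, t]\<close>.\<close>
  define l where "l = sorted_list_of_set (insert 0 (insert s S))"
  define n where "n = length l - 1"
  have fin: "finite (insert 0 (insert s S))" using assms by simp
  have setl: "set l = insert 0 (insert s S)" unfolding l_def by (simp only: set_sorted_list_of_set[OF fin])
  have sl: "sorted l" unfolding l_def by simp
  have ln: "length l = Suc n" unfolding n_def using setl by (cases l) auto
  have l0: "l ! 0 = 0"
  proof -
    obtain j where j: "j < length l" "l ! j = 0" using setl by (metis in_set_conv_nth insertI1)
    then have "l ! 0 \<le> 0" using sorted_nth_mono[OF sl, of 0 j] by simp
    moreover have "l ! 0 \<in> insert 0 (insert s S)" using setl ln by (metis nth_mem zero_less_Suc)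
    ultimately show ?thesis using assms(2,3) by auto
  qed
  have lN: "l ! n = s"
  proof -
    obtain j where j: "j < length l" "l ! j = s" using setl by (metis in_set_conv_nth insertI1 insertI2)
    then have "s \<le> l ! n" using sorted_nth_mono[OF sl, of j n] ln by simp
    moreover have "l ! n \<in> insert 0 (insert s S)" using setl ln by (metis nth_mem lessI)
    ultimately show ?thesis using assms(2,3) by auto
  qed
  define \<tau> where "\<tau> i = (if i \<le> n then l ! i else t)" for i
  define X where "X i \<omega> = B (\<tau> (Suc i)) \<omega> - B (\<tau> i) \<omega>" for i \<omega>
  have \<tau>0: "\<tau> 0 = 0" by (simp add: \<tau>_def l0)
  have mono: "\<tau> i \<le> \<tau> (Suc i)" if "i < Suc n" for i
  proof (cases "i = n")
    case True
    then show ?thesis using lN assms(4) by (simp add: \<tau>_def)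
  next
    case False
    then show ?thesis using that sorted_nth_mono[OF sl, of i "Suc i"] ln by (simp add: \<tau>_def)
  qed
  have ind: "indep_vars (\<lambda>_. borel) X {..<Suc n}"
    unfolding X_def[abs_def] using \<tau>0 by (intro indep_increments mono) auto
  have iv: "indep_var (PiM {..<n} (\<lambda>_. borel)) (\<lambda>\<omega>. restrict (\<lambda>i. X i \<omega>) {..<n})
      (PiM {n} (\<lambda>_. borel)) (\<lambda>\<omega>. restrict (\<lambda>i. X i \<omega>) {n})"
    by (rule indep_var_restrict[OF ind]) auto
  have Xn: "X n = (\<lambda>\<omega>. B t \<omega> - B s \<omega>)" by (simp add: X_def \<tau>_def lN fun_eq_iff)
  have "\<exists>j. j \<le> n \<and> \<tau> j = r" if "r \<in> S" for r
    using that setl ln unfolding \<tau>_def by (metis in_set_conv_nth insertI2 less_Suc_eq_le)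
  then obtain idx where idx: "\<And>r. r \<in> S \<Longrightarrow> idx r \<le> n \<and> \<tau> (idx r) = r" by metis
  define C where "C = {x \<in> space (PiM {..<n} (\<lambda>_. borel)). \<forall>r\<in>S. (\<Sum>i<idx r. x i) \<in> A r}"
  have mC: "C \<in> sets (PiM {..<n} (\<lambda>_. borel :: real measure))"
    unfolding C_def
  proof (intro sets.sets_Collect_finite_All[OF _ assms(1)])
    fix r assume r: "r \<in> S"
    have "(\<lambda>x. \<Sum>i<idx r. x i) \<in> borel_measurable (PiM {..<n} (\<lambda>_. borel :: real measure))"
      using idx[OF r] by (intro borel_measurable_sum measurable_component_singleton) auto
    then show "{x \<in> space (PiM {..<n} (\<lambda>_. borel)). (\<Sum>i<idx r. x i) \<in> A r} \<in> sets (PiM {..<n} (\<lambda>_. borel))"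
      using assms(5) by measurable
  qed
  define D' where "D' = {x \<in> space (PiM {n} (\<lambda>_. borel :: real measure)). x n \<in> D}"
  have mD': "D' \<in> sets (PiM {n} (\<lambda>_. borel))"
    unfolding D'_def using assms(6) measurable_component_singleton[of n "{n}" "\<lambda>_. borel :: real measure"]
    by measurable
  have D'_eq: "(\<lambda>\<omega>. restrict (\<lambda>i. X i \<omega>) {n}) -` D' \<inter> space M = X n -` D \<inter> space M"
    by (auto simp: D'_def space_PiM)
  have tel: "(\<Sum>i<j. X i \<omega>) = B (\<tau> j) \<omega> - B (\<tau> 0) \<omega>" for j \<omega>
    unfolding X_def by (rule sum_lessThan_telescope)
  have EC: "AE \<omega> in M. (\<omega> \<in> {\<omega>\<in>space M. \<forall>r\<in>S. B r \<omega> \<in> A r}) \<longleftrightarrow>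
      \<omega> \<in> (\<lambda>\<omega>. restrict (\<lambda>i. X i \<omega>) {..<n}) -` C \<inter> space M"
    using start_zero AE_space
  proof eventually_elim
    case (elim \<omega>)
    have "(\<Sum>i<idx r. restrict (\<lambda>i. X i \<omega>) {..<n} i) = B r \<omega>" if "r \<in> S" for r
    proof -
      have "(\<Sum>i<idx r. restrict (\<lambda>i. X i \<omega>) {..<n} i) = (\<Sum>i<idx r. X i \<omega>)"
        using idx[OF that] by (intro sum.cong) auto
      then show ?thesis using tel[of \<omega> "idx r"] \<tau>0 elim idx[OF that] by simp
    qed
    then show ?case using elim by (auto simp: C_def space_PiM)
  qed
  have mr: "(\<lambda>\<omega>. restrict (\<lambda>i. X i \<omega>) {..<n}) \<in> measurable M (PiM {..<n} (\<lambda>_. borel))"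
    and mX: "X n \<in> borel_measurable M"
    using indep_var_rv1[OF iv] ind by (auto simp: indep_vars_def)
  have mE: "{\<omega>\<in>space M. \<forall>r\<in>S. B r \<omega> \<in> A r} \<in> sets M"
  proof (intro sets.sets_Collect_finite_All[OF _ assms(1)])
    fix r assume "r \<in> S"
    then have "B r \<in> borel_measurable M" using assms(2) by (intro measurable_B) auto
    then show "{\<omega> \<in> space M. B r \<omega> \<in> A r} \<in> sets M" using assms(5) by measurable
  qed
  have mD: "X n -` D \<inter> space M \<in> sets M" using mX assms(6) by measurable
  have mrC: "(\<lambda>\<omega>. restrict (\<lambda>i. X i \<omega>) {..<n}) -` C \<inter> space M \<in> sets M"
    using mr mC by measurable
  have "prob ({\<omega>\<in>space M. \<forall>r\<in>S. B r \<omega> \<in> A r} \<inter> (X n -` D \<inter> space M))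
      = prob (((\<lambda>\<omega>. restrict (\<lambda>i. X i \<omega>) {..<n}) -` C \<inter> space M) \<inter> (X n -` D \<inter> space M))"
    using EC mE mD mrC by (intro finite_measure_eq_AE) auto
  also have "\<dots> = prob ((\<lambda>\<omega>. (restrict (\<lambda>i. X i \<omega>) {..<n}, restrict (\<lambda>i. X i \<omega>) {n})) -` (C \<times> D') \<inter> space M)"
    unfolding D'_eq[symmetric] by (rule arg_cong[where f=prob]) auto
  also have "\<dots> = prob ((\<lambda>\<omega>. restrict (\<lambda>i. X i \<omega>) {..<n}) -` C \<inter> space M) * prob (X n -` D \<inter> space M)"
    unfolding D'_eq[symmetric] by (rule indep_varD[OF iv mC mD'])
  also have "prob ((\<lambda>\<omega>. restrict (\<lambda>i. X i \<omega>) {..<n}) -` C \<inter> space M) = prob {\<omega>\<in>space M. \<forall>r\<in>S. B r \<omega> \<in> A r}"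
    using EC mE mrC by (intro finite_measure_eq_AE) auto
  finally show ?thesis unfolding Xn .
qed

text \<open>The cylinder sets of times up to \<open>s\<close> form a generator of the past of \<open>s\<close> that is stable under
  intersections, so independence extends from them to the whole sigma-algebra.\<close>

lemma indep_F_increment:
  assumes "0 \<le> s" "s < t" "f \<in> borel_measurable (F s)"
  shows "indep_var borel f borel (\<lambda>\<omega>. B t \<omega> - B s \<omega>)"
proof -
  define G where "G = {{\<omega>\<in>space M. \<forall>r\<in>S. B r \<omega> \<in> A r} | S A.
      finite S \<and> S \<subseteq> {0..s} \<and> (\<forall>r. A r \<in> sets (borel :: real measure))}"
  define H where "H = {(\<lambda>\<omega>. B t \<omega> - B s \<omega>) -` D \<inter> space M | D. D \<in> sets (borel :: real measure)}"
  have mB: "B t \<in> borel_measurable M" "B s \<in> borel_measurable M" using assms measurable_B by auto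
  have GM: "G \<subseteq> events"
  proof
    fix E assume "E \<in> G"
    then obtain S A where E: "E = {\<omega>\<in>space M. \<forall>r\<in>S. B r \<omega> \<in> A r}" "finite S" "S \<subseteq> {0..s}"
        "\<And>r. A r \<in> sets borel" unfolding G_def by blast
    show "E \<in> events" unfolding E(1)
    proof (intro sets.sets_Collect_finite_All[OF _ E(2)])
      fix r assume "r \<in> S"
      then have "B r \<in> borel_measurable M" using E(3) by (intro measurable_B) auto
      then show "{\<omega> \<in> space M. B r \<omega> \<in> A r} \<in> sets M" using E(4) by measurable
    qed
  qed
  have HM: "H \<subseteq> events"
    unfolding H_def using mB by (auto intro!: measurable_sets borel_measurable_diff)
  have "indep_set G H"
  proof (rule indep_setI[OF GM HM])
    fix a b assume "a \<in> G" "b \<in> H"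
    then show "prob (a \<inter> b) = prob a * prob b"
      unfolding G_def H_def using assms by (auto intro!: prob_cylinder_increment)
  qed
  moreover have "Int_stable G"
  proof (rule Int_stableI)
    fix a b assume "a \<in> G" "b \<in> G"
    then obtain S A S' A' where a: "a = {\<omega>\<in>space M. \<forall>r\<in>S. B r \<omega> \<in> A r}" "finite S" "S \<subseteq> {0..s}"
        "\<And>r. A r \<in> sets borel"
      and b: "b = {\<omega>\<in>space M. \<forall>r\<in>S'. B r \<omega> \<in> A' r}" "finite S'" "S' \<subseteq> {0..s}"
        "\<And>r. A' r \<in> sets borel" unfolding G_def by blast
    have "a \<inter> b = {\<omega>\<in>space M. \<forall>r\<in>S \<union> S'. B r \<omega> \<in>
        (if r \<in> S then A r else UNIV) \<inter> (if r \<in> S' then A' r else UNIV)}"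
      unfolding a b by auto
    then show "a \<inter> b \<in> G" unfolding G_def using a b
      by (intro CollectI exI[of _ "S \<union> S'"]
        exI[of _ "\<lambda>r. (if r \<in> S then A r else UNIV) \<inter> (if r \<in> S' then A' r else UNIV)"]) auto
  qed
  moreover have "Int_stable H"
  proof (rule Int_stableI)
    fix a b assume "a \<in> H" "b \<in> H"
    then obtain D D' where "a = (\<lambda>\<omega>. B t \<omega> - B s \<omega>) -` D \<inter> space M" "D \<in> sets borel"
      "b = (\<lambda>\<omega>. B t \<omega> - B s \<omega>) -` D' \<inter> space M" "D' \<in> sets borel" unfolding H_def by blast
    then show "a \<inter> b \<in> H" unfolding H_def by (intro CollectI exI[of _ "D \<inter> D'"]) auto
  qed
  ultimately have *: "indep_set (sigma_sets (space M) G) (sigma_sets (space M) H)"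
    by (rule indep_set_sigma_sets)
  have "sets (F s) \<subseteq> sigma_sets (space M) G"
    unfolding sets_F
  proof (rule sigma_sets_mono, rule subsetI)
    fix E assume "E \<in> {B r -` A \<inter> space M |r A. 0 \<le> r \<and> r \<le> s \<and> A \<in> sets borel}"
    then obtain r A where E: "E = B r -` A \<inter> space M" "0 \<le> r" "r \<le> s" "A \<in> sets borel" by blast
    then have "E \<in> G" unfolding G_def
      by (intro CollectI exI[of _ "{r}"] exI[of _ "\<lambda>_. A"]) auto
    then show "E \<in> sigma_sets (space M) G" by (rule sigma_sets.Basic)
  qed
  moreover have "sigma_sets (space M) {f -` A \<inter> space M |A. A \<in> sets borel} \<subseteq> sets (F s)"
  proof -
    have "{f -` A \<inter> space M |A. A \<in> sets borel} \<subseteq> sets (F s)"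
      using measurable_sets[OF assms(3)] by (auto simp: space_F)
    from sets.sigma_sets_subset[OF this] show ?thesis by (simp add: space_F)
  qed
  ultimately have "indep_set (sigma_sets (space M) {f -` A \<inter> space M |A. A \<in> sets borel})
     (sigma_sets (space M) H)"
    using * unfolding indep_sets2_eq by blast
  then show ?thesis
    unfolding indep_var_eq H_def using measurable_F_M[OF assms(3)] mB by auto
qed

lemma distributed_scaled_increment:
  assumes "0 \<le> s" "s < t"
  shows "distributed M lborel (\<lambda>\<omega>. (B t \<omega> - B s \<omega>) / sqrt (t - s)) std_normal_density"
  using normal_increments[OF assms] assms
  by (subst (asm) normal_standard_normal_convert) auto

lemma
  assumes "0 \<le> s" "s < t" "f \<in> borel_measurable borel"
    and int: "integrable std_normal_distribution (\<lambda>x. f (sqrt (t - s) * x))"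
  shows integrable_increment: "integrable M (\<lambda>\<omega>. f (B t \<omega> - B s \<omega>) :: real)"
    and expectation_increment:
      "expectation (\<lambda>\<omega>. f (B t \<omega> - B s \<omega>)) = (\<integral>x. f (sqrt (t - s) * x) \<partial>std_normal_distribution)"
proof -
  note D = distributed_scaled_increment[OF assms(1,2)]
  have m: "(\<lambda>x. f (sqrt (t - s) * x)) \<in> borel_measurable lborel" using assms(3) by measurable
  have eq: "f (sqrt (t - s) * ((B t \<omega> - B s \<omega>) / sqrt (t - s))) = f (B t \<omega> - B s \<omega>)" for \<omega>
    using assms(2) by simp
  have i: "integrable lborel (\<lambda>x. std_normal_density x * f (sqrt (t - s) * x))"
    using int m by (subst (asm) integrable_density) auto
  show "integrable M (\<lambda>\<omega>. f (B t \<omega> - B s \<omega>))"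
    using distributed_integrable[OF D m] i unfolding eq by simp
  show "expectation (\<lambda>\<omega>. f (B t \<omega> - B s \<omega>)) = (\<integral>x. f (sqrt (t - s) * x) \<partial>std_normal_distribution)"
    using distributed_integral[OF D m] m unfolding eq by (subst integral_density) auto
qed

lemma
  assumes "0 \<le> s" "s < t" "f \<in> borel_measurable borel"
    and int: "integrable std_normal_distribution (\<lambda>x. f (sqrt (t - s) * x))"
    and X: "X \<in> borel_measurable (F s)" "integrable M X"
  shows integrable_mult_increment: "integrable M (\<lambda>\<omega>. X \<omega> * f (B t \<omega> - B s \<omega>) :: real)"
    and expectation_mult_increment:
      "expectation (\<lambda>\<omega>. X \<omega> * f (B t \<omega> - B s \<omega>))
        = expectation X * (\<integral>x. f (sqrt (t - s) * x) \<partial>std_normal_distribution)"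
proof -
  have "indep_var borel (id \<circ> X) borel (f \<circ> (\<lambda>\<omega>. B t \<omega> - B s \<omega>))"
    using indep_F_increment[OF assms(1,2) X(1)] assms(3) by (intro indep_var_compose) auto
  then have iv: "indep_var borel X borel (\<lambda>\<omega>. f (B t \<omega> - B s \<omega>))" by (simp add: comp_def)
  note i = integrable_increment[OF assms(1-4)]
  show "integrable M (\<lambda>\<omega>. X \<omega> * f (B t \<omega> - B s \<omega>))" by (rule indep_var_integrable[OF iv X(2) i])
  show "expectation (\<lambda>\<omega>. X \<omega> * f (B t \<omega> - B s \<omega>))
        = expectation X * (\<integral>x. f (sqrt (t - s) * x) \<partial>std_normal_distribution)"
    using indep_var_lebesgue_integral[OF iv X(2) i] expectation_increment[OF assms(1-4)] by simp
qed

end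

section \<open>Products of Brownian increments\<close>

lemma std_normal_mean: "(\<integral>x. r * x \<partial>std_normal_distribution) = 0"
  using integral_std_normal_distribution_moment_odd[of 1] by simp

lemma integrable_std_normal_polynomial:
  "integrable std_normal_distribution (\<lambda>x. r * x)"
  "integrable std_normal_distribution (\<lambda>x. (r * x)\<^sup>2)"
  "integrable std_normal_distribution (\<lambda>x. (r * x)\<^sup>2 - d)"
  "integrable std_normal_distribution (\<lambda>x. ((r * x)\<^sup>2 - d)\<^sup>2)"
proof -
  interpret prob_space std_normal_distribution by (rule prob_space_std_normal)
  have i: "integrable std_normal_distribution (\<lambda>x. x ^ k)" for k
    by (rule integrable_std_normal_distribution_moment)
  show "integrable std_normal_distribution (\<lambda>x. r * x)" using i[of 1] by simp
  show 2: "integrable std_normal_distribution (\<lambda>x. (r * x)\<^sup>2)"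
    using i[of 2] by (simp add: power_mult_distrib)
  show "integrable std_normal_distribution (\<lambda>x. (r * x)\<^sup>2 - d)" using 2 by simp
  have "((r * x)\<^sup>2 - d)\<^sup>2 = r ^ 4 * x ^ 4 - 2 * d * r\<^sup>2 * x\<^sup>2 + d\<^sup>2" for x :: real
    by algebra
  then show "integrable std_normal_distribution (\<lambda>x. ((r * x)\<^sup>2 - d)\<^sup>2)"
    using i[of 2] i[of 4] by simp
qed

lemma std_normal_variance: "(\<integral>x. (r * x)\<^sup>2 \<partial>std_normal_distribution) = r\<^sup>2"
  using std_normal_distribution_even_moments(1)[of 1]
  by (simp add: power_mult_distrib)

context std_brownian_motion
begin

lemma
  assumes "0 \<le> s" "s \<le> t" "Y \<in> borel_measurable (F s)" "integrable M Y"
  shows integrable_increment_mult: "integrable M (\<lambda>\<omega>. Y \<omega> * (B t \<omega> - B s \<omega>))"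
    and expectation_increment_zero: "expectation (\<lambda>\<omega>. Y \<omega> * (B t \<omega> - B s \<omega>)) = 0"
proof -
  have "integrable M (\<lambda>\<omega>. Y \<omega> * (B t \<omega> - B s \<omega>)) \<and> expectation (\<lambda>\<omega>. Y \<omega> * (B t \<omega> - B s \<omega>)) = 0"
  proof (cases "s = t")
    case False
    then have st: "s < t" using assms by simp
    note i = integrable_std_normal_polynomial(1)[of "sqrt (t - s)"]
    show ?thesis
      using integrable_mult_increment[OF assms(1) st _ i assms(3,4)]
        expectation_mult_increment[OF assms(1) st _ i assms(3,4)] std_normal_mean[of "sqrt (t - s)"]
      by auto
  qed simp
  then show "integrable M (\<lambda>\<omega>. Y \<omega> * (B t \<omega> - B s \<omega>))"
    "expectation (\<lambda>\<omega>. Y \<omega> * (B t \<omega> - B s \<omega>)) = 0" by auto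
qed

lemma
  assumes "0 \<le> s" "s \<le> t" "Y \<in> borel_measurable (F s)" "integrable M Y"
  shows integrable_increment_square: "integrable M (\<lambda>\<omega>. Y \<omega> * (B t \<omega> - B s \<omega>)\<^sup>2)"
    and expectation_increment_square:
      "expectation (\<lambda>\<omega>. Y \<omega> * (B t \<omega> - B s \<omega>)\<^sup>2) = expectation Y * (t - s)"
proof -
  have "integrable M (\<lambda>\<omega>. Y \<omega> * (B t \<omega> - B s \<omega>)\<^sup>2) \<and>
    expectation (\<lambda>\<omega>. Y \<omega> * (B t \<omega> - B s \<omega>)\<^sup>2) = expectation Y * (t - s)"
  proof (cases "s = t")
    case False
    then have st: "s < t" using assms by simp
    note i = integrable_std_normal_polynomial(2)[of "sqrt (t - s)"]
    show ?thesis
      using integrable_mult_increment[OF assms(1) st _ i assms(3,4)] st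
        expectation_mult_increment[OF assms(1) st _ i assms(3,4)] std_normal_variance[of "sqrt (t - s)"]
      by auto
  qed simp
  then show "integrable M (\<lambda>\<omega>. Y \<omega> * (B t \<omega> - B s \<omega>)\<^sup>2)"
    "expectation (\<lambda>\<omega>. Y \<omega> * (B t \<omega> - B s \<omega>)\<^sup>2) = expectation Y * (t - s)" by auto
qed

lemma measurable_increment_F:
  "0 \<le> a \<Longrightarrow> a \<le> b \<Longrightarrow> b \<le> s \<Longrightarrow> (\<lambda>\<omega>. B b \<omega> - B a \<omega>) \<in> borel_measurable (F s)"
  using measurable_B_F[of a s] measurable_B_F[of b s] by auto

lemma L2_increment_mult:
  assumes "0 \<le> s" "s \<le> t" "\<xi> \<in> borel_measurable (F s)" "L2 M \<xi>"
  shows "L2 M (\<lambda>\<omega>. \<xi> \<omega> * (B t \<omega> - B s \<omega>))"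
  unfolding L2_def
proof
  have m: "(\<lambda>\<omega>. (\<xi> \<omega>)\<^sup>2) \<in> borel_measurable (F s)" using assms(3) by measurable
  have "integrable M (\<lambda>\<omega>. (\<xi> \<omega>)\<^sup>2)" using assms(4) by (simp add: L2_def)
  from integrable_increment_square[OF assms(1,2) m this]
  show "integrable M (\<lambda>\<omega>. (\<xi> \<omega> * (B t \<omega> - B s \<omega>))\<^sup>2)" by (simp add: power_mult_distrib)
  show "(\<lambda>\<omega>. \<xi> \<omega> * (B t \<omega> - B s \<omega>)) \<in> borel_measurable M"
    using L2_measurable[OF assms(4)] measurable_B[of s] measurable_B[of t] assms(1,2) by auto
qed

text \<open>Splitting both intervals at \<open>c\<close> and at the smaller of their right endpoints writes the product as a
  sum of products of increments over disjoint intervals, which have mean zero, and of one square over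
  the common part of the two intervals. Arbitrary pairs of intervals are treated so that simple integrands
  over different partitions never need a common refinement.\<close>

lemma expectation_increment_product_aux:
  assumes "0 \<le> a" "a < b" "c < d" "a \<le> c"
    and \<xi>: "\<xi> \<in> borel_measurable (F a)" "L2 M \<xi>" and \<eta>: "\<eta> \<in> borel_measurable (F c)" "L2 M \<eta>"
  shows "expectation (\<lambda>\<omega>. \<xi> \<omega> * (B b \<omega> - B a \<omega>) * (\<eta> \<omega> * (B d \<omega> - B c \<omega>)))
    = expectation (\<lambda>\<omega>. \<xi> \<omega> * \<eta> \<omega>) * max 0 (min b d - max a c)"
proof (cases "b \<le> c")
  case True
  have L: "L2 M (\<lambda>\<omega>. \<xi> \<omega> * (B b \<omega> - B a \<omega>))" using assms by (intro L2_increment_mult) auto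
  have m: "(\<lambda>\<omega>. \<xi> \<omega> * (B b \<omega> - B a \<omega>) * \<eta> \<omega>) \<in> borel_measurable (F c)"
    using measurable_F_mono[OF \<xi>(1) assms(4)] measurable_increment_F[of a b c] \<eta>(1) assms True by auto
  have "expectation (\<lambda>\<omega>. \<xi> \<omega> * (B b \<omega> - B a \<omega>) * \<eta> \<omega> * (B d \<omega> - B c \<omega>)) = 0"
    using L2_mult_integrable[OF L \<eta>(2)] m assms by (intro expectation_increment_zero) auto
  then show ?thesis using True assms by (simp add: mult.assoc)
next
  case False
  define e where "e = min b d"
  have ce: "0 \<le> c" "c \<le> e" "0 \<le> e" "e \<le> b" "e \<le> d" "c < e" using False assms by (auto simp: e_def)
  have \<xi>c: "\<xi> \<in> borel_measurable (F c)" using measurable_F_mono[OF \<xi>(1) assms(4)] .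
  have \<eta>e: "\<eta> \<in> borel_measurable (F e)" and \<xi>e: "\<xi> \<in> borel_measurable (F e)"
    using measurable_F_mono[OF \<eta>(1) ce(2)] measurable_F_mono[OF \<xi>c ce(2)] by auto
  define t1 where "t1 \<omega> = \<xi> \<omega> * (B c \<omega> - B a \<omega>) * \<eta> \<omega> * (B d \<omega> - B c \<omega>)" for \<omega>
  define t2 where "t2 \<omega> = \<xi> \<omega> * \<eta> \<omega> * (B e \<omega> - B c \<omega>)\<^sup>2" for \<omega>
  define t3 where "t3 \<omega> = \<xi> \<omega> * (B e \<omega> - B c \<omega>) * \<eta> \<omega> * (B d \<omega> - B e \<omega>)" for \<omega>
  define t4 where "t4 \<omega> = \<xi> \<omega> * (B e \<omega> - B c \<omega>) * \<eta> \<omega> * (B b \<omega> - B e \<omega>)" for \<omega>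
  have m1: "(\<lambda>\<omega>. \<xi> \<omega> * (B c \<omega> - B a \<omega>) * \<eta> \<omega>) \<in> borel_measurable (F c)"
    using \<xi>c \<eta>(1) measurable_increment_F[of a c c] assms by auto
  have i1: "integrable M (\<lambda>\<omega>. \<xi> \<omega> * (B c \<omega> - B a \<omega>) * \<eta> \<omega>)"
    using L2_mult_integrable[OF L2_increment_mult[OF assms(1,4) \<xi>] \<eta>(2)] .
  have m3: "(\<lambda>\<omega>. \<xi> \<omega> * (B e \<omega> - B c \<omega>) * \<eta> \<omega>) \<in> borel_measurable (F e)"
    using \<xi>e \<eta>e measurable_increment_F[of c e e] ce by auto
  have i3: "integrable M (\<lambda>\<omega>. \<xi> \<omega> * (B e \<omega> - B c \<omega>) * \<eta> \<omega>)"
    using L2_mult_integrable[OF L2_increment_mult[OF ce(1,2) \<xi>c \<xi>(2)] \<eta>(2)] .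
  have m2: "(\<lambda>\<omega>. \<xi> \<omega> * \<eta> \<omega>) \<in> borel_measurable (F c)" using \<xi>c \<eta>(1) by auto
  have "\<xi> \<omega> * (B b \<omega> - B a \<omega>) * (\<eta> \<omega> * (B d \<omega> - B c \<omega>)) = t1 \<omega> + t2 \<omega> + t3 \<omega> + t4 \<omega>" for \<omega>
  proof -
    have "(B b \<omega> - B e \<omega>) * (B d \<omega> - B e \<omega>) = 0" by (auto simp: e_def min_def)
    then show ?thesis unfolding t1_def t2_def t3_def t4_def power2_eq_square by algebra
  qed
  then have "expectation (\<lambda>\<omega>. \<xi> \<omega> * (B b \<omega> - B a \<omega>) * (\<eta> \<omega> * (B d \<omega> - B c \<omega>)))
      = expectation (\<lambda>\<omega>. t1 \<omega> + t2 \<omega> + t3 \<omega> + t4 \<omega>)" by simp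
  also have "\<dots> = expectation t1 + expectation t2 + expectation t3 + expectation t4"
  proof -
    have "integrable M t1" "integrable M t2" "integrable M t3" "integrable M t4"
      unfolding t1_def[abs_def] t2_def[abs_def] t3_def[abs_def] t4_def[abs_def]
      using integrable_increment_mult[OF _ _ m1 i1, of d] integrable_increment_mult[OF _ _ m3 i3, of d]
        integrable_increment_mult[OF _ _ m3 i3, of b]
        integrable_increment_square[OF _ _ m2 L2_mult_integrable[OF \<xi>(2) \<eta>(2)], of e] ce assms by auto
    then show ?thesis by simp
  qed
  also have "\<dots> = expectation (\<lambda>\<omega>. \<xi> \<omega> * \<eta> \<omega>) * (e - c)"
    unfolding t1_def t2_def t3_def t4_def
    using expectation_increment_zero[OF _ _ m1 i1, of d] expectation_increment_zero[OF _ _ m3 i3, of d]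
        expectation_increment_zero[OF _ _ m3 i3, of b]
        expectation_increment_square[OF _ _ m2 L2_mult_integrable[OF \<xi>(2) \<eta>(2)], of e] ce assms by auto
  finally show ?thesis using ce assms by (simp add: e_def max_def)
qed

lemma expectation_increment_product:
  assumes "0 \<le> a" "a < b" "0 \<le> c" "c < d"
    and \<xi>: "\<xi> \<in> borel_measurable (F a)" "L2 M \<xi>" and \<eta>: "\<eta> \<in> borel_measurable (F c)" "L2 M \<eta>"
  shows "expectation (\<lambda>\<omega>. \<xi> \<omega> * (B b \<omega> - B a \<omega>) * (\<eta> \<omega> * (B d \<omega> - B c \<omega>)))
    = expectation (\<lambda>\<omega>. \<xi> \<omega> * \<eta> \<omega>) * max 0 (min b d - max a c)"
proof (cases "a \<le> c")
  case True
  show ?thesis by (rule expectation_increment_product_aux[OF assms(1,2,4) True \<xi> \<eta>])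
next
  case False
  then have "c \<le> a" by simp
  from expectation_increment_product_aux[OF assms(3,4,2) this \<eta> \<xi>] show ?thesis
    by (simp add: mult.commute min.commute max.commute)
qed

section \<open>A version with continuous paths\<close>

text \<open>The paths of \<open>B\<close> are continuous outside a null set only, and measurability in time and
  scenario jointly is needed for time integrals. The process \<open>W\<close> repairs this by changing \<open>B\<close> on a null
  set. The natural filtration is not complete, so \<open>W\<close> need not be adapted: coefficients of simple integrands
  are always expressed by \<open>B\<close>, and \<open>W\<close> appears in processes that are integrated over time.\<close>

definition good_paths :: "'a set" where
  "good_paths = (SOME A. A \<in> sets M \<and> prob A = 1 \<and> (\<forall>\<omega>\<in>A. continuous_on {0..} (\<lambda>t. B t \<omega>)))"

definition W :: "real \<Rightarrow> 'a \<Rightarrow> real" where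
  "W t \<omega> = (if \<omega> \<in> good_paths then B t \<omega> else 0)"

lemma good_paths: "good_paths \<in> sets M" "prob good_paths = 1"
  "\<omega> \<in> good_paths \<Longrightarrow> continuous_on {0..} (\<lambda>t. B t \<omega>)"
proof -
  obtain N where N: "{\<omega> \<in> space M. \<not> continuous_on {0..} (\<lambda>t. B t \<omega>)} \<subseteq> N" "emeasure M N = 0" "N \<in> sets M"
    using AE_E[OF continuous_paths] by blast
  have "prob (space M - N) = 1" using N(2,3) prob_compl[of N] by (simp add: measure_def)
  then have "\<exists>A. A \<in> sets M \<and> prob A = 1 \<and> (\<forall>\<omega>\<in>A. continuous_on {0..} (\<lambda>t. B t \<omega>))"
    using N by (intro exI[of _ "space M - N"]) auto
  from someI_ex[OF this] show "good_paths \<in> sets M" "prob good_paths = 1"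
    "\<omega> \<in> good_paths \<Longrightarrow> continuous_on {0..} (\<lambda>t. B t \<omega>)"
    unfolding good_paths_def by auto
qed

lemma measurable_W: "0 \<le> t \<Longrightarrow> W t \<in> borel_measurable M"
  unfolding W_def[abs_def] using good_paths(1) measurable_B[of t] by measurable

lemma AE_W_eq_B: "AE \<omega> in M. \<forall>t. W t \<omega> = B t \<omega>"
proof -
  have "AE \<omega> in M. \<omega> \<in> good_paths" using good_paths by (simp add: AE_in_set_eq_1)
  then show ?thesis by eventually_elim (simp add: W_def)
qed

lemma continuous_W: "continuous_on {0..} (\<lambda>t. W t \<omega>)"
  using good_paths(3)[of \<omega>] by (cases "\<omega> \<in> good_paths") (simp_all add: W_def)

text \<open>A process with continuous paths is the limit of its values at the last preceding multiple of
  \<open>1 / (n + 1)\<close>, and these take countably many times as arguments.\<close>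

lemma measurable_W_joint:
  "(\<lambda>x. W (fst x) (snd x)) \<in> borel_measurable (restrict_space lborel {0..T} \<Otimes>\<^sub>M M)"
proof (rule borel_measurable_LIMSEQ_real)
  let ?N = "restrict_space lborel {0..T} \<Otimes>\<^sub>M M"
  let ?f = "\<lambda>n x. W (real (nat \<lfloor>fst x * real (Suc n)\<rfloor>) / real (Suc n)) (snd x)"
  show "?f n \<in> borel_measurable ?N" for n
  proof (rule measurable_compose_countable[where g="\<lambda>x. nat \<lfloor>fst x * real (Suc n)\<rfloor>"])
    show "(\<lambda>x. W (real i / real (Suc n)) (snd x)) \<in> borel_measurable ?N" for i
      using measurable_W[of "real i / real (Suc n)"] by measurable
    have "fst \<in> borel_measurable ?N"
      by (rule measurable_fst'') (auto intro: measurable_restrict_space1)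
    then show "(\<lambda>x. nat \<lfloor>fst x * real (Suc n)\<rfloor>) \<in> measurable ?N (count_space UNIV)"
      by measurable
  qed
  fix x assume "x \<in> space ?N"
  then have x: "0 \<le> fst x" by (auto simp: space_pair_measure space_restrict_space)
  have "(\<lambda>n. real (nat \<lfloor>fst x * real (Suc n)\<rfloor>) / real (Suc n)) \<longlonglongrightarrow> fst x"
  proof (rule real_tendsto_sandwich)
    show "\<forall>\<^sub>F n in sequentially. fst x - 1 / real (Suc n) \<le> real (nat \<lfloor>fst x * real (Suc n)\<rfloor>) / real (Suc n)"
    proof (rule always_eventually, rule allI)
      fix n
      have "fst x * real (Suc n) - 1 \<le> real (nat \<lfloor>fst x * real (Suc n)\<rfloor>)" by linarith
      then have "(fst x * real (Suc n) - 1) / real (Suc n) \<le> real (nat \<lfloor>fst x * real (Suc n)\<rfloor>) / real (Suc n)"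
        by (rule divide_right_mono) simp
      then show "fst x - 1 / real (Suc n) \<le> real (nat \<lfloor>fst x * real (Suc n)\<rfloor>) / real (Suc n)"
        by (simp add: diff_divide_distrib)
    qed
    show "\<forall>\<^sub>F n in sequentially. real (nat \<lfloor>fst x * real (Suc n)\<rfloor>) / real (Suc n) \<le> fst x"
    proof (rule always_eventually, rule allI)
      fix n
      have "real (nat \<lfloor>fst x * real (Suc n)\<rfloor>) \<le> fst x * real (Suc n)" using x by simp
      then show "real (nat \<lfloor>fst x * real (Suc n)\<rfloor>) / real (Suc n) \<le> fst x"
        by (subst pos_divide_le_eq) auto
    qed
    show "(\<lambda>n. fst x - 1 / real (Suc n)) \<longlonglongrightarrow> fst x"
      using tendsto_diff[OF tendsto_const LIMSEQ_inverse_real_of_nat, of "fst x"] by (simp add: inverse_eq_divide)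
  qed simp
  from continuous_on_tendsto_compose[OF continuous_W this]
  show "(\<lambda>n. ?f n x) \<longlonglongrightarrow> W (fst x) (snd x)" using x by (simp add: always_eventually)
qed

end

section \<open>Time and scenarios\<close>

text \<open>A Brownian motion together with a time horizon: \<open>lam\<close> is Lebesgue measure on the horizon and
  \<open>mu\<close> the measure with respect to which integrands are square-integrable.\<close>

locale bm_horizon = std_brownian_motion +
  fixes T :: real
  assumes T_pos: "0 < T"
begin

definition lam :: "real measure" where "lam = restrict_space lborel {0..T}"
abbreviation mu :: "(real \<times> 'a) measure" where "mu \<equiv> lam \<Otimes>\<^sub>M M"

lemma space_lam[simp]: "space lam = {0..T}"
  by (simp add: lam_def space_restrict_space)

lemma emeasure_lam: "A \<subseteq> {0..T} \<Longrightarrow> emeasure lam A = emeasure lborel A"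
  unfolding lam_def by (rule emeasure_restrict_space) auto

lemma finite_measure_lam: "finite_measure lam"
  by (rule finite_measureI) (use T_pos in \<open>simp add: emeasure_lam\<close>)

sublocale lam: finite_measure lam by (rule finite_measure_lam)
sublocale pm: pair_sigma_finite lam M ..

lemma finite_measure_mu: "finite_measure mu"
  by (rule finite_measure_pair_measure) (auto intro: finite_measure_lam finite_measure_axioms)

sublocale mu: finite_measure mu by (rule finite_measure_mu)

lemma space_mu: "space mu = {0..T} \<times> space M"
  by (simp add: space_pair_measure)

lemma measurable_lam: "f \<in> borel_measurable borel \<Longrightarrow> f \<in> borel_measurable lam"
  unfolding lam_def by (auto intro: measurable_restrict_space1)

lemma measurable_mu_time: "f \<in> borel_measurable borel \<Longrightarrow> (\<lambda>x. f (fst x)) \<in> borel_measurable mu"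
  using measurable_compose[OF measurable_fst measurable_lam] by auto

lemma measurable_mu_fst: "fst \<in> borel_measurable mu"
  using measurable_mu_time[of "\<lambda>x. x"] by simp

lemma measurable_mu_snd: "f \<in> borel_measurable M \<Longrightarrow> (\<lambda>x. f (snd x)) \<in> borel_measurable mu"
  using measurable_compose[OF measurable_snd] by blast

lemma measurable_mu_indicator: "A \<in> sets borel \<Longrightarrow> (\<lambda>x. indicator A (fst x) :: real) \<in> borel_measurable mu"
  using measurable_mu_time[of "indicator A"] by simp

lemma measure_lam_Ioc: "0 \<le> a \<Longrightarrow> a \<le> b \<Longrightarrow> b \<le> T \<Longrightarrow> measure lam {a<..b} = b - a"
  by (subst measure_def, subst emeasure_lam) auto

lemma AE_mu_snd: "AE \<omega> in M. P \<omega> \<Longrightarrow> AE x in mu. P (snd x)"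
proof -
  assume "AE \<omega> in M. P \<omega>"
  then obtain N where N: "{\<omega> \<in> space M. \<not> P \<omega>} \<subseteq> N" "emeasure M N = 0" "N \<in> sets M" by (rule AE_E)
  have "AE x in mu. x \<notin> space lam \<times> N"
  proof (rule AE_not_in)
    show "space lam \<times> N \<in> null_sets mu"
      using N by (auto simp: null_sets_def emeasure_pair_measure_Times simp del: space_lam)
  qed
  then show ?thesis using AE_space[of mu]
    by eventually_elim (use N(1) in \<open>auto simp: space_pair_measure\<close>)
qed

lemma AE_mu_W_eq_B: "AE x in mu. W (fst x) (snd x) = B (fst x) (snd x)"
  using AE_mu_snd[OF AE_W_eq_B] by eventually_elim simp

lemma integrable_mu_snd:
  fixes g :: "'a \<Rightarrow> real"
  assumes "integrable M g" shows "integrable mu (\<lambda>x. g (snd x))"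
  by (rule pm.Fubini_integrable) (use assms in auto)

lemma L2_mu_snd: "L2 M g \<Longrightarrow> L2 mu (\<lambda>x. g (snd x))"
  using integrable_mu_snd[of "\<lambda>\<omega>. (g \<omega>)\<^sup>2"] measurable_mu_snd[of g] by (simp add: L2_def)

lemma L2_mu_indicator:
  assumes "L2 mu V" "A \<in> sets borel" shows "L2 mu (\<lambda>x. V x * indicator A (fst x))"
proof (rule L2_bound[OF _ assms(1)])
  show "(\<lambda>x. V x * indicator A (fst x)) \<in> borel_measurable mu"
    using L2_measurable[OF assms(1)] measurable_mu_indicator[OF assms(2)] by measurable
qed (auto simp: indicator_def)

lemma expectation_mu_block:
  fixes g :: "'a \<Rightarrow> real"
  assumes "integrable M g" "0 \<le> a" "a < b" "b \<le> T" "0 \<le> c" "c < d" "d \<le> T"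
  shows "(\<integral>x. g (snd x) * (indicator {a<..b} (fst x) * indicator {c<..d} (fst x)) \<partial>mu)
    = expectation g * max 0 (min b d - max a c)"
proof -
  have I: "{a<..b} \<inter> {c<..d} = {max a c<..min b d}" by auto
  have m: "measure lam ({a<..b} \<inter> {c<..d}) = max 0 (min b d - max a c)"
    unfolding I using assms
    by (cases "max a c \<le> min b d") (simp_all only: measure_lam_Ioc greaterThanAtMost_empty, auto)
  have "integrable mu (\<lambda>x. g (snd x) * indicator ({a<..b} \<inter> {c<..d}) (fst x))"
  proof (rule Bochner_Integration.integrable_bound[OF integrable_mu_snd[OF assms(1)]])
    show "(\<lambda>x. g (snd x) * indicator ({a<..b} \<inter> {c<..d}) (fst x)) \<in> borel_measurable mu"
      using measurable_mu_indicator[of "{a<..b} \<inter> {c<..d}"] measurable_mu_snd[of g] assms(1) by auto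
  qed (auto simp: indicator_def)
  from pm.integral_fst'[OF this]
  have "(\<integral>x. g (snd x) * indicator ({a<..b} \<inter> {c<..d}) (fst x) \<partial>mu)
      = (\<integral>s. expectation g * indicator ({a<..b} \<inter> {c<..d}) s \<partial>lam)"
    by simp
  also have "\<dots> = expectation g * measure lam ({a<..b} \<inter> {c<..d})"
  proof -
    have "({max a c<..min b d} \<inter> {0..T}) = {max a c<..min b d}" using assms by auto
    then show ?thesis by (simp add: I)
  qed
  finally show ?thesis unfolding m indicator_inter_arith .
qed

section \<open>The Ito integral of simple processes\<close>

text \<open>Pairs of a simple integrand and its stochastic integral. Blocks may overlap and need not come
  from a partition, which makes sums trivial; coefficients are square-integrable rather than bounded.\<close>

inductive simple_ito :: "real \<Rightarrow> (real \<times> 'a \<Rightarrow> real) \<Rightarrow> ('a \<Rightarrow> real) \<Rightarrow> bool" for t where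
  zero: "simple_ito t (\<lambda>_. 0) (\<lambda>_. 0)"
| block: "simple_ito t V J \<Longrightarrow> t \<le> a \<Longrightarrow> a < b \<Longrightarrow> b \<le> T \<Longrightarrow> \<xi> \<in> borel_measurable (F a) \<Longrightarrow> L2 M \<xi> \<Longrightarrow>
    simple_ito t (\<lambda>x. \<xi> (snd x) * indicator {a<..b} (fst x) + V x) (\<lambda>\<omega>. \<xi> \<omega> * (B b \<omega> - B a \<omega>) + J \<omega>)"

lemma L2_block:
  "L2 M \<xi> \<Longrightarrow> L2 mu (\<lambda>x. \<xi> (snd x) * indicator {a<..b} (fst x))"
  by (intro L2_mu_indicator L2_mu_snd) auto

lemma simple_ito_L2:
  assumes "simple_ito t V J" "0 \<le> t" shows "L2 mu V \<and> L2 M J"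
  using assms by (induction rule: simple_ito.induct) (auto intro!: L2_add L2_block L2_increment_mult)

lemma simple_ito_add:
  assumes "simple_ito t V J" "simple_ito t V' J'"
  shows "simple_ito t (\<lambda>x. V x + V' x) (\<lambda>\<omega>. J \<omega> + J' \<omega>)"
  using assms(1)
proof (induction rule: simple_ito.induct)
  case (block V J a b \<xi>)
  from simple_ito.block[OF block.IH block.hyps(2-)] show ?case by (simp add: add.assoc)
qed (use assms(2) in simp)

lemma simple_ito_cmult:
  assumes "simple_ito t V J" shows "simple_ito t (\<lambda>x. r * V x) (\<lambda>\<omega>. r * J \<omega>)"
  using assms
proof (induction rule: simple_ito.induct)
  case (block V J a b \<xi>)
  have "(\<lambda>\<omega>. r * \<xi> \<omega>) \<in> borel_measurable (F a)" "L2 M (\<lambda>\<omega>. r * \<xi> \<omega>)"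
    using block.hyps by (auto intro: L2_cmult)
  from simple_ito.block[OF block.IH block.hyps(2-4) this] show ?case by (simp add: algebra_simps)
qed (simp add: simple_ito.zero)

lemma simple_ito_block_product:
  assumes "simple_ito t V J" "0 \<le> t" "t \<le> a" "a < b" "b \<le> T"
    and \<xi>: "\<xi> \<in> borel_measurable (F a)" "L2 M \<xi>"
  shows "expectation (\<lambda>\<omega>. \<xi> \<omega> * (B b \<omega> - B a \<omega>) * J \<omega>)
    = (\<integral>x. \<xi> (snd x) * indicator {a<..b} (fst x) * V x \<partial>mu)"
  using assms(1)
proof (induction rule: simple_ito.induct)
  case zero
  show ?case by simp
next
  case (block V J c d \<eta>)
  have LJ: "L2 mu V" "L2 M J" using simple_ito_L2[OF block.hyps(1) assms(2)] by auto
  have a: "0 \<le> a" "0 \<le> c" using assms block by auto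
  have L\<xi>: "L2 M (\<lambda>\<omega>. \<xi> \<omega> * (B b \<omega> - B a \<omega>))" using assms a by (intro L2_increment_mult) auto
  have L\<eta>: "L2 M (\<lambda>\<omega>. \<eta> \<omega> * (B d \<omega> - B c \<omega>))" using block a by (intro L2_increment_mult) auto
  have LVx: "L2 mu (\<lambda>x. \<xi> (snd x) * indicator {a<..b} (fst x))"
    and LVe: "L2 mu (\<lambda>x. \<eta> (snd x) * indicator {c<..d} (fst x))"
    using L2_block \<xi>(2) block.hyps by blast+
  have "expectation (\<lambda>\<omega>. \<xi> \<omega> * (B b \<omega> - B a \<omega>) * (\<eta> \<omega> * (B d \<omega> - B c \<omega>) + J \<omega>))
      = expectation (\<lambda>\<omega>. \<xi> \<omega> * (B b \<omega> - B a \<omega>) * (\<eta> \<omega> * (B d \<omega> - B c \<omega>)))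
        + expectation (\<lambda>\<omega>. \<xi> \<omega> * (B b \<omega> - B a \<omega>) * J \<omega>)"
    unfolding distrib_left
    by (rule Bochner_Integration.integral_add[OF L2_mult_integrable[OF L\<xi> L\<eta>] L2_mult_integrable[OF L\<xi> LJ(2)]])
  also have "expectation (\<lambda>\<omega>. \<xi> \<omega> * (B b \<omega> - B a \<omega>) * (\<eta> \<omega> * (B d \<omega> - B c \<omega>)))
      = expectation (\<lambda>\<omega>. \<xi> \<omega> * \<eta> \<omega>) * max 0 (min b d - max a c)"
    using assms block.hyps a by (intro expectation_increment_product) auto
  also have "\<dots> = (\<integral>x. (\<xi> (snd x) * \<eta> (snd x)) * (indicator {a<..b} (fst x) * indicator {c<..d} (fst x)) \<partial>mu)"
    using assms block.hyps a L2_mult_integrable[OF \<xi>(2) block.hyps(6)]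
    by (intro expectation_mu_block[symmetric]) auto
  also have "\<dots> = (\<integral>x. \<xi> (snd x) * indicator {a<..b} (fst x) * (\<eta> (snd x) * indicator {c<..d} (fst x)) \<partial>mu)"
    by (simp add: mult_ac)
  also note block.IH
  also have "(\<integral>x. \<xi> (snd x) * indicator {a<..b} (fst x) * (\<eta> (snd x) * indicator {c<..d} (fst x)) \<partial>mu)
      + (\<integral>x. \<xi> (snd x) * indicator {a<..b} (fst x) * V x \<partial>mu)
    = (\<integral>x. \<xi> (snd x) * indicator {a<..b} (fst x) * (\<eta> (snd x) * indicator {c<..d} (fst x) + V x) \<partial>mu)"
    unfolding distrib_left
    by (rule Bochner_Integration.integral_add[symmetric, OF L2_mult_integrable[OF LVx LVe] L2_mult_integrable[OF LVx LJ(1)]])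
  finally show ?case .
qed

text \<open>The Ito isometry in polarised form, by induction over the blocks of both integrands.\<close>

lemma simple_ito_product:
  assumes "simple_ito t V J" "simple_ito t V' J'" "0 \<le> t"
  shows "expectation (\<lambda>\<omega>. J \<omega> * J' \<omega>) = (\<integral>x. V x * V' x \<partial>mu)"
  using assms(1)
proof (induction rule: simple_ito.induct)
  case zero
  show ?case by simp
next
  case (block V J a b \<xi>)
  have LJ: "L2 mu V" "L2 M J" "L2 mu V'" "L2 M J'"
    using simple_ito_L2[OF block.hyps(1) assms(3)] simple_ito_L2[OF assms(2,3)] by auto
  have L\<xi>: "L2 M (\<lambda>\<omega>. \<xi> \<omega> * (B b \<omega> - B a \<omega>))" using assms block by (intro L2_increment_mult) auto
  have LVx: "L2 mu (\<lambda>x. \<xi> (snd x) * indicator {a<..b} (fst x))" using L2_block block.hyps by blast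
  show ?case
    unfolding distrib_right
    using Bochner_Integration.integral_add[OF L2_mult_integrable[OF L\<xi> LJ(4)] L2_mult_integrable[OF LJ(2,4)]]
      Bochner_Integration.integral_add[OF L2_mult_integrable[OF LVx LJ(3)] L2_mult_integrable[OF LJ(1,3)]]
      simple_ito_block_product[OF assms(2,3) block.hyps(2-6)] block.IH
    by simp
qed

lemma simple_ito_isometry:
  assumes "simple_ito t V J" "0 \<le> t" shows "l2norm M J = l2norm mu V"
  using simple_ito_product[OF assms(1,1,2)] by (simp add: l2norm_def power2_eq_square)

lemma simple_ito_orthogonal:
  assumes "simple_ito t V J" "0 \<le> t" "Y \<in> borel_measurable (F t)" "L2 M Y"
  shows "expectation (\<lambda>\<omega>. J \<omega> * Y \<omega>) = 0"
  using assms(1)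
proof (induction rule: simple_ito.induct)
  case zero
  show ?case by simp
next
  case (block V J a b \<xi>)
  have LJ: "L2 M J" using simple_ito_L2[OF block.hyps(1) assms(2)] by auto
  have L\<xi>: "L2 M (\<lambda>\<omega>. \<xi> \<omega> * (B b \<omega> - B a \<omega>))" using assms block by (intro L2_increment_mult) auto
  have m: "(\<lambda>\<omega>. \<xi> \<omega> * Y \<omega>) \<in> borel_measurable (F a)"
    using measurable_F_mono[OF assms(3) block.hyps(2)] block.hyps by auto
  have "expectation (\<lambda>\<omega>. \<xi> \<omega> * Y \<omega> * (B b \<omega> - B a \<omega>)) = 0"
    using m block.hyps assms L2_mult_integrable by (intro expectation_increment_zero) auto
  then have "expectation (\<lambda>\<omega>. \<xi> \<omega> * (B b \<omega> - B a \<omega>) * Y \<omega>) = 0" by (simp add: mult_ac)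
  then show ?case unfolding distrib_right
    using Bochner_Integration.integral_add[OF L2_mult_integrable[OF L\<xi> assms(4)] L2_mult_integrable[OF LJ assms(4)]]
      block.IH by simp
qed

section \<open>The Ito integral as an isometric limit\<close>

text \<open>The closure of the simple pairs: \<open>X\<close> is a version of the stochastic integral of \<open>V\<close> over
  \<open>[t, T]\<close>. The integrand \<open>V\<close> lives on the whole horizon and vanishes before \<open>t\<close>.\<close>

definition ito_limit :: "real \<Rightarrow> (real \<times> 'a \<Rightarrow> real) \<Rightarrow> ('a \<Rightarrow> real) \<Rightarrow> bool" where
  "ito_limit t V X \<longleftrightarrow> L2 mu V \<and> L2 M X \<and> (\<exists>Vn Jn. (\<forall>n::nat. simple_ito t (Vn n) (Jn n)) \<and>
     (\<lambda>n. l2norm mu (\<lambda>x. Vn n x - V x)) \<longlonglongrightarrow> 0 \<and> (\<lambda>n. l2norm M (\<lambda>\<omega>. Jn n \<omega> - X \<omega>)) \<longlonglongrightarrow> 0)"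

lemma ito_limit_L2: "ito_limit t V X \<Longrightarrow> L2 mu V" "ito_limit t V X \<Longrightarrow> L2 M X"
  by (auto simp: ito_limit_def)

lemma ito_limit_isometry:
  assumes "ito_limit t V X" "0 \<le> t" shows "l2norm M X = l2norm mu V"
proof -
  obtain Vn Jn where s: "\<And>n::nat. simple_ito t (Vn n) (Jn n)"
    and l: "(\<lambda>n. l2norm mu (\<lambda>x. Vn n x - V x)) \<longlonglongrightarrow> 0" "(\<lambda>n. l2norm M (\<lambda>\<omega>. Jn n \<omega> - X \<omega>)) \<longlonglongrightarrow> 0"
    using assms(1) unfolding ito_limit_def by blast
  have "(\<lambda>n. l2norm mu (Vn n)) \<longlonglongrightarrow> l2norm mu V" "(\<lambda>n. l2norm M (Jn n)) \<longlonglongrightarrow> l2norm M X"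
    using simple_ito_L2[OF s assms(2)] ito_limit_L2[OF assms(1)] l by (auto intro!: l2norm_tendsto)
  then show ?thesis using simple_ito_isometry[OF s assms(2)] LIMSEQ_unique by simp
qed

lemma ito_limit_orthogonal:
  assumes "ito_limit t V X" "0 \<le> t" "Y \<in> borel_measurable (F t)" "L2 M Y"
  shows "expectation (\<lambda>\<omega>. X \<omega> * Y \<omega>) = 0"
proof -
  obtain Vn Jn where s: "\<And>n::nat. simple_ito t (Vn n) (Jn n)"
    and l: "(\<lambda>n. l2norm M (\<lambda>\<omega>. Jn n \<omega> - X \<omega>)) \<longlonglongrightarrow> 0"
    using assms(1) unfolding ito_limit_def by blast
  have "(\<lambda>n. expectation (\<lambda>\<omega>. Jn n \<omega> * Y \<omega>)) \<longlonglongrightarrow> expectation (\<lambda>\<omega>. X \<omega> * Y \<omega>)"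
    using simple_ito_L2[OF s assms(2)] ito_limit_L2[OF assms(1)] l assms(4) by (intro L2_inner_tendsto) auto
  then show ?thesis
    using simple_ito_orthogonal[OF s assms(2-4)] by (simp add: LIMSEQ_const_iff)
qed

lemma ito_limit_zero: "ito_limit t (\<lambda>_. 0) (\<lambda>_. 0)"
  unfolding ito_limit_def
  by (auto intro!: exI[of _ "\<lambda>_ _. 0"] simple_ito.zero)

lemma ito_limit_cmult:
  assumes "ito_limit t V X" shows "ito_limit t (\<lambda>x. r * V x) (\<lambda>\<omega>. r * X \<omega>)"
proof -
  obtain Vn Jn where s: "\<And>n::nat. simple_ito t (Vn n) (Jn n)"
    and l: "(\<lambda>n. l2norm mu (\<lambda>x. Vn n x - V x)) \<longlonglongrightarrow> 0" "(\<lambda>n. l2norm M (\<lambda>\<omega>. Jn n \<omega> - X \<omega>)) \<longlonglongrightarrow> 0"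
    and L: "L2 mu V" "L2 M X" using assms(1) unfolding ito_limit_def by blast
  have *: "(\<lambda>n. l2norm mu (\<lambda>x. r * Vn n x - r * V x)) \<longlonglongrightarrow> 0" "(\<lambda>n. l2norm M (\<lambda>\<omega>. r * Jn n \<omega> - r * X \<omega>)) \<longlonglongrightarrow> 0"
    unfolding right_diff_distrib[symmetric] l2norm_cmult using l tendsto_mult_right_zero by auto
  show ?thesis unfolding ito_limit_def
    using simple_ito_cmult[OF s, of r] * L2_cmult[OF L(1)] L2_cmult[OF L(2)]
    by (intro conjI exI[of _ "\<lambda>n x. r * Vn n x"] exI[of _ "\<lambda>n x. r * Jn n x"]) auto
qed

lemma ito_limit_add:
  assumes "0 \<le> t" "ito_limit t V X" "ito_limit t V' X'"
  shows "ito_limit t (\<lambda>x. V x + V' x) (\<lambda>\<omega>. X \<omega> + X' \<omega>)"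
proof -
  obtain Vn Jn where s: "\<And>n::nat. simple_ito t (Vn n) (Jn n)"
    and l: "(\<lambda>n. l2norm mu (\<lambda>x. Vn n x - V x)) \<longlonglongrightarrow> 0" "(\<lambda>n. l2norm M (\<lambda>\<omega>. Jn n \<omega> - X \<omega>)) \<longlonglongrightarrow> 0"
    and L: "L2 mu V" "L2 M X" using assms(2) unfolding ito_limit_def by blast
  obtain Vn' Jn' where s': "\<And>n::nat. simple_ito t (Vn' n) (Jn' n)"
    and l': "(\<lambda>n. l2norm mu (\<lambda>x. Vn' n x - V' x)) \<longlonglongrightarrow> 0" "(\<lambda>n. l2norm M (\<lambda>\<omega>. Jn' n \<omega> - X' \<omega>)) \<longlonglongrightarrow> 0"
    and L': "L2 mu V'" "L2 M X'" using assms(3) unfolding ito_limit_def by blast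
  have tri: "(\<lambda>n. l2norm N (\<lambda>x. fn n x + gn n x - (f x + g x))) \<longlonglongrightarrow> 0"
    if "(\<lambda>n. l2norm N (\<lambda>x. fn n x - f x)) \<longlonglongrightarrow> 0" "(\<lambda>n. l2norm N (\<lambda>x. gn n x - g x)) \<longlonglongrightarrow> 0"
      "\<And>n. L2 N (fn n)" "\<And>n. L2 N (gn n)" "L2 N f" "L2 N g"
    for N :: "'z measure" and fn gn :: "nat \<Rightarrow> 'z \<Rightarrow> real" and f g
  proof (rule Lim_null_comparison)
    show "(\<lambda>n. l2norm N (\<lambda>x. fn n x - f x) + l2norm N (\<lambda>x. gn n x - g x)) \<longlonglongrightarrow> 0"
      using tendsto_add[OF that(1,2)] by simp
    show "\<forall>\<^sub>F n in sequentially. norm (l2norm N (\<lambda>x. fn n x + gn n x - (f x + g x)))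
        \<le> l2norm N (\<lambda>x. fn n x - f x) + l2norm N (\<lambda>x. gn n x - g x)"
      using l2norm_triangle[OF L2_diff[OF that(3,5)] L2_diff[OF that(4,6)]]
      by (auto simp: algebra_simps)
  qed
  have Ls: "L2 mu (Vn n)" "L2 mu (Vn' n)" "L2 M (Jn n)" "L2 M (Jn' n)" for n
    using simple_ito_L2[OF s assms(1)] simple_ito_L2[OF s' assms(1)] by auto
  show ?thesis unfolding ito_limit_def
    using simple_ito_add[OF s s'] tri[OF l(1) l'(1) Ls(1,2) L(1) L'(1)] tri[OF l(2) l'(2) Ls(3,4) L(2) L'(2)]
      L2_add[OF L(1) L'(1)] L2_add[OF L(2) L'(2)]
    by (intro conjI exI[of _ "\<lambda>n x. Vn n x + Vn' n x"] exI[of _ "\<lambda>n x. Jn n x + Jn' n x"]) auto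
qed

lemma ito_limit_diff:
  assumes "0 \<le> t" "ito_limit t V X" "ito_limit t V' X'"
  shows "ito_limit t (\<lambda>x. V x - V' x) (\<lambda>\<omega>. X \<omega> - X' \<omega>)"
  using ito_limit_add[OF assms(1,2) ito_limit_cmult[OF assms(3), of "-1"]] by simp

lemma ito_limit_cong_AE:
  assumes "ito_limit t V X" "0 \<le> t" "AE x in mu. V x = V' x" "AE \<omega> in M. X \<omega> = X' \<omega>"
    "V' \<in> borel_measurable mu" "X' \<in> borel_measurable M"
  shows "ito_limit t V' X'"
proof -
  obtain Vn Jn where s: "\<And>n::nat. simple_ito t (Vn n) (Jn n)"
    and l: "(\<lambda>n. l2norm mu (\<lambda>x. Vn n x - V x)) \<longlonglongrightarrow> 0" "(\<lambda>n. l2norm M (\<lambda>\<omega>. Jn n \<omega> - X \<omega>)) \<longlonglongrightarrow> 0"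
    and L: "L2 mu V" "L2 M X" using assms(1) unfolding ito_limit_def by blast
  have eq: "l2norm N (\<lambda>x. f x - g x) = l2norm N (\<lambda>x. f x - g' x)"
    if "AE x in N. g x = g' x" "L2 N f" "L2 N g" "g' \<in> borel_measurable N" for N :: "'z measure" and f g g'
    using that(1) L2_measurable[OF that(2)] L2_measurable[OF that(3)] that(4)
    by (intro l2norm_cong_AE) (auto elim: eventually_mono)
  have Ls: "L2 mu (Vn n)" "L2 M (Jn n)" for n
    using simple_ito_L2[OF s assms(2)] by auto
  have "L2 mu V'" using assms(3) by (intro L2_bound[OF assms(5) L(1)]) (auto elim: eventually_mono)
  moreover have "L2 M X'" using assms(4) by (intro L2_bound[OF assms(6) L(2)]) (auto elim: eventually_mono)
  ultimately show ?thesis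
    using s l unfolding ito_limit_def eq[OF assms(3) Ls(1) L(1) assms(5)] eq[OF assms(4) Ls(2) L(2) assms(6)]
    by blast
qed

text \<open>Tonelli's theorem connects the iterated integrals in the definitions of square-integrable
  processes and of the Ito integral with the product measure.\<close>

lemma nn_integral_mu:
  assumes "f \<in> borel_measurable mu"
  shows "(\<integral>\<^sup>+\<omega>. (\<integral>\<^sup>+s\<in>{0..T}. f (s, \<omega>) \<partial>lborel) \<partial>M) = (\<integral>\<^sup>+x. f x \<partial>mu)"
  using pm.nn_integral_snd[of f] assms by (simp add: lam_def nn_integral_restrict_space)

lemma L2_M2_process:
  assumes "M2_process M B T Z" shows "L2 mu (\<lambda>x. Z (fst x) (snd x))"
proof (rule L2_nn_integral)
  show m: "(\<lambda>x. Z (fst x) (snd x)) \<in> borel_measurable mu"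
    using assms by (simp add: lam_def M2_process_def case_prod_beta')
  have "(\<lambda>x. ennreal ((Z (fst x) (snd x))\<^sup>2)) \<in> borel_measurable mu" using m by measurable
  from nn_integral_mu[OF this] assms
  show "(\<integral>\<^sup>+x. ennreal ((Z (fst x) (snd x))\<^sup>2) \<partial>mu) < \<infinity>" by (simp add: M2_process_def)
qed

lemma step_integrand_simple_ito:
  assumes "step_integrand M B t T m \<tau> \<xi>" "0 \<le> t"
  shows "simple_ito t (\<lambda>x. step_process m \<tau> \<xi> (fst x) (snd x)) (step_integral B m \<tau> \<xi>)"
    and "s < t \<Longrightarrow> step_process m \<tau> \<xi> s \<omega> = 0"
proof -
  have st: "\<tau> 0 = t" "\<tau> m = T" "\<And>i. i < m \<Longrightarrow> \<tau> i < \<tau> (Suc i)"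
    "\<And>i. i < m \<Longrightarrow> \<xi> i \<in> borel_measurable (F (\<tau> i))"
    "\<And>i. i < m \<Longrightarrow> \<exists>C. \<forall>\<omega>\<in>space M. \<bar>\<xi> i \<omega>\<bar> \<le> C"
    using assms(1) by (auto simp: step_integrand_def)
  have mono: "\<tau> i \<le> \<tau> j" if "i \<le> j" "j \<le> m" for i j
    using that by (induction j rule: dec_induct)
      (use st(3) in \<open>auto intro: less_imp_le order_trans[OF _ less_imp_le]\<close>)
  have ge: "t \<le> \<tau> i" "\<tau> i \<le> T" if "i \<le> m" for i
    using mono[of 0 i] mono[of i m] st that by auto
  have L: "L2 M (\<xi> i)" if i: "i < m" for i
  proof -
    obtain C where C: "\<forall>\<omega>\<in>space M. \<bar>\<xi> i \<omega>\<bar> \<le> C" using st(5)[OF i] by blast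
    show ?thesis
      by (rule L2_bound[OF measurable_F_M[OF st(4)[OF i]] L2_const[of C]]) (use C in \<open>fastforce intro: AE_I2\<close>)
  qed
  have "simple_ito t (\<lambda>x. step_process j \<tau> \<xi> (fst x) (snd x)) (step_integral B j \<tau> \<xi>)" if "j \<le> m" for j
    using that
  proof (induction j)
    case 0
    then show ?case using simple_ito.zero by (simp add: step_process_def step_integral_def[abs_def])
  next
    case (Suc j)
    have "simple_ito t (\<lambda>x. \<xi> j (snd x) * indicator {\<tau> j<..\<tau> (Suc j)} (fst x) + step_process j \<tau> \<xi> (fst x) (snd x))
      (\<lambda>\<omega>. \<xi> j \<omega> * (B (\<tau> (Suc j)) \<omega> - B (\<tau> j) \<omega>) + step_integral B j \<tau> \<xi> \<omega>)"
      using Suc st L ge by (intro simple_ito.block) auto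
    then show ?case
      by (simp add: step_process_def step_integral_def[abs_def] add.commute)
  qed
  then show "simple_ito t (\<lambda>x. step_process m \<tau> \<xi> (fst x) (snd x)) (step_integral B m \<tau> \<xi>)" by simp
  show "s < t \<Longrightarrow> step_process m \<tau> \<xi> s \<omega> = 0"
  proof (unfold step_process_def, intro sum.neutral ballI)
    fix i assume "s < t" "i \<in> {..<m}"
    then have "s < \<tau> i" using ge(1)[of i] by simp
    then show "\<xi> i \<omega> * indicator {\<tau> i<..\<tau> (Suc i)} s = 0" by simp
  qed
qed

lemma has_ito_integral_ito_limit:
  assumes "has_ito_integral M B t T Z X" "0 \<le> t" "t \<le> T" "L2 mu (\<lambda>x. Z (fst x) (snd x))"
  shows "ito_limit t (\<lambda>x. Z (fst x) (snd x) * indicator {t..T} (fst x)) X"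
proof -
  obtain m \<tau> \<xi> where si: "\<And>n::nat. step_integrand M B t T (m n) (\<tau> n) (\<xi> n)"
    and l1: "(\<lambda>n. \<integral>\<^sup>+\<omega>. (\<integral>\<^sup>+s\<in>{t..T}.
               ennreal (\<bar>Z s \<omega> - step_process (m n) (\<tau> n) (\<xi> n) s \<omega>\<bar>\<^sup>2) \<partial>lborel) \<partial>M) \<longlonglongrightarrow> 0"
    and l2: "(\<lambda>n. \<integral>\<^sup>+\<omega>. ennreal (\<bar>X \<omega> - step_integral B (m n) (\<tau> n) (\<xi> n) \<omega>\<bar>\<^sup>2) \<partial>M) \<longlonglongrightarrow> 0"
    and mX: "X \<in> borel_measurable M"
    using assms(1) unfolding has_ito_integral_def by blast
  define V where "V n x = step_process (m n) (\<tau> n) (\<xi> n) (fst x) (snd x)" for n x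
  define J where "J n = step_integral B (m n) (\<tau> n) (\<xi> n)" for n
  have s: "simple_ito t (V n) (J n)" for n
    using step_integrand_simple_ito(1)[OF si assms(2), of n] unfolding V_def[abs_def] J_def by simp
  have LV: "L2 mu (V n)" and LJ: "L2 M (J n)" for n using simple_ito_L2[OF s assms(2)] by auto
  define Zt where "Zt x = Z (fst x) (snd x) * indicator {t..T} (fst x)" for x
  have LZ: "L2 mu Zt" unfolding Zt_def[abs_def] by (rule L2_mu_indicator[OF assms(4)]) simp
  have LX: "L2 M X"
  proof -
    have "\<forall>\<^sub>F n in sequentially. (\<integral>\<^sup>+\<omega>. ennreal (\<bar>X \<omega> - J n \<omega>\<bar>\<^sup>2) \<partial>M) < 1"
      using order_tendstoD(2)[OF l2, of 1] by (simp add: J_def)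
    then obtain n where n: "(\<integral>\<^sup>+\<omega>. ennreal ((X \<omega> - J n \<omega>)\<^sup>2) \<partial>M) < 1"
      by (auto simp: eventually_sequentially)
    have "L2 M (\<lambda>\<omega>. X \<omega> - J n \<omega>)"
      by (rule L2_nn_integral) (use n mX L2_measurable[OF LJ] in \<open>auto simp: order.strict_trans\<close>)
    from L2_add[OF this LJ[of n]] show ?thesis by simp
  qed
  have "(\<lambda>n. l2norm mu (\<lambda>x. V n x - Zt x)) \<longlonglongrightarrow> 0"
  proof (rule l2norm_tendsto_0_nn)
    show "L2 mu (\<lambda>x. V n x - Zt x)" for n by (rule L2_diff[OF LV LZ])
    have "(\<integral>\<^sup>+x. ennreal ((V n x - Zt x)\<^sup>2) \<partial>mu) = (\<integral>\<^sup>+\<omega>. (\<integral>\<^sup>+s\<in>{t..T}.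
               ennreal (\<bar>Z s \<omega> - step_process (m n) (\<tau> n) (\<xi> n) s \<omega>\<bar>\<^sup>2) \<partial>lborel) \<partial>M)" for n
    proof -
      have m: "(\<lambda>x. ennreal ((V n x - Zt x)\<^sup>2)) \<in> borel_measurable mu"
        using L2_measurable[OF LV] L2_measurable[OF LZ] by measurable
      have "ennreal ((V n (s, \<omega>) - Zt (s, \<omega>))\<^sup>2) * indicator {0..T} s
        = ennreal (\<bar>Z s \<omega> - step_process (m n) (\<tau> n) (\<xi> n) s \<omega>\<bar>\<^sup>2) * indicator {t..T} s" for s \<omega>
        using step_integrand_simple_ito(2)[OF si assms(2), of s n \<omega>] assms(2,3)
        by (auto simp: indicator_def V_def Zt_def power2_commute)
      then show ?thesis unfolding nn_integral_mu[OF m, symmetric] by simp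
    qed
    then show "(\<lambda>n. \<integral>\<^sup>+x. ennreal ((V n x - Zt x)\<^sup>2) \<partial>mu) \<longlonglongrightarrow> 0" using l1 by simp
  qed
  moreover have "(\<lambda>n. l2norm M (\<lambda>\<omega>. J n \<omega> - X \<omega>)) \<longlonglongrightarrow> 0"
    by (rule l2norm_tendsto_0_nn) (use l2 L2_diff[OF LJ LX] in \<open>auto simp: J_def power2_commute\<close>)
  ultimately show ?thesis unfolding ito_limit_def Zt_def[abs_def, symmetric]
    using LZ LX s by blast
qed

section \<open>Time integrals\<close>

definition time_integral :: "(real \<times> 'a \<Rightarrow> real) \<Rightarrow> 'a \<Rightarrow> real" where
  "time_integral V \<omega> = (\<integral>s. V (s, \<omega>) \<partial>lam)"

lemma AE_integrable_time:
  assumes "L2 mu V" shows "AE \<omega> in M. integrable lam (\<lambda>s. V (s, \<omega>))"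
  using pm.AE_integrable_snd[of "\<lambda>s \<omega>. V (s, \<omega>)"] mu.L2_integrable[OF assms] by simp

lemma measurable_time_integral:
  "V \<in> borel_measurable mu \<Longrightarrow> time_integral V \<in> borel_measurable M"
  unfolding time_integral_def[abs_def]
  by (rule lam.borel_measurable_lebesgue_integral) (simp add: measurable_pair_swap_iff[of _ M] case_prod_beta')

lemma time_integral_add:
  assumes "L2 mu V" "L2 mu V'"
  shows "AE \<omega> in M. time_integral (\<lambda>x. V x + V' x) \<omega> = time_integral V \<omega> + time_integral V' \<omega>"
  using AE_integrable_time[OF assms(1)] AE_integrable_time[OF assms(2)]
  by eventually_elim (simp add: time_integral_def)

lemma time_integral_cmult: "time_integral (\<lambda>x. r * V x) \<omega> = r * time_integral V \<omega>"
  by (simp add: time_integral_def)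

lemma time_integral_diff:
  assumes "L2 mu V" "L2 mu V'"
  shows "AE \<omega> in M. time_integral (\<lambda>x. V x - V' x) \<omega> = time_integral V \<omega> - time_integral V' \<omega>"
  using AE_integrable_time[OF assms(1)] AE_integrable_time[OF assms(2)]
  by eventually_elim (simp add: time_integral_def)

text \<open>Cauchy--Schwarz in time. The factor \<open>sqrt (b - a)\<close> is what makes the uniqueness argument a
  contraction on short intervals.\<close>

lemma
  assumes V: "L2 mu V" and ab: "0 \<le> a" "a \<le> b" "b \<le> T"
    and supp: "\<And>s \<omega>. s \<notin> {a..b} \<Longrightarrow> V (s, \<omega>) = 0"
  shows L2_time_integral_support: "L2 M (time_integral V)"
    and l2norm_time_integral_support: "l2norm M (time_integral V) \<le> sqrt (b - a) * l2norm mu V"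
proof -
  have i2: "integrable mu (\<lambda>(s, \<omega>). (V (s, \<omega>))\<^sup>2)" using V by (simp add: L2_def case_prod_beta')
  note mV = L2_measurable[OF V]
  note mI = measurable_time_integral[OF mV]
  have bd: "AE \<omega> in M. (time_integral V \<omega>)\<^sup>2 \<le> (b - a) * (\<integral>s. (V (s, \<omega>))\<^sup>2 \<partial>lam)"
    using pm.AE_integrable_snd[OF i2] AE_space
  proof eventually_elim
    case (elim \<omega>)
    have L: "L2 lam (\<lambda>s. V (s, \<omega>))"
      using elim measurable_compose[OF measurable_Pair2'[OF elim(2)] mV] by (simp add: L2_def)
    have Li: "L2 lam (indicator {a..b})"
    proof (rule L2_bound[OF _ lam.L2_const[of 1]])
      show "indicator {a..b} \<in> borel_measurable lam" by (rule measurable_lam) simp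
    qed (simp add: indicator_def)
    have "time_integral V \<omega> = (\<integral>s. indicator {a..b} s * V (s, \<omega>) \<partial>lam)"
      unfolding time_integral_def using supp
      by (intro Bochner_Integration.integral_cong) (auto simp: indicator_def)
    then have "\<bar>time_integral V \<omega>\<bar> \<le> l2norm lam (indicator {a..b}) * l2norm lam (\<lambda>s. V (s, \<omega>))"
      using Cauchy_Schwarz_L2[OF Li L] by simp
    then have "(time_integral V \<omega>)\<^sup>2 \<le> (l2norm lam (indicator {a..b}) * l2norm lam (\<lambda>s. V (s, \<omega>)))\<^sup>2"
      by (metis abs_ge_zero power2_abs power_mono)
    also have "(l2norm lam (indicator {a..b}))\<^sup>2 = b - a"
    proof -
      have "(\<lambda>x. (indicator {a..b} x :: real)\<^sup>2) = indicator {a..b}" by (auto simp: indicator_def)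
      moreover have "measure lam {a..b} = b - a"
        using ab by (subst measure_def, subst emeasure_lam) auto
      ultimately show ?thesis using ab by (simp add: l2norm_power2 Int_absorb2)
    qed
    then have "(l2norm lam (indicator {a..b}) * l2norm lam (\<lambda>s. V (s, \<omega>)))\<^sup>2
      = (b - a) * (\<integral>s. (V (s, \<omega>))\<^sup>2 \<partial>lam)" by (simp add: power_mult_distrib l2norm_power2)
    finally show ?case .
  qed
  have i: "integrable M (\<lambda>\<omega>. (b - a) * (\<integral>s. (V (s, \<omega>))\<^sup>2 \<partial>lam))"
    using pm.integrable_snd[OF i2] by simp
  show L: "L2 M (time_integral V)"
    unfolding L2_def
  proof (intro conjI mI Bochner_Integration.integrable_bound[OF i])
    show "AE \<omega> in M. norm ((time_integral V \<omega>)\<^sup>2) \<le> norm ((b - a) * (\<integral>s. (V (s, \<omega>))\<^sup>2 \<partial>lam))"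
      using bd by eventually_elim simp
  qed (use mI in measurable)
  have "(l2norm M (time_integral V))\<^sup>2 \<le> expectation (\<lambda>\<omega>. (b - a) * (\<integral>s. (V (s, \<omega>))\<^sup>2 \<partial>lam))"
    unfolding l2norm_power2 using L bd i by (intro integral_mono_AE) (auto simp: L2_def)
  also have "\<dots> = (sqrt (b - a) * l2norm mu V)\<^sup>2"
    using pm.integral_snd[OF i2] ab by (simp add: power_mult_distrib l2norm_power2 case_prod_beta')
  finally show "l2norm M (time_integral V) \<le> sqrt (b - a) * l2norm mu V"
    by (rule power2_le_imp_le) (use ab in \<open>simp add: mult_nonneg_nonneg\<close>)
qed

lemma
  assumes "L2 mu V"
  shows L2_time_integral: "L2 M (time_integral V)"
    and l2norm_time_integral: "l2norm M (time_integral V) \<le> sqrt T * l2norm mu V"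
proof -
  define V' where "V' x = V x * indicator {0..T} (fst x)" for x
  have L: "L2 mu V'" unfolding V'_def[abs_def] by (rule L2_mu_indicator[OF assms]) simp
  have t: "time_integral V' = time_integral V"
    unfolding time_integral_def fun_eq_iff V'_def
    by (intro allI Bochner_Integration.integral_cong) auto
  have n: "l2norm mu V' = l2norm mu V"
    unfolding l2norm_def V'_def
    by (intro arg_cong[where f=sqrt] Bochner_Integration.integral_cong) (auto simp: space_mu)
  show "L2 M (time_integral V)" "l2norm M (time_integral V) \<le> sqrt T * l2norm mu V"
    using L2_time_integral_support[OF L, of 0 T] l2norm_time_integral_support[OF L, of 0 T] T_pos t n
    by (auto simp: V'_def)
qed

end

section \<open>Locally Lipschitz functions of exponential growth\<close>

text \<open>The modulus grows exponentially, which Gaussian moments absorb. The class is closed under products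
  and contains the exponentials and trigonometric functions of \<open>\<bar>x - c\<bar>\<close> in spite of their kinks.\<close>

definition exp_lipschitz :: "(real \<Rightarrow> real) \<Rightarrow> bool" where
  "exp_lipschitz f \<longleftrightarrow> (\<exists>C\<ge>0. \<exists>K\<ge>0. \<forall>x y. \<bar>f (x + y) - f x\<bar> \<le> C * exp (K * (\<bar>x\<bar> + \<bar>y\<bar>)) * \<bar>y\<bar>)"

lemma exp_lipschitzE:
  assumes "exp_lipschitz f"
  obtains C K where "C \<ge> 0" "K \<ge> 0" "\<And>x y. \<bar>f (x + y) - f x\<bar> \<le> C * exp (K * (\<bar>x\<bar> + \<bar>y\<bar>)) * \<bar>y\<bar>"
  using assms unfolding exp_lipschitz_def by blast

lemma abs_le_exp: "\<bar>x\<bar> \<le> exp \<bar>x\<bar>" for x :: real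
  using exp_ge_add_one_self[of "\<bar>x\<bar>"] by linarith

lemma exp_lipschitz_growth:
  assumes "exp_lipschitz f"
  obtains C K where "C \<ge> 0" "K \<ge> 0" "\<And>x. \<bar>f x\<bar> \<le> C * exp (K * \<bar>x\<bar>)"
proof -
  obtain C K where CK: "C \<ge> 0" "K \<ge> 0" "\<And>x y. \<bar>f (x + y) - f x\<bar> \<le> C * exp (K * (\<bar>x\<bar> + \<bar>y\<bar>)) * \<bar>y\<bar>"
    using exp_lipschitzE[OF assms] by blast
  have "\<bar>f x\<bar> \<le> (\<bar>f 0\<bar> + C) * exp ((K + 1) * \<bar>x\<bar>)" for x
  proof -
    have "\<bar>f x\<bar> \<le> \<bar>f 0\<bar> + C * exp (K * \<bar>x\<bar>) * \<bar>x\<bar>" using CK(3)[of 0 x] by simp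
    also have "\<dots> \<le> \<bar>f 0\<bar> * exp ((K + 1) * \<bar>x\<bar>) + C * exp (K * \<bar>x\<bar>) * exp \<bar>x\<bar>"
      using CK(1,2) abs_le_exp[of x] by (intro add_mono mult_left_mono) (auto simp: mult_le_cancel_left1)
    also have "\<dots> = (\<bar>f 0\<bar> + C) * exp ((K + 1) * \<bar>x\<bar>)" by (simp add: algebra_simps exp_add)
    finally show ?thesis .
  qed
  then show ?thesis using that[of "\<bar>f 0\<bar> + C" "K + 1"] CK by auto
qed

lemma exp_lipschitzI:
  assumes "\<And>x y. \<bar>f (x + y) - f x\<bar> \<le> C * exp (K * (\<bar>x\<bar> + \<bar>y\<bar>)) * \<bar>y\<bar>"
  shows "exp_lipschitz f"
  unfolding exp_lipschitz_def
proof (rule exI[of _ "\<bar>C\<bar>"], rule conjI[OF abs_ge_zero], rule exI[of _ "\<bar>K\<bar>"],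
    rule conjI[OF abs_ge_zero], intro allI)
  fix x y :: real
  have "C * exp (K * (\<bar>x\<bar> + \<bar>y\<bar>)) * \<bar>y\<bar> \<le> \<bar>C\<bar> * exp (\<bar>K\<bar> * (\<bar>x\<bar> + \<bar>y\<bar>)) * \<bar>y\<bar>"
    by (intro mult_right_mono mult_mono) (auto intro: mult_right_mono)
  then show "\<bar>f (x + y) - f x\<bar> \<le> \<bar>C\<bar> * exp (\<bar>K\<bar> * (\<bar>x\<bar> + \<bar>y\<bar>)) * \<bar>y\<bar>"
    using assms[of x y] by linarith
qed

lemma exp_lipschitz_lipschitz:
  assumes "\<And>x y. \<bar>f (x + y) - f x\<bar> \<le> C * \<bar>y\<bar>" shows "exp_lipschitz f"
  by (rule exp_lipschitzI[of f C 0]) (use assms in simp)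

lemma exp_lipschitz_add:
  assumes "exp_lipschitz f" "exp_lipschitz g" shows "exp_lipschitz (\<lambda>x. f x + g x)"
proof -
  obtain C K where f: "C \<ge> 0" "K \<ge> 0" "\<And>x y. \<bar>f (x + y) - f x\<bar> \<le> C * exp (K * (\<bar>x\<bar> + \<bar>y\<bar>)) * \<bar>y\<bar>"
    using exp_lipschitzE[OF assms(1)] by blast
  obtain D L where g: "D \<ge> 0" "L \<ge> 0" "\<And>x y. \<bar>g (x + y) - g x\<bar> \<le> D * exp (L * (\<bar>x\<bar> + \<bar>y\<bar>)) * \<bar>y\<bar>"
    using exp_lipschitzE[OF assms(2)] by blast
  show ?thesis
  proof (rule exp_lipschitzI)
    fix x y :: real
    let ?z = "\<bar>x\<bar> + \<bar>y\<bar>"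
    have "\<bar>f (x + y) + g (x + y) - (f x + g x)\<bar> \<le> C * exp (K * ?z) * \<bar>y\<bar> + D * exp (L * ?z) * \<bar>y\<bar>"
      using f(3)[of x y] g(3)[of x y] by linarith
    also have "\<dots> \<le> C * exp (max K L * ?z) * \<bar>y\<bar> + D * exp (max K L * ?z) * \<bar>y\<bar>"
      using f(1) g(1) by (intro add_mono mult_right_mono mult_left_mono) (auto intro: mult_right_mono)
    also have "\<dots> = (C + D) * exp (max K L * ?z) * \<bar>y\<bar>" by (simp add: algebra_simps)
    finally show "\<bar>f (x + y) + g (x + y) - (f x + g x)\<bar> \<le> (C + D) * exp (max K L * ?z) * \<bar>y\<bar>" .
  qed
qed

lemma exp_lipschitz_mult:
  assumes "exp_lipschitz f" "exp_lipschitz g" shows "exp_lipschitz (\<lambda>x. f x * g x)"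
proof -
  obtain C K where f: "C \<ge> 0" "K \<ge> 0" "\<And>x y. \<bar>f (x + y) - f x\<bar> \<le> C * exp (K * (\<bar>x\<bar> + \<bar>y\<bar>)) * \<bar>y\<bar>"
    using exp_lipschitzE[OF assms(1)] by blast
  obtain D L where g: "D \<ge> 0" "L \<ge> 0" "\<And>x y. \<bar>g (x + y) - g x\<bar> \<le> D * exp (L * (\<bar>x\<bar> + \<bar>y\<bar>)) * \<bar>y\<bar>"
    using exp_lipschitzE[OF assms(2)] by blast
  obtain C' K' where f': "C' \<ge> 0" "K' \<ge> 0" "\<And>x. \<bar>f x\<bar> \<le> C' * exp (K' * \<bar>x\<bar>)"
    using exp_lipschitz_growth[OF assms(1)] by blast
  obtain D' L' where g': "D' \<ge> 0" "L' \<ge> 0" "\<And>x. \<bar>g x\<bar> \<le> D' * exp (L' * \<bar>x\<bar>)"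
    using exp_lipschitz_growth[OF assms(2)] by blast
  show ?thesis
  proof (rule exp_lipschitzI)
    fix x y :: real
    let ?z = "\<bar>x\<bar> + \<bar>y\<bar>" and ?N = "K + K' + L + L'"
    have "f (x + y) * g (x + y) - f x * g x = (f (x + y) - f x) * g (x + y) + f x * (g (x + y) - g x)"
      by (simp add: algebra_simps)
    then have "\<bar>f (x + y) * g (x + y) - f x * g x\<bar>
        \<le> \<bar>f (x + y) - f x\<bar> * \<bar>g (x + y)\<bar> + \<bar>f x\<bar> * \<bar>g (x + y) - g x\<bar>"
      using abs_triangle_ineq[of "(f (x + y) - f x) * g (x + y)" "f x * (g (x + y) - g x)"]
      by (simp add: abs_mult)
    also have "\<dots> \<le> (C * exp (K * ?z) * \<bar>y\<bar>) * (D' * exp (L' * ?z)) + (C' * exp (K' * ?z)) * (D * exp (L * ?z) * \<bar>y\<bar>)"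
    proof (intro add_mono mult_mono f(3) g(3))
      have "\<bar>g (x + y)\<bar> \<le> D' * exp (L' * \<bar>x + y\<bar>)" by (rule g'(3))
      also have "\<dots> \<le> D' * exp (L' * ?z)"
        using g'(1,2) by (intro mult_left_mono) (auto intro: mult_left_mono)
      finally show "\<bar>g (x + y)\<bar> \<le> D' * exp (L' * ?z)" .
      have "\<bar>f x\<bar> \<le> C' * exp (K' * \<bar>x\<bar>)" by (rule f'(3))
      also have "\<dots> \<le> C' * exp (K' * ?z)"
        using f'(1,2) by (intro mult_left_mono) (auto intro: mult_left_mono)
      finally show "\<bar>f x\<bar> \<le> C' * exp (K' * ?z)" .
    qed (use f(1,2) f'(1,2) in auto)
    also have "\<dots> = (C * D' * exp ((K + L') * ?z) + C' * D * exp ((K' + L) * ?z)) * \<bar>y\<bar>"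
      by (simp add: distrib_right exp_add algebra_simps)
    also have "\<dots> \<le> (C * D' * exp (?N * ?z) + C' * D * exp (?N * ?z)) * \<bar>y\<bar>"
      using f(1,2) g(1,2) f'(1,2) g'(1,2)
      by (intro mult_right_mono add_mono mult_left_mono) (auto intro!: mult_right_mono)
    finally show "\<bar>f (x + y) * g (x + y) - f x * g x\<bar> \<le> (C * D' + C' * D) * exp (?N * ?z) * \<bar>y\<bar>"
      by (simp add: algebra_simps)
  qed
qed

lemma exp_lipschitz_const: "exp_lipschitz (\<lambda>x. a)"
  by (rule exp_lipschitz_lipschitz[of _ 0]) simp

lemma exp_lipschitz_cmult: "exp_lipschitz f \<Longrightarrow> exp_lipschitz (\<lambda>x. a * f x)"
  by (rule exp_lipschitz_mult[OF exp_lipschitz_const])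

lemma exp_minus_one_bound: "\<bar>exp u - 1\<bar> \<le> \<bar>u\<bar> * exp \<bar>u\<bar>" for u :: real
proof -
  obtain t where t: "\<bar>t\<bar> \<le> \<bar>u\<bar>" "exp u = (\<Sum>m<1. u ^ m / fact m) + exp t / fact 1 * u ^ 1"
    using Maclaurin_exp_le[of u 1] by blast
  then have "\<bar>exp u - 1\<bar> = exp t * \<bar>u\<bar>" by (simp add: abs_mult)
  also have "\<dots> \<le> exp \<bar>u\<bar> * \<bar>u\<bar>" using t(1) by (intro mult_right_mono) auto
  finally show ?thesis by (simp add: mult.commute)
qed

lemma exp_second_order_bound: "\<bar>exp u - 1 - u\<bar> \<le> u\<^sup>2 * exp \<bar>u\<bar>" for u :: real
proof -
  obtain t where t: "\<bar>t\<bar> \<le> \<bar>u\<bar>" "exp u = (\<Sum>m<2. u ^ m / fact m) + exp t / fact 2 * u ^ 2"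
    using Maclaurin_exp_le[of u 2] by blast
  then have "\<bar>exp u - 1 - u\<bar> = exp t / 2 * u\<^sup>2" by (simp add: numeral_2_eq_2 abs_mult)
  also have "\<dots> \<le> exp t * u\<^sup>2" by (intro mult_right_mono) auto
  also have "\<dots> \<le> exp \<bar>u\<bar> * u\<^sup>2" using t(1) by (intro mult_right_mono) auto
  finally show ?thesis by (simp add: mult.commute)
qed

lemma exp_diff_bound: "\<bar>exp u - exp v\<bar> \<le> \<bar>u - v\<bar> * exp (\<bar>v\<bar> + \<bar>u - v\<bar>)" for u v :: real
proof -
  have "\<bar>exp u - exp v\<bar> = exp v * \<bar>exp (u - v) - 1\<bar>"
  proof -
    have "exp u - exp v = exp v * (exp (u - v) - 1)" by (simp add: exp_diff field_simps)
    then show ?thesis by (simp add: abs_mult)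
  qed
  also have "\<dots> \<le> exp \<bar>v\<bar> * (\<bar>u - v\<bar> * exp \<bar>u - v\<bar>)"
    by (intro mult_mono exp_minus_one_bound) auto
  finally show ?thesis by (simp add: exp_add mult_ac)
qed

lemma exp_lipschitz_exp_abs: "exp_lipschitz (\<lambda>x. exp (a * \<bar>x - c\<bar>))"
proof (rule exp_lipschitzI)
  fix x y :: real
  have d: "\<bar>a * \<bar>x + y - c\<bar> - a * \<bar>x - c\<bar>\<bar> \<le> \<bar>a\<bar> * \<bar>y\<bar>"
    unfolding right_diff_distrib[symmetric] abs_mult by (intro mult_left_mono) auto
  have "\<bar>a\<bar> * \<bar>x - c\<bar> \<le> \<bar>a\<bar> * (\<bar>x\<bar> + \<bar>c\<bar>)" by (intro mult_left_mono) auto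
  then have "\<bar>a * \<bar>x - c\<bar>\<bar> + \<bar>a * \<bar>x + y - c\<bar> - a * \<bar>x - c\<bar>\<bar> \<le> \<bar>a\<bar> * \<bar>c\<bar> + \<bar>a\<bar> * (\<bar>x\<bar> + \<bar>y\<bar>)"
    using d by (simp add: abs_mult distrib_left)
  then have "\<bar>exp (a * \<bar>x + y - c\<bar>) - exp (a * \<bar>x - c\<bar>)\<bar> \<le> (\<bar>a\<bar> * \<bar>y\<bar>) * exp (\<bar>a\<bar> * \<bar>c\<bar> + \<bar>a\<bar> * (\<bar>x\<bar> + \<bar>y\<bar>))"
    using d by (intro order_trans[OF exp_diff_bound] mult_mono) auto
  then show "\<bar>exp (a * \<bar>x + y - c\<bar>) - exp (a * \<bar>x - c\<bar>)\<bar>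
      \<le> (\<bar>a\<bar> * exp (\<bar>a\<bar> * \<bar>c\<bar>)) * exp (\<bar>a\<bar> * (\<bar>x\<bar> + \<bar>y\<bar>)) * \<bar>y\<bar>"
    by (simp add: exp_add mult_ac)
qed

lemma exp_lipschitz_isCont:
  assumes "exp_lipschitz f" shows "isCont f x"
proof -
  obtain C K where CK: "C \<ge> 0" "K \<ge> 0" "\<And>x y. \<bar>f (x + y) - f x\<bar> \<le> C * exp (K * (\<bar>x\<bar> + \<bar>y\<bar>)) * \<bar>y\<bar>"
    using exp_lipschitzE[OF assms] by blast
  have "((\<lambda>y. C * exp (K * (\<bar>x\<bar> + \<bar>y\<bar>)) * \<bar>y\<bar>) \<longlongrightarrow> C * exp (K * (\<bar>x\<bar> + \<bar>0\<bar>)) * \<bar>0\<bar>) (at 0)"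
    by (intro tendsto_intros)
  then have "((\<lambda>y. C * exp (K * (\<bar>x\<bar> + \<bar>y\<bar>)) * \<bar>y\<bar>) \<longlongrightarrow> 0) (at 0)" by simp
  then have "((\<lambda>y. f (x + y) - f x) \<longlongrightarrow> 0) (at 0)"
    by (rule Lim_null_comparison[rotated]) (use CK(3) in auto)
  then have "((\<lambda>y. f (x + y)) \<longlongrightarrow> f x) (at 0)" by (rule LIM_zero_cancel)
  then show ?thesis by (simp add: isCont_iff)
qed

lemma exp_lipschitz_measurable: "exp_lipschitz f \<Longrightarrow> f \<in> borel_measurable borel"
  by (intro borel_measurable_continuous_onI) (simp add: continuous_at_imp_continuous_on exp_lipschitz_isCont)

text \<open>The Lagrange remainder of second order differs from the second-order term by an increment of the
  second derivative, which need not be differentiable.\<close>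

lemma taylor_exp_lipschitz:
  assumes d1: "\<And>x. (w has_real_derivative w1 x) (at x)" and d2: "\<And>x. (w1 has_real_derivative w2 x) (at x)"
    and C: "C \<ge> 0" "K \<ge> 0" "\<And>x y. \<bar>w2 (x + y) - w2 x\<bar> \<le> C * exp (K * (\<bar>x\<bar> + \<bar>y\<bar>)) * \<bar>y\<bar>"
  shows "\<bar>w (x + y) - w x - w1 x * y - w2 x / 2 * y\<^sup>2\<bar> \<le> C * exp (K * (\<bar>x\<bar> + \<bar>y\<bar>)) * \<bar>y\<bar> ^ 3"
proof (cases "y = 0")
  case False
  define diff where "diff m = (if m = 0 then w else if m = 1 then w1 else w2)" for m :: nat
  have "\<exists>t. (if x + y < x then x + y < t \<and> t < x else x < t \<and> t < x + y) \<and>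
      w (x + y) = (\<Sum>m<2. diff m x / fact m * (x + y - x) ^ m) + diff 2 t / fact 2 * (x + y - x) ^ 2"
    by (rule Taylor[where a="x - \<bar>y\<bar>" and b="x + \<bar>y\<bar>"])
      (use d1 d2 False in \<open>auto simp: diff_def less_2_cases_iff\<close>)
  then obtain t where "if x + y < x then x + y < t \<and> t < x else x < t \<and> t < x + y"
      "w (x + y) = w x + w1 x * y + w2 t / 2 * y\<^sup>2"
    by (auto simp: diff_def numeral_2_eq_2)
  then have t: "\<bar>t - x\<bar> \<le> \<bar>y\<bar>" "w (x + y) = w x + w1 x * y + w2 t / 2 * y\<^sup>2"
    by (auto split: if_splits)
  have "\<bar>w (x + y) - w x - w1 x * y - w2 x / 2 * y\<^sup>2\<bar> = \<bar>w2 (x + (t - x)) - w2 x\<bar> / 2 * \<bar>y\<bar>\<^sup>2"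
  proof -
    have eq: "w (x + y) - w x - w1 x * y - w2 x / 2 * y\<^sup>2 = (w2 t - w2 x) / 2 * y\<^sup>2"
      using t(2) by (simp add: field_simps)
    show ?thesis unfolding eq by (simp add: abs_mult)
  qed
  also have "\<dots> \<le> \<bar>w2 (x + (t - x)) - w2 x\<bar> * \<bar>y\<bar>\<^sup>2"
    by (intro mult_right_mono) auto
  also have "\<dots> \<le> (C * exp (K * (\<bar>x\<bar> + \<bar>t - x\<bar>)) * \<bar>t - x\<bar>) * \<bar>y\<bar>\<^sup>2"
    by (intro mult_right_mono C(3)) auto
  also have "\<dots> \<le> (C * exp (K * (\<bar>x\<bar> + \<bar>y\<bar>)) * \<bar>y\<bar>) * \<bar>y\<bar>\<^sup>2"
    using C(1,2) t(1) by (intro mult_right_mono mult_mono) (auto intro!: mult_left_mono mult_nonneg_nonneg)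
  finally show ?thesis by (simp add: power3_eq_cube power2_eq_square mult_ac)
qed simp

lemma exp_sum_power2:
  "(exp (K * (a + d)) * d ^ p)\<^sup>2 = exp (2 * K * a) * (exp (2 * K * d) * d ^ (2 * p))" for a d K :: real
proof -
  have "(exp (K * (a + d)))\<^sup>2 = exp (2 * (K * (a + d)))" by (rule exp_double[symmetric])
  also have "2 * (K * (a + d)) = 2 * K * a + 2 * K * d" by (simp add: algebra_simps)
  finally have e: "(exp (K * (a + d)))\<^sup>2 = exp (2 * K * a) * exp (2 * K * d)" by (simp only: exp_add)
  show ?thesis unfolding power_mult_distrib e power_even_eq[of d p] by (rule mult.assoc)
qed

section \<open>Exponential moments along the path\<close>

context bm_horizon
begin

lemma
  assumes "0 \<le> t" "t \<le> T" "0 \<le> K"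
  shows integrable_exp_B: "integrable M (\<lambda>\<omega>. exp (K * \<bar>B t \<omega>\<bar>))"
    and expectation_exp_B: "expectation (\<lambda>\<omega>. exp (K * \<bar>B t \<omega>\<bar>)) \<le> gauss_exp_moment (K * sqrt T) 0"
proof -
  interpret G: prob_space std_normal_distribution by (rule prob_space_std_normal)
  have "integrable M (\<lambda>\<omega>. exp (K * \<bar>B t \<omega>\<bar>)) \<and> expectation (\<lambda>\<omega>. exp (K * \<bar>B t \<omega>\<bar>)) \<le> gauss_exp_moment (K * sqrt T) 0"
  proof (cases "t = 0")
    case True
    have ae: "AE \<omega> in M. exp (K * \<bar>B t \<omega>\<bar>) = 1" using start_zero True by (auto elim: eventually_mono)
    have m: "(\<lambda>\<omega>. exp (K * \<bar>B t \<omega>\<bar>)) \<in> borel_measurable M" using measurable_B[OF assms(1)] by measurable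
    have "1 = (\<integral>x. (1::real) \<partial>std_normal_distribution)"
      using lebesgue_integral_const[of std_normal_distribution "1::real"] G.prob_space by (simp del: lebesgue_integral_const space_density)
    also have "\<dots> \<le> gauss_exp_moment (K * sqrt T) 0"
      unfolding gauss_exp_moment_def using integrable_gauss_exp_moment[of "K * sqrt T" 0] assms(3) T_pos
      by (intro integral_mono) auto
    finally show ?thesis
      using integrable_cong_AE[OF m _ ae] integral_cong_AE[OF m _ ae] by (simp add: prob_space)
  next
    case False
    then have t: "0 < t" using assms by simp
    have b: "exp (K * \<bar>sqrt (t - 0) * x\<bar>) \<le> exp (K * sqrt T * \<bar>x\<bar>)" for x :: real
    proof -
      have "sqrt (t - 0) * \<bar>x\<bar> \<le> sqrt T * \<bar>x\<bar>" using assms by (intro mult_right_mono) auto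
      then have "K * (sqrt (t - 0) * \<bar>x\<bar>) \<le> K * (sqrt T * \<bar>x\<bar>)" using assms(3) by (rule mult_left_mono)
      then show ?thesis using t by (simp add: abs_mult mult.assoc)
    qed
    have i: "integrable std_normal_distribution (\<lambda>x. exp (K * \<bar>sqrt (t - 0) * x\<bar>))"
    proof (rule Bochner_Integration.integrable_bound)
      show "integrable std_normal_distribution (\<lambda>x. exp (K * sqrt T * \<bar>x\<bar>))"
        using integrable_gauss_exp_moment[of "K * sqrt T" 0] by simp
      show "AE x in std_normal_distribution. norm (exp (K * \<bar>sqrt (t - 0) * x\<bar>)) \<le> norm (exp (K * sqrt T * \<bar>x\<bar>))"
        using b by (intro AE_I2) (simp only: real_norm_def abs_exp_cancel)
    qed measurable
    have m: "(\<lambda>x. exp (K * \<bar>x\<bar>)) \<in> borel_measurable borel" by measurable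
    note I = integrable_increment[OF order_refl t m i] expectation_increment[OF order_refl t m i]
    have ae: "AE \<omega> in M. exp (K * \<bar>B t \<omega> - B 0 \<omega>\<bar>) = exp (K * \<bar>B t \<omega>\<bar>)"
      using start_zero by eventually_elim simp
    have m1: "(\<lambda>\<omega>. exp (K * \<bar>B t \<omega> - B 0 \<omega>\<bar>)) \<in> borel_measurable M" using I(1) by auto
    have m2: "(\<lambda>\<omega>. exp (K * \<bar>B t \<omega>\<bar>)) \<in> borel_measurable M" using measurable_B[OF assms(1)] by measurable
    have "(\<integral>x. exp (K * \<bar>sqrt (t - 0) * x\<bar>) \<partial>std_normal_distribution) \<le> gauss_exp_moment (K * sqrt T) 0"
      using integral_mono[OF i _ b] integrable_gauss_exp_moment[of "K * sqrt T" 0]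
      unfolding gauss_exp_moment_def by simp
    then show ?thesis
      using integrable_cong_AE[OF m1 m2 ae] integral_cong_AE[OF m1 m2 ae] I by simp
  qed
  then show "integrable M (\<lambda>\<omega>. exp (K * \<bar>B t \<omega>\<bar>))"
    "expectation (\<lambda>\<omega>. exp (K * \<bar>B t \<omega>\<bar>)) \<le> gauss_exp_moment (K * sqrt T) 0" by auto
qed

text \<open>The constant in the bound on exponentially weighted powers of an increment; independence of
  \<open>B a\<close> and \<open>B b - B a\<close> makes it a product of two Gaussian moments.\<close>

definition incr_const :: "real \<Rightarrow> nat \<Rightarrow> real" where
  "incr_const K p = sqrt (gauss_exp_moment (2 * K * sqrt T) 0 * gauss_exp_moment (2 * K * sqrt T) (2 * p))"

lemma incr_const_nonneg: "0 \<le> incr_const K p"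
  by (simp add: incr_const_def gauss_exp_moment_nonneg)

lemma
  assumes "0 \<le> a" "a < b" "b \<le> T" "0 \<le> K"
  shows L2_exp_increment: "L2 M (\<lambda>\<omega>. exp (K * (\<bar>B a \<omega>\<bar> + \<bar>B b \<omega> - B a \<omega>\<bar>)) * \<bar>B b \<omega> - B a \<omega>\<bar> ^ p)"
    and l2norm_exp_increment:
      "l2norm M (\<lambda>\<omega>. exp (K * (\<bar>B a \<omega>\<bar> + \<bar>B b \<omega> - B a \<omega>\<bar>)) * \<bar>B b \<omega> - B a \<omega>\<bar> ^ p)
        \<le> incr_const K p * sqrt (b - a) ^ p"
proof -
  let ?X = "\<lambda>\<omega>. exp (2 * K * \<bar>B a \<omega>\<bar>)" and ?f = "\<lambda>x::real. exp (2 * K * \<bar>x\<bar>) * \<bar>x\<bar> ^ (2 * p)"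
  have mX: "?X \<in> borel_measurable (F a)" using measurable_B_F[OF assms(1) order_refl] by measurable
  have iX: "integrable M ?X" and eX: "expectation ?X \<le> gauss_exp_moment (2 * K * sqrt T) 0"
    using integrable_exp_B[of a "2 * K"] expectation_exp_B[of a "2 * K"] assms by auto
  have mf: "?f \<in> borel_measurable borel" by measurable
  have b: "?f (sqrt (b - a) * x) \<le> sqrt (b - a) ^ (2 * p) * (exp (2 * K * sqrt T * \<bar>x\<bar>) * \<bar>x\<bar> ^ (2 * p))" for x
  proof -
    have "?f (sqrt (b - a) * x) = exp (2 * K * (sqrt (b - a) * \<bar>x\<bar>)) * \<bar>x\<bar> ^ (2 * p) * sqrt (b - a) ^ (2 * p)"
      using assms by (simp add: abs_mult power_mult_distrib mult_ac)
    also have "\<dots> \<le> exp (2 * K * (sqrt T * \<bar>x\<bar>)) * \<bar>x\<bar> ^ (2 * p) * sqrt (b - a) ^ (2 * p)"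
      using assms by (intro mult_right_mono) (auto intro!: mult_left_mono mult_right_mono)
    finally show ?thesis by (simp add: mult_ac)
  qed
  note ig = integrable_mult_right[OF integrable_gauss_exp_moment[of "2 * K * sqrt T" "2 * p"], of "sqrt (b - a) ^ (2 * p)"]
  have i: "integrable std_normal_distribution (\<lambda>x. ?f (sqrt (b - a) * x))"
  proof (rule Bochner_Integration.integrable_bound[OF ig])
    have "norm (?f (sqrt (b - a) * x)) \<le> norm (sqrt (b - a) ^ (2 * p) * (exp (2 * K * sqrt T * \<bar>x\<bar>) * \<bar>x\<bar> ^ (2 * p)))" for x
    proof -
      have "norm (?f (sqrt (b - a) * x)) = ?f (sqrt (b - a) * x)" by simp
      also note b[of x]
      finally show ?thesis using abs_ge_self order_trans by fastforce
    qed
    then show "AE x in std_normal_distribution. norm (?f (sqrt (b - a) * x))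
        \<le> norm (sqrt (b - a) ^ (2 * p) * (exp (2 * K * sqrt T * \<bar>x\<bar>) * \<bar>x\<bar> ^ (2 * p)))" by simp
  qed measurable
  have ef: "(\<integral>x. ?f (sqrt (b - a) * x) \<partial>std_normal_distribution)
      \<le> sqrt (b - a) ^ (2 * p) * gauss_exp_moment (2 * K * sqrt T) (2 * p)"
    using integral_mono[OF i ig b] by (simp add: gauss_exp_moment_def)
  have eq: "(exp (K * (\<bar>B a \<omega>\<bar> + \<bar>B b \<omega> - B a \<omega>\<bar>)) * \<bar>B b \<omega> - B a \<omega>\<bar> ^ p)\<^sup>2
      = ?X \<omega> * ?f (B b \<omega> - B a \<omega>)" for \<omega>
    by (rule exp_sum_power2)
  have m: "(\<lambda>\<omega>. exp (K * (\<bar>B a \<omega>\<bar> + \<bar>B b \<omega> - B a \<omega>\<bar>)) * \<bar>B b \<omega> - B a \<omega>\<bar> ^ p) \<in> borel_measurable M"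
  proof -
    have [measurable]: "B a \<in> borel_measurable M" "B b \<in> borel_measurable M"
      using measurable_B assms by auto
    show ?thesis by measurable
  qed
  show "L2 M (\<lambda>\<omega>. exp (K * (\<bar>B a \<omega>\<bar> + \<bar>B b \<omega> - B a \<omega>\<bar>)) * \<bar>B b \<omega> - B a \<omega>\<bar> ^ p)"
    unfolding L2_def eq using m integrable_mult_increment[OF assms(1,2) mf i mX iX] by auto
  have "(l2norm M (\<lambda>\<omega>. exp (K * (\<bar>B a \<omega>\<bar> + \<bar>B b \<omega> - B a \<omega>\<bar>)) * \<bar>B b \<omega> - B a \<omega>\<bar> ^ p))\<^sup>2
     = expectation ?X * (\<integral>x. ?f (sqrt (b - a) * x) \<partial>std_normal_distribution)"
    unfolding l2norm_power2 eq by (rule expectation_mult_increment[OF assms(1,2) mf i mX iX])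
  also have "\<dots> \<le> gauss_exp_moment (2 * K * sqrt T) 0 *
      (sqrt (b - a) ^ (2 * p) * gauss_exp_moment (2 * K * sqrt T) (2 * p))"
    by (intro mult_mono eX ef) (auto simp: gauss_exp_moment_nonneg intro!: integral_nonneg_AE)
  also have "\<dots> = (incr_const K p * sqrt (b - a) ^ p)\<^sup>2"
    by (simp add: incr_const_def power_mult_distrib gauss_exp_moment_nonneg power_even_eq)
  finally show "l2norm M (\<lambda>\<omega>. exp (K * (\<bar>B a \<omega>\<bar> + \<bar>B b \<omega> - B a \<omega>\<bar>)) * \<bar>B b \<omega> - B a \<omega>\<bar> ^ p)
        \<le> incr_const K p * sqrt (b - a) ^ p"
    by (rule power2_le_imp_le) (use assms in \<open>simp add: incr_const_nonneg\<close>)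
qed

lemma
  assumes "0 \<le> t" "t \<le> T" "0 \<le> K"
  shows L2_exp_B: "L2 M (\<lambda>\<omega>. exp (K * \<bar>B t \<omega>\<bar>))"
    and l2norm_exp_B: "l2norm M (\<lambda>\<omega>. exp (K * \<bar>B t \<omega>\<bar>)) \<le> sqrt (gauss_exp_moment (2 * K * sqrt T) 0)"
proof -
  have eq: "(exp (K * \<bar>B t \<omega>\<bar>))\<^sup>2 = exp (2 * K * \<bar>B t \<omega>\<bar>)" for \<omega>
    by (simp add: exp_double[symmetric] mult.assoc)
  have m: "(\<lambda>\<omega>. exp (K * \<bar>B t \<omega>\<bar>)) \<in> borel_measurable M" using measurable_B[OF assms(1)] by measurable
  show "L2 M (\<lambda>\<omega>. exp (K * \<bar>B t \<omega>\<bar>))"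
    unfolding L2_def eq using m integrable_exp_B[of t "2 * K"] assms by auto
  show "l2norm M (\<lambda>\<omega>. exp (K * \<bar>B t \<omega>\<bar>)) \<le> sqrt (gauss_exp_moment (2 * K * sqrt T) 0)"
    unfolding l2norm_def eq using expectation_exp_B[of t "2 * K"] assms by (intro real_sqrt_le_mono) auto
qed

end

section \<open>Ito's formula for separated functions\<close>

context std_brownian_motion
begin

text \<open>For orthogonal summands the squares of the norms add up; this gains a factor \<open>sqrt n\<close> over the
  triangle inequality, without which the quadratic terms in Ito's formula would not vanish.\<close>

lemma l2norm_sum_orthogonal:
  assumes "\<And>i. i < n \<Longrightarrow> L2 M (Q i)" "\<And>i. i < n \<Longrightarrow> (l2norm M (Q i))\<^sup>2 \<le> D"
    and "\<And>i j. i < j \<Longrightarrow> j < n \<Longrightarrow> expectation (\<lambda>\<omega>. Q i \<omega> * Q j \<omega>) = 0"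
  shows "(l2norm M (\<lambda>\<omega>. \<Sum>i<n. Q i \<omega>))\<^sup>2 \<le> real n * D"
  using assms
proof (induction n)
  case (Suc n)
  let ?S = "\<lambda>\<omega>. \<Sum>i<n. Q i \<omega>"
  have LS: "L2 M ?S" and LQ: "L2 M (Q n)" using Suc.prems(1) by (auto intro: L2_sum)
  have "expectation (\<lambda>\<omega>. ?S \<omega> * Q n \<omega>) = (\<Sum>i<n. expectation (\<lambda>\<omega>. Q i \<omega> * Q n \<omega>))"
    unfolding sum_distrib_right
    using Suc.prems(1) by (intro Bochner_Integration.integral_sum L2_mult_integrable) auto
  also have "\<dots> = 0" using Suc.prems(3) by simp
  finally have z: "expectation (\<lambda>\<omega>. ?S \<omega> * Q n \<omega>) = 0" .
  have "(l2norm M (\<lambda>\<omega>. ?S \<omega> + Q n \<omega>))\<^sup>2 = expectation (\<lambda>\<omega>. (?S \<omega>)\<^sup>2 + 2 * (?S \<omega> * Q n \<omega>) + (Q n \<omega>)\<^sup>2)"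
    unfolding l2norm_power2 by (intro Bochner_Integration.integral_cong) (auto simp: power2_sum algebra_simps)
  also have "\<dots> = (l2norm M ?S)\<^sup>2 + (l2norm M (Q n))\<^sup>2"
    using LS LQ L2_mult_integrable[OF LS LQ] z by (simp add: L2_def l2norm_power2)
  also have "\<dots> \<le> real n * D + D"
    using Suc.IH Suc.prems by (intro add_mono) auto
  finally show ?case by (simp add: algebra_simps)
qed simp

end

context bm_horizon
begin

text \<open>Integrating a bound that is uniform in time over the horizon.\<close>

lemma
  assumes V: "V \<in> borel_measurable mu" and D: "0 \<le> D"
    and L: "\<And>s. 0 \<le> s \<Longrightarrow> s \<le> T \<Longrightarrow> L2 M (\<lambda>\<omega>. V (s, \<omega>)) \<and> l2norm M (\<lambda>\<omega>. V (s, \<omega>)) \<le> D"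
  shows L2_mu_slices: "L2 mu V" and l2norm_mu_slices: "l2norm mu V \<le> sqrt T * D"
proof -
  have m: "(\<lambda>x. ennreal ((V x)\<^sup>2)) \<in> borel_measurable mu" using V by measurable
  have "(\<integral>\<^sup>+x. ennreal ((V x)\<^sup>2) \<partial>mu) = (\<integral>\<^sup>+s. (\<integral>\<^sup>+\<omega>. ennreal ((V (s, \<omega>))\<^sup>2) \<partial>M) \<partial>lam)"
    using nn_integral_fst[OF m] by simp
  also have "\<dots> \<le> (\<integral>\<^sup>+s. ennreal (D\<^sup>2) \<partial>lam)"
  proof (rule nn_integral_mono)
    fix s assume "s \<in> space lam"
    then have s: "L2 M (\<lambda>\<omega>. V (s, \<omega>))" "l2norm M (\<lambda>\<omega>. V (s, \<omega>)) \<le> D" using L[of s] by auto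
    show "(\<integral>\<^sup>+\<omega>. ennreal ((V (s, \<omega>))\<^sup>2) \<partial>M) \<le> ennreal (D\<^sup>2)"
      unfolding nn_integral_l2norm[OF s(1)] using s(2) by (intro ennreal_leI power_mono) auto
  qed
  also have "\<dots> = ennreal (D\<^sup>2 * T)"
    using T_pos by (simp add: emeasure_lam ennreal_mult')
  finally have le: "(\<integral>\<^sup>+x. ennreal ((V x)\<^sup>2) \<partial>mu) \<le> ennreal (D\<^sup>2 * T)" .
  show LV: "L2 mu V" by (rule L2_nn_integral[OF V]) (rule le_less_trans[OF le], simp)
  have "(l2norm mu V)\<^sup>2 \<le> D\<^sup>2 * T" using le T_pos unfolding nn_integral_l2norm[OF LV]
    by (subst (asm) ennreal_le_iff) auto
  also have "\<dots> = (sqrt T * D)\<^sup>2" using T_pos by (simp add: power_mult_distrib)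
  finally show "l2norm mu V \<le> sqrt T * D" by (rule power2_le_imp_le) (use D T_pos in simp)
qed

text \<open>The separated functions $e^{\beta s} f(x)$ for which Ito's formula is proved.\<close>

definition discounted :: "real \<Rightarrow> (real \<Rightarrow> real) \<Rightarrow> real \<Rightarrow> real \<Rightarrow> real" where
  "discounted \<beta> f s x = exp (\<beta> * s) * f x"

lemma exp_time_bound: "0 \<le> s \<Longrightarrow> s \<le> T \<Longrightarrow> exp (\<beta> * s) \<le> exp (\<bar>\<beta>\<bar> * T)"
  by (simp, rule order_trans[of _ "\<bar>\<beta>\<bar> * s"]) (auto intro: mult_right_mono mult_left_mono)

lemma discounted_L2:
  assumes "exp_lipschitz f"
  obtains D where "D \<ge> 0"
    "\<And>s. 0 \<le> s \<Longrightarrow> s \<le> T \<Longrightarrow> L2 M (\<lambda>\<omega>. discounted \<beta> f s (B s \<omega>)) \<and> l2norm M (\<lambda>\<omega>. discounted \<beta> f s (B s \<omega>)) \<le> D"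
proof -
  obtain C K where CK: "C \<ge> 0" "K \<ge> 0" "\<And>x. \<bar>f x\<bar> \<le> C * exp (K * \<bar>x\<bar>)"
    using exp_lipschitz_growth[OF assms] by blast
  define R where "R = exp (\<bar>\<beta>\<bar> * T) * C"
  have R0: "R \<ge> 0" using CK(1) by (simp add: R_def)
  show ?thesis
  proof (rule that[of "R * sqrt (gauss_exp_moment (2 * K * sqrt T) 0)"])
    show "0 \<le> R * sqrt (gauss_exp_moment (2 * K * sqrt T) 0)"
      using R0 gauss_exp_moment_nonneg by (intro mult_nonneg_nonneg) auto
    fix s assume s: "0 \<le> s" "s \<le> T"
    have m: "(\<lambda>\<omega>. discounted \<beta> f s (B s \<omega>)) \<in> borel_measurable M"
      unfolding discounted_def using measurable_compose[OF measurable_B[OF s(1)] exp_lipschitz_measurable[OF assms]]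
      by measurable
    have b: "\<bar>discounted \<beta> f s (B s \<omega>)\<bar> \<le> \<bar>R * exp (K * \<bar>B s \<omega>\<bar>)\<bar>" for \<omega>
    proof -
      have "\<bar>discounted \<beta> f s (B s \<omega>)\<bar> \<le> exp (\<bar>\<beta>\<bar> * T) * (C * exp (K * \<bar>B s \<omega>\<bar>))"
        unfolding discounted_def abs_mult using exp_time_bound[OF s] CK by (intro mult_mono) auto
      then show ?thesis using R0 CK(1) by (simp add: R_def mult.assoc abs_mult abs_of_nonneg)
    qed
    note LB = L2_cmult[OF L2_exp_B[OF s CK(2)], of R]
    have "l2norm M (\<lambda>\<omega>. discounted \<beta> f s (B s \<omega>)) \<le> l2norm M (\<lambda>\<omega>. R * exp (K * \<bar>B s \<omega>\<bar>))"
      by (rule l2norm_mono[OF m LB]) (use b in simp)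
    also have "\<dots> \<le> R * sqrt (gauss_exp_moment (2 * K * sqrt T) 0)"
      unfolding l2norm_cmult using l2norm_exp_B[OF s CK(2)] R0 by (simp add: mult_left_mono)
    finally show "L2 M (\<lambda>\<omega>. discounted \<beta> f s (B s \<omega>)) \<and>
        l2norm M (\<lambda>\<omega>. discounted \<beta> f s (B s \<omega>)) \<le> R * sqrt (gauss_exp_moment (2 * K * sqrt T) 0)"
      using L2_bound[OF m LB] b by simp
  qed
qed

lemma exp_increment_bound:
  assumes "0 \<le> a" "a \<le> b" "b \<le> T"
  shows "\<bar>exp (\<beta> * b) - exp (\<beta> * a)\<bar> \<le> \<bar>\<beta>\<bar> * exp (2 * \<bar>\<beta>\<bar> * T) * (b - a)"
    and "\<bar>exp (\<beta> * b) - exp (\<beta> * a) - \<beta> * exp (\<beta> * a) * (b - a)\<bar> \<le> \<beta>\<^sup>2 * exp (2 * \<bar>\<beta>\<bar> * T) * (b - a)\<^sup>2"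
proof -
  let ?u = "\<beta> * (b - a)"
  have e: "exp (\<beta> * b) = exp (\<beta> * a) * exp ?u" by (simp add: exp_add[symmetric] algebra_simps)
  have ea: "exp (\<beta> * a) \<le> exp (\<bar>\<beta>\<bar> * T)" using assms by (intro exp_time_bound) auto
  have u: "\<bar>?u\<bar> = \<bar>\<beta>\<bar> * (b - a)" using assms by (simp add: abs_mult)
  have eu: "exp \<bar>?u\<bar> \<le> exp (\<bar>\<beta>\<bar> * T)" unfolding u using assms by (auto intro: mult_left_mono)
  have ee: "exp (\<bar>\<beta>\<bar> * T) * exp (\<bar>\<beta>\<bar> * T) = exp (2 * \<bar>\<beta>\<bar> * T)" by (simp add: exp_add[symmetric])
  have "exp (\<beta> * b) - exp (\<beta> * a) = exp (\<beta> * a) * (exp ?u - 1)" unfolding e by (simp add: algebra_simps)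
  then have "\<bar>exp (\<beta> * b) - exp (\<beta> * a)\<bar> = exp (\<beta> * a) * \<bar>exp ?u - 1\<bar>" by (simp add: abs_mult)
  also have "\<dots> \<le> exp (\<bar>\<beta>\<bar> * T) * (\<bar>?u\<bar> * exp \<bar>?u\<bar>)"
    by (intro mult_mono ea exp_minus_one_bound) auto
  also have "\<dots> \<le> exp (\<bar>\<beta>\<bar> * T) * (\<bar>?u\<bar> * exp (\<bar>\<beta>\<bar> * T))"
    by (intro mult_left_mono eu) auto
  also have "\<dots> = \<bar>\<beta>\<bar> * exp (2 * \<bar>\<beta>\<bar> * T) * (b - a)" unfolding u ee[symmetric] by (simp add: mult_ac)
  finally show "\<bar>exp (\<beta> * b) - exp (\<beta> * a)\<bar> \<le> \<bar>\<beta>\<bar> * exp (2 * \<bar>\<beta>\<bar> * T) * (b - a)" .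
  have "exp (\<beta> * b) - exp (\<beta> * a) - \<beta> * exp (\<beta> * a) * (b - a) = exp (\<beta> * a) * (exp ?u - 1 - ?u)"
    unfolding e by (simp add: algebra_simps)
  then have "\<bar>exp (\<beta> * b) - exp (\<beta> * a) - \<beta> * exp (\<beta> * a) * (b - a)\<bar> = exp (\<beta> * a) * \<bar>exp ?u - 1 - ?u\<bar>"
    by (simp add: abs_mult)
  also have "\<dots> \<le> exp (\<bar>\<beta>\<bar> * T) * (?u\<^sup>2 * exp \<bar>?u\<bar>)"
    by (intro mult_mono ea exp_second_order_bound) auto
  also have "\<dots> \<le> exp (\<bar>\<beta>\<bar> * T) * (?u\<^sup>2 * exp (\<bar>\<beta>\<bar> * T))"
    by (intro mult_left_mono eu) auto
  also have "\<dots> = \<beta>\<^sup>2 * exp (2 * \<bar>\<beta>\<bar> * T) * (b - a)\<^sup>2"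
    unfolding ee[symmetric] power_mult_distrib by (simp add: mult_ac)
  finally show "\<bar>exp (\<beta> * b) - exp (\<beta> * a) - \<beta> * exp (\<beta> * a) * (b - a)\<bar> \<le> \<beta>\<^sup>2 * exp (2 * \<bar>\<beta>\<bar> * T) * (b - a)\<^sup>2" .
qed

text \<open>Exponential moments absorb the growth of the spatial modulus and leave the order \<open>sqrt (b - a)\<close> of
  the increment of \<open>B\<close>; the time factor contributes the higher order \<open>b - a\<close>.\<close>

lemma discounted_increment:
  assumes "exp_lipschitz f"
  obtains D where "D \<ge> 0"
    "\<And>a b. 0 \<le> a \<Longrightarrow> a < b \<Longrightarrow> b \<le> T \<Longrightarrow>
      L2 M (\<lambda>\<omega>. discounted \<beta> f b (B b \<omega>) - discounted \<beta> f a (B a \<omega>)) \<and>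
      l2norm M (\<lambda>\<omega>. discounted \<beta> f b (B b \<omega>) - discounted \<beta> f a (B a \<omega>)) \<le> D * sqrt (b - a)"
proof -
  obtain C K where CK: "C \<ge> 0" "K \<ge> 0" "\<And>x y. \<bar>f (x + y) - f x\<bar> \<le> C * exp (K * (\<bar>x\<bar> + \<bar>y\<bar>)) * \<bar>y\<bar>"
    using exp_lipschitzE[OF assms] by blast
  obtain C' K' where CK': "C' \<ge> 0" "K' \<ge> 0" "\<And>x. \<bar>f x\<bar> \<le> C' * exp (K' * \<bar>x\<bar>)"
    using exp_lipschitz_growth[OF assms] by blast
  define R where "R = exp (\<bar>\<beta>\<bar> * T) * C"
  define R' where "R' = \<bar>\<beta>\<bar> * exp (2 * \<bar>\<beta>\<bar> * T) * C'"
  define D where "D = R * incr_const K 1 + R' * incr_const K' 0 * sqrt T"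
  have R0: "R \<ge> 0" "R' \<ge> 0" using CK(1) CK'(1) by (auto simp: R_def R'_def)
  have "D \<ge> 0" using R0 T_pos by (auto simp: D_def incr_const_nonneg)
  moreover have "L2 M (\<lambda>\<omega>. discounted \<beta> f b (B b \<omega>) - discounted \<beta> f a (B a \<omega>)) \<and>
      l2norm M (\<lambda>\<omega>. discounted \<beta> f b (B b \<omega>) - discounted \<beta> f a (B a \<omega>)) \<le> D * sqrt (b - a)"
    if ab: "0 \<le> a" "a < b" "b \<le> T" for a b
  proof -
    let ?X = "\<lambda>\<omega>. exp (K * (\<bar>B a \<omega>\<bar> + \<bar>B b \<omega> - B a \<omega>\<bar>)) * \<bar>B b \<omega> - B a \<omega>\<bar> ^ 1"
    let ?X' = "\<lambda>\<omega>. exp (K' * (\<bar>B a \<omega>\<bar> + \<bar>B b \<omega> - B a \<omega>\<bar>)) * \<bar>B b \<omega> - B a \<omega>\<bar> ^ 0"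
    note L = L2_exp_increment[OF ab CK(2), of 1] L2_exp_increment[OF ab CK'(2), of 0]
    note N = l2norm_exp_increment[OF ab CK(2), of 1] l2norm_exp_increment[OF ab CK'(2), of 0]
    have mb: "B a \<in> borel_measurable M" "B b \<in> borel_measurable M" using measurable_B ab by auto
    have m: "(\<lambda>\<omega>. discounted \<beta> f b (B b \<omega>) - discounted \<beta> f a (B a \<omega>)) \<in> borel_measurable M"
      unfolding discounted_def using mb[THEN measurable_compose, OF exp_lipschitz_measurable[OF assms]] by measurable
    have b: "\<bar>discounted \<beta> f b (B b \<omega>) - discounted \<beta> f a (B a \<omega>)\<bar> \<le> \<bar>R * ?X \<omega> + (R' * (b - a)) * ?X' \<omega>\<bar>" for \<omega>
    proof -
      have "discounted \<beta> f b (B b \<omega>) - discounted \<beta> f a (B a \<omega>)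
        = exp (\<beta> * b) * (f (B a \<omega> + (B b \<omega> - B a \<omega>)) - f (B a \<omega>)) + (exp (\<beta> * b) - exp (\<beta> * a)) * f (B a \<omega>)"
        by (simp add: discounted_def algebra_simps)
      also have "\<bar>\<dots>\<bar> \<le> exp (\<beta> * b) * \<bar>f (B a \<omega> + (B b \<omega> - B a \<omega>)) - f (B a \<omega>)\<bar> + \<bar>exp (\<beta> * b) - exp (\<beta> * a)\<bar> * \<bar>f (B a \<omega>)\<bar>"
        by (rule order_trans[OF abs_triangle_ineq]) (simp add: abs_mult)
      also have "\<dots> \<le> exp (\<bar>\<beta>\<bar> * T) * (C * exp (K * (\<bar>B a \<omega>\<bar> + \<bar>B b \<omega> - B a \<omega>\<bar>)) * \<bar>B b \<omega> - B a \<omega>\<bar>)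
          + (\<bar>\<beta>\<bar> * exp (2 * \<bar>\<beta>\<bar> * T) * (b - a)) * (C' * exp (K' * (\<bar>B a \<omega>\<bar> + \<bar>B b \<omega> - B a \<omega>\<bar>)))"
      proof (intro add_mono mult_mono CK(3) exp_time_bound exp_increment_bound)
        have "\<bar>f (B a \<omega>)\<bar> \<le> C' * exp (K' * \<bar>B a \<omega>\<bar>)" by (rule CK'(3))
        also have "\<dots> \<le> C' * exp (K' * (\<bar>B a \<omega>\<bar> + \<bar>B b \<omega> - B a \<omega>\<bar>))"
          using CK' by (intro mult_left_mono) (auto intro: mult_left_mono)
        finally show "\<bar>f (B a \<omega>)\<bar> \<le> C' * exp (K' * (\<bar>B a \<omega>\<bar> + \<bar>B b \<omega> - B a \<omega>\<bar>))" .
      qed (use ab CK in auto)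
      also have "\<dots> = R * ?X \<omega> + (R' * (b - a)) * ?X' \<omega>" by (simp add: R_def R'_def mult_ac)
      finally show ?thesis by linarith
    qed
    have LL: "L2 M (\<lambda>\<omega>. R * ?X \<omega> + (R' * (b - a)) * ?X' \<omega>)" by (intro L2_add L2_cmult L)
    have "l2norm M (\<lambda>\<omega>. discounted \<beta> f b (B b \<omega>) - discounted \<beta> f a (B a \<omega>)) \<le> l2norm M (\<lambda>\<omega>. R * ?X \<omega> + (R' * (b - a)) * ?X' \<omega>)"
      by (rule l2norm_mono[OF m LL]) (use b in simp)
    also have "\<dots> \<le> R * l2norm M ?X + (R' * (b - a)) * l2norm M ?X'"
      using l2norm_triangle[OF L2_cmult[OF L(1), of R] L2_cmult[OF L(2), of "R' * (b - a)"]] R0 ab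
      by (simp add: l2norm_cmult abs_mult)
    also have "\<dots> \<le> R * (incr_const K 1 * sqrt (b - a) ^ 1) + (R' * (b - a)) * (incr_const K' 0 * sqrt (b - a) ^ 0)"
      using N R0 ab by (intro add_mono mult_left_mono) auto
    also have "\<dots> = R * incr_const K 1 * sqrt (b - a) + R' * incr_const K' 0 * (b - a)" by simp
    also have "\<dots> \<le> R * incr_const K 1 * sqrt (b - a) + R' * incr_const K' 0 * (sqrt T * sqrt (b - a))"
    proof (intro add_left_mono mult_left_mono)
      have "b - a = sqrt (b - a) * sqrt (b - a)" using ab by simp
      also have "\<dots> \<le> sqrt T * sqrt (b - a)" using ab by (intro mult_right_mono) auto
      finally show "b - a \<le> sqrt T * sqrt (b - a)" .
    qed (use R0 in \<open>auto simp: incr_const_nonneg\<close>)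
    also have "\<dots> = D * sqrt (b - a)" by (simp add: D_def algebra_simps)
    finally show ?thesis using L2_bound[OF m LL] b by simp
  qed
  ultimately show ?thesis using that by blast
qed

definition taylor_error ::
    "real \<Rightarrow> (real \<Rightarrow> real) \<Rightarrow> (real \<Rightarrow> real) \<Rightarrow> (real \<Rightarrow> real) \<Rightarrow> real \<Rightarrow> real \<Rightarrow> 'a \<Rightarrow> real" where
  "taylor_error \<beta> w w1 w2 a b \<omega> =
     discounted \<beta> w b (B b \<omega>) - discounted \<beta> w a (B a \<omega>) - discounted \<beta> w1 a (B a \<omega>) * (B b \<omega> - B a \<omega>)
     - \<beta> * discounted \<beta> w a (B a \<omega>) * (b - a) - discounted \<beta> w2 a (B a \<omega>) / 2 * (B b \<omega> - B a \<omega>)\<^sup>2"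

text \<open>An increment of \<open>B\<close> over a time \<open>\<delta>\<close> is of order \<open>sqrt \<delta>\<close>, so the cubic Taylor remainder is of
  order \<open>\<delta> * sqrt \<delta>\<close>. Summed over \<open>1 / \<delta>\<close> intervals it still tends to \<open>0\<close>.\<close>

lemma ito_local_error:
  assumes d1: "\<And>x. (w has_real_derivative w1 x) (at x)" and d2: "\<And>x. (w1 has_real_derivative w2 x) (at x)"
    and e: "exp_lipschitz w" "exp_lipschitz w1" "exp_lipschitz w2"
  obtains D where "D \<ge> 0"
    "\<And>a b. 0 \<le> a \<Longrightarrow> a < b \<Longrightarrow> b \<le> T \<Longrightarrow> L2 M (taylor_error \<beta> w w1 w2 a b) \<and>
      l2norm M (taylor_error \<beta> w w1 w2 a b) \<le> D * (b - a) * sqrt (b - a)"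
proof -
  obtain C K where CK: "C \<ge> 0" "K \<ge> 0" "\<And>x y. \<bar>w2 (x + y) - w2 x\<bar> \<le> C * exp (K * (\<bar>x\<bar> + \<bar>y\<bar>)) * \<bar>y\<bar>"
    using exp_lipschitzE[OF e(3)] by blast
  obtain C1 K1 where CK1: "C1 \<ge> 0" "K1 \<ge> 0" "\<And>x y. \<bar>w (x + y) - w x\<bar> \<le> C1 * exp (K1 * (\<bar>x\<bar> + \<bar>y\<bar>)) * \<bar>y\<bar>"
    using exp_lipschitzE[OF e(1)] by blast
  obtain C2 K2 where CK2: "C2 \<ge> 0" "K2 \<ge> 0" "\<And>x. \<bar>w x\<bar> \<le> C2 * exp (K2 * \<bar>x\<bar>)"
    using exp_lipschitz_growth[OF e(1)] by blast
  define R where "R = exp (\<bar>\<beta>\<bar> * T) * C"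
  define R1 where "R1 = \<bar>\<beta>\<bar> * exp (2 * \<bar>\<beta>\<bar> * T) * C1"
  define R2 where "R2 = \<beta>\<^sup>2 * exp (2 * \<bar>\<beta>\<bar> * T) * C2"
  define D where "D = R * incr_const K 3 + R1 * incr_const K1 1 + R2 * incr_const K2 0 * sqrt T"
  have R0: "R \<ge> 0" "R1 \<ge> 0" "R2 \<ge> 0" using CK(1) CK1(1) CK2(1) by (auto simp: R_def R1_def R2_def)
  have "D \<ge> 0" using R0 T_pos by (auto simp: D_def incr_const_nonneg)
  moreover have "L2 M (taylor_error \<beta> w w1 w2 a b) \<and>
      l2norm M (taylor_error \<beta> w w1 w2 a b) \<le> D * (b - a) * sqrt (b - a)" (is "L2 M ?E \<and> _")
    if ab: "0 \<le> a" "a < b" "b \<le> T" for a b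
  proof -
    let ?Y = "\<lambda>\<omega>. \<bar>B b \<omega> - B a \<omega>\<bar>"
    let ?X = "\<lambda>\<omega>. exp (K * (\<bar>B a \<omega>\<bar> + ?Y \<omega>)) * ?Y \<omega> ^ 3"
    let ?X1 = "\<lambda>\<omega>. exp (K1 * (\<bar>B a \<omega>\<bar> + ?Y \<omega>)) * ?Y \<omega> ^ 1"
    let ?X2 = "\<lambda>\<omega>. exp (K2 * (\<bar>B a \<omega>\<bar> + ?Y \<omega>)) * ?Y \<omega> ^ 0"
    note L = L2_exp_increment[OF ab CK(2), of 3] L2_exp_increment[OF ab CK1(2), of 1] L2_exp_increment[OF ab CK2(2), of 0]
    note N = l2norm_exp_increment[OF ab CK(2), of 3] l2norm_exp_increment[OF ab CK1(2), of 1] l2norm_exp_increment[OF ab CK2(2), of 0]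
    have mb: "B a \<in> borel_measurable M" "B b \<in> borel_measurable M" using measurable_B ab by auto
    note [measurable] = mb mb[THEN measurable_compose, OF exp_lipschitz_measurable[OF e(1)]]
      mb[THEN measurable_compose, OF exp_lipschitz_measurable[OF e(2)]]
      mb[THEN measurable_compose, OF exp_lipschitz_measurable[OF e(3)]]
    have m: "?E \<in> borel_measurable M" unfolding taylor_error_def[abs_def] discounted_def by measurable
    have b: "\<bar>?E \<omega>\<bar> \<le> \<bar>R * ?X \<omega> + ((R1 * (b - a)) * ?X1 \<omega> + (R2 * (b - a)\<^sup>2) * ?X2 \<omega>)\<bar>" for \<omega>
    proof -
      define x where "x = B a \<omega>"
      define y where "y = B b \<omega> - B a \<omega>"
      have xy: "B b \<omega> = x + y" "B a \<omega> = x" by (simp_all add: x_def y_def)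
      have "?E \<omega> = exp (\<beta> * a) * (w (x + y) - w x - w1 x * y - w2 x / 2 * y\<^sup>2)
          + ((exp (\<beta> * b) - exp (\<beta> * a)) * (w (x + y) - w x)
          + (exp (\<beta> * b) - exp (\<beta> * a) - \<beta> * exp (\<beta> * a) * (b - a)) * w x)"
        unfolding taylor_error_def xy discounted_def by (simp add: algebra_simps)
      also have "\<bar>\<dots>\<bar> \<le> exp (\<beta> * a) * \<bar>w (x + y) - w x - w1 x * y - w2 x / 2 * y\<^sup>2\<bar>
          + (\<bar>exp (\<beta> * b) - exp (\<beta> * a)\<bar> * \<bar>w (x + y) - w x\<bar>
          + \<bar>exp (\<beta> * b) - exp (\<beta> * a) - \<beta> * exp (\<beta> * a) * (b - a)\<bar> * \<bar>w x\<bar>)"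
        by (rule order_trans[OF abs_triangle_ineq add_mono[OF _ order_trans[OF abs_triangle_ineq]]]) (simp_all add: abs_mult)
      also have "\<dots> \<le> exp (\<bar>\<beta>\<bar> * T) * (C * exp (K * (\<bar>x\<bar> + \<bar>y\<bar>)) * \<bar>y\<bar> ^ 3)
          + ((\<bar>\<beta>\<bar> * exp (2 * \<bar>\<beta>\<bar> * T) * (b - a)) * (C1 * exp (K1 * (\<bar>x\<bar> + \<bar>y\<bar>)) * \<bar>y\<bar>)
          + (\<beta>\<^sup>2 * exp (2 * \<bar>\<beta>\<bar> * T) * (b - a)\<^sup>2) * (C2 * exp (K2 * (\<bar>x\<bar> + \<bar>y\<bar>))))"
      proof (intro add_mono mult_mono taylor_exp_lipschitz[OF d1 d2 CK] CK1(3) exp_time_bound exp_increment_bound)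
        have "\<bar>w x\<bar> \<le> C2 * exp (K2 * \<bar>x\<bar>)" by (rule CK2(3))
        also have "\<dots> \<le> C2 * exp (K2 * (\<bar>x\<bar> + \<bar>y\<bar>))"
          using CK2 by (intro mult_left_mono) (auto intro: mult_left_mono)
        finally show "\<bar>w x\<bar> \<le> C2 * exp (K2 * (\<bar>x\<bar> + \<bar>y\<bar>))" .
      qed (use ab CK CK1 in auto)
      also have "\<dots> = R * ?X \<omega> + ((R1 * (b - a)) * ?X1 \<omega> + (R2 * (b - a)\<^sup>2) * ?X2 \<omega>)"
        unfolding y_def[symmetric] unfolding x_def[symmetric] by (simp add: R_def R1_def R2_def mult_ac)
      finally show ?thesis by linarith
    qed
    note LX = L2_cmult[OF L(1), of R] L2_cmult[OF L(2), of "R1 * (b - a)"] L2_cmult[OF L(3), of "R2 * (b - a)\<^sup>2"]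
    have LL: "L2 M (\<lambda>\<omega>. R * ?X \<omega> + ((R1 * (b - a)) * ?X1 \<omega> + (R2 * (b - a)\<^sup>2) * ?X2 \<omega>))"
      by (intro L2_add LX)
    have "l2norm M ?E \<le> l2norm M (\<lambda>\<omega>. R * ?X \<omega> + ((R1 * (b - a)) * ?X1 \<omega> + (R2 * (b - a)\<^sup>2) * ?X2 \<omega>))"
      by (rule l2norm_mono[OF m LL]) (use b in simp)
    also have "\<dots> \<le> R * l2norm M ?X + ((R1 * (b - a)) * l2norm M ?X1 + (R2 * (b - a)\<^sup>2) * l2norm M ?X2)"
      using l2norm_triangle[OF LX(1) L2_add[OF LX(2,3)]] l2norm_triangle[OF LX(2,3)] R0 ab
      unfolding l2norm_cmult by (simp add: abs_mult)
    also have "\<dots> \<le> R * (incr_const K 3 * sqrt (b - a) ^ 3) + ((R1 * (b - a)) * (incr_const K1 1 * sqrt (b - a) ^ 1)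
        + (R2 * (b - a)\<^sup>2) * (incr_const K2 0 * sqrt (b - a) ^ 0))"
      using N R0 ab by (intro add_mono mult_left_mono) auto
    also have "\<dots> = (R * incr_const K 3 + R1 * incr_const K1 1) * ((b - a) * sqrt (b - a)) + R2 * incr_const K2 0 * (b - a)\<^sup>2"
      using ab by (simp add: power3_eq_cube algebra_simps)
    also have "\<dots> \<le> (R * incr_const K 3 + R1 * incr_const K1 1) * ((b - a) * sqrt (b - a))
        + R2 * incr_const K2 0 * (sqrt T * ((b - a) * sqrt (b - a)))"
    proof (intro add_left_mono mult_left_mono)
      have "(b - a)\<^sup>2 = (b - a) * (sqrt (b - a) * sqrt (b - a))" using ab by (simp add: power2_eq_square)
      also have "\<dots> \<le> (b - a) * (sqrt T * sqrt (b - a))" using ab by (intro mult_left_mono mult_right_mono) auto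
      finally show "(b - a)\<^sup>2 \<le> sqrt T * ((b - a) * sqrt (b - a))" by (simp add: mult_ac)
    qed (use R0 in \<open>auto simp: incr_const_nonneg\<close>)
    also have "\<dots> = D * (b - a) * sqrt (b - a)" by (simp add: D_def algebra_simps)
    finally show ?thesis using L2_bound[OF m LL] b by simp
  qed
  ultimately show ?thesis using that by blast
qed


definition grid :: "real \<Rightarrow> nat \<Rightarrow> nat \<Rightarrow> real" where
  "grid t n i = t + real i * ((T - t) / real n)"

definition discounted_step :: "real \<Rightarrow> (real \<Rightarrow> real) \<Rightarrow> real \<Rightarrow> nat \<Rightarrow> real \<times> 'a \<Rightarrow> real" where
  "discounted_step \<beta> f t n x =
     (\<Sum>i<n. discounted \<beta> f (grid t n i) (B (grid t n i) (snd x)) * indicator {grid t n i<..grid t n (Suc i)} (fst x))"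

context
  fixes t :: real and n :: nat
  assumes t: "0 \<le> t" "t < T" and n: "0 < n"
begin

lemma grid_simps: "grid t n 0 = t" "grid t n n = T" "grid t n (Suc i) - grid t n i = (T - t) / real n"
  using n by (auto simp: grid_def field_simps)

lemma grid_mono: "i \<le> j \<Longrightarrow> grid t n i \<le> grid t n j" "i < j \<Longrightarrow> grid t n i < grid t n j"
  using t n by (auto simp: grid_def intro!: divide_right_mono mult_right_mono mult_strict_right_mono divide_strict_right_mono)

lemma grid_range: "i \<le> n \<Longrightarrow> t \<le> grid t n i \<and> grid t n i \<le> T \<and> 0 \<le> grid t n i"
  using grid_mono(1)[of 0 i] grid_mono(1)[of i n] grid_simps t by auto

lemma grid_cell:
  assumes "t < s" "s \<le> T"
  obtains i where "i < n" "grid t n i < s" "s \<le> grid t n (Suc i)"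
proof -
  define j where "j = (LEAST j. s \<le> grid t n j)"
  have ex: "s \<le> grid t n n" using grid_simps assms by simp
  have j: "s \<le> grid t n j" unfolding j_def by (rule LeastI[of _ n]) (rule ex)
  have jn: "j \<le> n" unfolding j_def by (rule Least_le) (rule ex)
  have j0: "j \<noteq> 0" using j grid_simps assms by (metis not_le)
  then obtain i where i: "j = Suc i" by (cases j) auto
  have "\<not> s \<le> grid t n i" using not_less_Least[of i "\<lambda>j. s \<le> grid t n j"] i unfolding j_def by simp
  then show ?thesis using that[of i] i j jn by auto
qed

lemma discounted_step_cell:
  assumes "i < n" "grid t n i < s" "s \<le> grid t n (Suc i)"
  shows "discounted_step \<beta> f t n (s, \<omega>) = discounted \<beta> f (grid t n i) (B (grid t n i) \<omega>)"
proof -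
  have "discounted_step \<beta> f t n (s, \<omega>) = (\<Sum>j\<in>{i}. discounted \<beta> f (grid t n j) (B (grid t n j) \<omega>) * indicator {grid t n j<..grid t n (Suc j)} s)"
    unfolding discounted_step_def fst_conv snd_conv
  proof (rule sum.mono_neutral_right)
    show "\<forall>j\<in>{..<n} - {i}. discounted \<beta> f (grid t n j) (B (grid t n j) \<omega>) * indicator {grid t n j<..grid t n (Suc j)} s = 0"
    proof
      fix j assume "j \<in> {..<n} - {i}"
      then consider "Suc j \<le> i" | "Suc i \<le> j" by fastforce
      then have "s \<notin> {grid t n j<..grid t n (Suc j)}"
        by cases (use grid_mono(1)[of "Suc j" i] grid_mono(1)[of "Suc i" j] assms in auto)
      then show "discounted \<beta> f (grid t n j) (B (grid t n j) \<omega>) * indicator {grid t n j<..grid t n (Suc j)} s = 0" by simp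
    qed
  qed (use assms in auto)
  also have "\<dots> = discounted \<beta> f (grid t n i) (B (grid t n i) \<omega>)" using assms by simp
  finally show ?thesis .
qed

lemma discounted_step_before: "s \<le> t \<Longrightarrow> discounted_step \<beta> f t n (s, \<omega>) = 0"
proof (unfold discounted_step_def fst_conv snd_conv, intro sum.neutral ballI)
  fix i assume "s \<le> t" "i \<in> {..<n}"
  then have "s \<le> grid t n i" using grid_range[of i] by auto
  then show "discounted \<beta> f (grid t n i) (B (grid t n i) \<omega>) * indicator {grid t n i<..grid t n (Suc i)} s = 0" by simp
qed

lemma measurable_discounted_F: "exp_lipschitz f \<Longrightarrow> i < n \<Longrightarrow>
    (\<lambda>\<omega>. discounted \<beta> f (grid t n i) (B (grid t n i) \<omega>)) \<in> borel_measurable (F (grid t n i))"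
  unfolding discounted_def using grid_range[of i]
    measurable_compose[OF measurable_B_F[OF _ order_refl, of "grid t n i"] exp_lipschitz_measurable] by auto

lemma L2_discounted: "exp_lipschitz f \<Longrightarrow> 0 \<le> s \<Longrightarrow> s \<le> T \<Longrightarrow> L2 M (\<lambda>\<omega>. discounted \<beta> f s (B s \<omega>))"
  using discounted_L2[of f \<beta>] by metis

lemma simple_ito_discounted_step:
  assumes f: "exp_lipschitz f"
  shows "simple_ito t (discounted_step \<beta> f t n)
    (\<lambda>\<omega>. \<Sum>i<n. discounted \<beta> f (grid t n i) (B (grid t n i) \<omega>) * (B (grid t n (Suc i)) \<omega> - B (grid t n i) \<omega>))"
proof -
  have "simple_ito t (\<lambda>x. \<Sum>i<j. discounted \<beta> f (grid t n i) (B (grid t n i) (snd x)) * indicator {grid t n i<..grid t n (Suc i)} (fst x))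
    (\<lambda>\<omega>. \<Sum>i<j. discounted \<beta> f (grid t n i) (B (grid t n i) \<omega>) * (B (grid t n (Suc i)) \<omega> - B (grid t n i) \<omega>))"
    if "j \<le> n" for j
    using that
  proof (induction j)
    case 0
    then show ?case using simple_ito.zero by simp
  next
    case (Suc j)
    then have j: "j < n" by simp
    then have "simple_ito t (\<lambda>x. discounted \<beta> f (grid t n j) (B (grid t n j) (snd x)) * indicator {grid t n j<..grid t n (Suc j)} (fst x)
        + (\<Sum>i<j. discounted \<beta> f (grid t n i) (B (grid t n i) (snd x)) * indicator {grid t n i<..grid t n (Suc i)} (fst x)))
      (\<lambda>\<omega>. discounted \<beta> f (grid t n j) (B (grid t n j) \<omega>) * (B (grid t n (Suc j)) \<omega> - B (grid t n j) \<omega>)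
        + (\<Sum>i<j. discounted \<beta> f (grid t n i) (B (grid t n i) \<omega>) * (B (grid t n (Suc i)) \<omega> - B (grid t n i) \<omega>)))"
      using Suc grid_range[of j] grid_range[of "Suc j"] grid_mono(2)[of j "Suc j"] measurable_discounted_F[OF f j] L2_discounted[OF f]
      by (intro simple_ito.block) auto
    then show ?case by (simp add: add.commute)
  qed
  from this[of n] show ?thesis unfolding discounted_step_def[abs_def] by simp
qed

end

lemma measurable_discounted_W:
  assumes "exp_lipschitz f"
  shows "(\<lambda>x. discounted \<beta> f (fst x) (W (fst x) (snd x))) \<in> borel_measurable mu"
proof -
  have [measurable]: "(\<lambda>x. W (fst x) (snd x)) \<in> borel_measurable mu"
    using measurable_W_joint[of T] by (simp add: lam_def)
  have [measurable]: "fst \<in> borel_measurable mu" by (rule measurable_mu_fst)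
  have [measurable]: "f \<in> borel_measurable borel" by (rule exp_lipschitz_measurable[OF assms])
  show ?thesis unfolding discounted_def by measurable
qed

lemma L2_mu_discounted:
  assumes "exp_lipschitz f"
  shows "L2 mu (\<lambda>x. discounted \<beta> f (fst x) (W (fst x) (snd x)))"
proof -
  obtain D where D: "D \<ge> 0" "\<And>s. 0 \<le> s \<Longrightarrow> s \<le> T \<Longrightarrow> L2 M (\<lambda>\<omega>. discounted \<beta> f s (B s \<omega>)) \<and> l2norm M (\<lambda>\<omega>. discounted \<beta> f s (B s \<omega>)) \<le> D"
    using discounted_L2[OF assms, of \<beta>] by blast
  show ?thesis
  proof (rule L2_mu_slices[OF measurable_discounted_W[OF assms] D(1)])
    fix s :: real assume s: "0 \<le> s" "s \<le> T"
    have ae: "AE \<omega> in M. discounted \<beta> f s (W s \<omega>) = discounted \<beta> f s (B s \<omega>)" using AE_W_eq_B by eventually_elim simp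
    have m: "(\<lambda>\<omega>. discounted \<beta> f s (W s \<omega>)) \<in> borel_measurable M"
      unfolding discounted_def using measurable_compose[OF measurable_W[OF s(1)] exp_lipschitz_measurable[OF assms]] by measurable
    have LB: "L2 M (\<lambda>\<omega>. discounted \<beta> f s (B s \<omega>))" using D(2)[OF s] by simp
    have "L2 M (\<lambda>\<omega>. discounted \<beta> f s (W s \<omega>))"
      by (rule L2_bound[OF m LB]) (use ae in \<open>auto elim: eventually_mono\<close>)
    moreover have "l2norm M (\<lambda>\<omega>. discounted \<beta> f s (W s \<omega>)) = l2norm M (\<lambda>\<omega>. discounted \<beta> f s (B s \<omega>))"
      by (rule l2norm_cong_AE[OF m L2_measurable[OF LB] ae])
    ultimately show "L2 M (\<lambda>\<omega>. discounted \<beta> f (fst (s, \<omega>)) (W (fst (s, \<omega>)) (snd (s, \<omega>)))) \<and>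
         l2norm M (\<lambda>\<omega>. discounted \<beta> f (fst (s, \<omega>)) (W (fst (s, \<omega>)) (snd (s, \<omega>)))) \<le> D"
      using D(2)[OF s] by simp
  qed
qed

definition discounted_process :: "real \<Rightarrow> (real \<Rightarrow> real) \<Rightarrow> real \<Rightarrow> real \<times> 'a \<Rightarrow> real" where
  "discounted_process \<beta> f t x = discounted \<beta> f (fst x) (W (fst x) (snd x)) * indicator {t<..T} (fst x)"

lemma L2_discounted_process: "exp_lipschitz f \<Longrightarrow> L2 mu (discounted_process \<beta> f t)"
  unfolding discounted_process_def[abs_def] by (intro L2_mu_indicator L2_mu_discounted) auto

text \<open>On a cell of the grid the integrand keeps its value at the left endpoint, so the error is an
  increment of the function along the path over at most one cell.\<close>

lemma discounted_step_approx:
  assumes f: "exp_lipschitz f" and t: "0 \<le> t" "t < T"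
  obtains D where "D \<ge> 0" "\<And>n. 0 < n \<Longrightarrow>
    l2norm mu (\<lambda>x. discounted_step \<beta> f t n x - discounted_process \<beta> f t x) \<le> D * sqrt ((T - t) / real n)"
proof -
  obtain D where D: "D \<ge> 0"
    "\<And>a b. 0 \<le> a \<Longrightarrow> a < b \<Longrightarrow> b \<le> T \<Longrightarrow>
      L2 M (\<lambda>\<omega>. discounted \<beta> f b (B b \<omega>) - discounted \<beta> f a (B a \<omega>)) \<and>
      l2norm M (\<lambda>\<omega>. discounted \<beta> f b (B b \<omega>) - discounted \<beta> f a (B a \<omega>)) \<le> D * sqrt (b - a)"
    using discounted_increment[OF f, of \<beta>] by blast
  have "l2norm mu (\<lambda>x. discounted_step \<beta> f t n x - discounted_process \<beta> f t x) \<le> sqrt T * (D * sqrt ((T - t) / real n))"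
    if n: "0 < n" for n
  proof (rule l2norm_mu_slices)
    have L: "L2 mu (discounted_step \<beta> f t n)" using simple_ito_L2[OF simple_ito_discounted_step[OF t n f] t(1)] by auto
    have Lp: "L2 mu (discounted_process \<beta> f t)" by (rule L2_discounted_process[OF f])
    show m: "(\<lambda>x. discounted_step \<beta> f t n x - discounted_process \<beta> f t x) \<in> borel_measurable mu"
      using L2_measurable[OF L2_diff[OF L Lp]] .
    show D0: "0 \<le> D * sqrt ((T - t) / real n)" using D(1) t by simp
    fix s :: real assume s: "0 \<le> s" "s \<le> T"
    show "L2 M (\<lambda>\<omega>. discounted_step \<beta> f t n (s, \<omega>) - discounted_process \<beta> f t (s, \<omega>)) \<and>
      l2norm M (\<lambda>\<omega>. discounted_step \<beta> f t n (s, \<omega>) - discounted_process \<beta> f t (s, \<omega>)) \<le> D * sqrt ((T - t) / real n)"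
    proof (cases "s \<le> t")
      case True
      then show ?thesis using discounted_step_before[OF t n True] D0 by (simp add: discounted_process_def)
    next
      case False
      then have ts: "t < s" by simp
      obtain i where i: "i < n" "grid t n i < s" "s \<le> grid t n (Suc i)" using grid_cell[OF t n ts s(2)] .
      have g0: "0 \<le> grid t n i" using grid_range[OF t n, of i] i by auto
      note LB = D(2)[OF g0 i(2) s(2)]
      have ms: "(\<lambda>\<omega>. discounted_step \<beta> f t n (s, \<omega>) - discounted_process \<beta> f t (s, \<omega>)) \<in> borel_measurable M"
        using measurable_compose[OF measurable_Pair1' m, of s] s by simp
      have ae: "AE \<omega> in M. discounted_step \<beta> f t n (s, \<omega>) - discounted_process \<beta> f t (s, \<omega>)
          = - (discounted \<beta> f s (B s \<omega>) - discounted \<beta> f (grid t n i) (B (grid t n i) \<omega>))"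
        using AE_W_eq_B
        by eventually_elim (use discounted_step_cell[OF t n i] ts s in \<open>simp add: discounted_process_def\<close>)
      have LL: "L2 M (\<lambda>\<omega>. - (discounted \<beta> f s (B s \<omega>) - discounted \<beta> f (grid t n i) (B (grid t n i) \<omega>)))"
        using LB L2_minus by blast
      have "l2norm M (\<lambda>\<omega>. discounted_step \<beta> f t n (s, \<omega>) - discounted_process \<beta> f t (s, \<omega>))
          = l2norm M (\<lambda>\<omega>. - (discounted \<beta> f s (B s \<omega>) - discounted \<beta> f (grid t n i) (B (grid t n i) \<omega>)))"
        by (rule l2norm_cong_AE[OF ms L2_measurable[OF LL] ae])
      also have "\<dots> \<le> D * sqrt (s - grid t n i)" unfolding l2norm_minus using LB by simp
      also have "\<dots> \<le> D * sqrt ((T - t) / real n)"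
        using grid_simps(3)[OF t n, of i] i D(1) by (intro mult_left_mono real_sqrt_le_mono) auto
      finally have "l2norm M (\<lambda>\<omega>. discounted_step \<beta> f t n (s, \<omega>) - discounted_process \<beta> f t (s, \<omega>)) \<le> D * sqrt ((T - t) / real n)" .
      moreover have "L2 M (\<lambda>\<omega>. discounted_step \<beta> f t n (s, \<omega>) - discounted_process \<beta> f t (s, \<omega>))"
        by (rule L2_bound[OF ms LL]) (use ae in \<open>eventually_elim, simp\<close>)
      ultimately show ?thesis by simp
    qed
  qed
  then show ?thesis using that[of "sqrt T * D"] D(1) T_pos by (simp add: mult.assoc)
qed

lemma time_integral_discounted_step:
  assumes t: "0 \<le> t" "t < T" and n: "0 < n"
  shows "time_integral (discounted_step \<beta> f t n) \<omega>
    = (\<Sum>i<n. discounted \<beta> f (grid t n i) (B (grid t n i) \<omega>) * ((T - t) / real n))"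
proof -
  have m: "measure lam {grid t n i<..grid t n (Suc i)} = (T - t) / real n"
    and e: "{grid t n i<..grid t n (Suc i)} \<inter> {0..T} = {grid t n i<..grid t n (Suc i)}"
    and s: "{grid t n i<..grid t n (Suc i)} \<in> sets lam" if "i < n" for i
  proof -
    have r: "0 \<le> grid t n i" "grid t n i \<le> grid t n (Suc i)" "grid t n (Suc i) \<le> T"
      using grid_range[OF t n, of i] grid_range[OF t n, of "Suc i"] grid_mono(1)[OF t n, of i "Suc i"] that by auto
    show "measure lam {grid t n i<..grid t n (Suc i)} = (T - t) / real n"
      using measure_lam_Ioc[OF r] grid_simps(3)[OF t n] by simp
    show "{grid t n i<..grid t n (Suc i)} \<inter> {0..T} = {grid t n i<..grid t n (Suc i)}" using r by auto
    show "{grid t n i<..grid t n (Suc i)} \<in> sets lam"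
      using r unfolding lam_def by (subst sets_restrict_space_iff) auto
  qed
  have "time_integral (discounted_step \<beta> f t n) \<omega> =
    (\<Sum>i<n. \<integral>s. discounted \<beta> f (grid t n i) (B (grid t n i) \<omega>) * indicator {grid t n i<..grid t n (Suc i)} s \<partial>lam)"
    unfolding time_integral_def discounted_step_def fst_conv snd_conv
    using s by (intro Bochner_Integration.integral_sum) (auto simp: lam.emeasure_eq_measure)
  also have "\<dots> = (\<Sum>i<n. discounted \<beta> f (grid t n i) (B (grid t n i) \<omega>) * ((T - t) / real n))"
    by (intro sum.cong refl) (simp add: e m)
  finally show ?thesis .
qed

text \<open>The stochastic integral is approximated by its Riemann sums with left endpoints on a grid of \<open>n\<close>
  cells of length \<open>\<delta>\<close>. The error splits into the Taylor errors, into the sums of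
  \<open>\<eta> * ((B b - B a)\<^sup>2 - \<delta>)\<close>, which are orthogonal, and into the error of the Riemann sums of the drift
  integral. All three are of order \<open>sqrt \<delta>\<close>.\<close>

theorem ito_formula:
  assumes d1: "\<And>x. (w has_real_derivative w1 x) (at x)" and d2: "\<And>x. (w1 has_real_derivative w2 x) (at x)"
    and e: "exp_lipschitz w" "exp_lipschitz w1" "exp_lipschitz w2"
    and t: "0 \<le> t" "t < T"
  shows "ito_limit t (discounted_process \<beta> w1 t)
    (\<lambda>\<omega>. discounted \<beta> w T (B T \<omega>) - discounted \<beta> w t (B t \<omega>)
      - time_integral (discounted_process \<beta> (\<lambda>x. \<beta> * w x + w2 x / 2) t) \<omega>)"
proof -
  define l where "l x = \<beta> * w x + w2 x / 2" for x
  have el: "exp_lipschitz l"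
    unfolding l_def[abs_def] using exp_lipschitz_add[OF exp_lipschitz_cmult[OF e(1), of \<beta>] exp_lipschitz_cmult[OF e(3), of "1/2"]]
    by simp
  define \<delta> where "\<delta> n = (T - t) / real n" for n
  define g where "g n = grid t n" for n
  define X where "X \<omega> = discounted \<beta> w T (B T \<omega>) - discounted \<beta> w t (B t \<omega>) - time_integral (discounted_process \<beta> l t) \<omega>" for \<omega>
  define J where "J n \<omega> = (\<Sum>i<n. discounted \<beta> w1 (g n i) (B (g n i) \<omega>) * (B (g n (Suc i)) \<omega> - B (g n i) \<omega>))" for n \<omega>
  obtain D1 where D1: "D1 \<ge> 0" "\<And>n. 0 < n \<Longrightarrow>
    l2norm mu (\<lambda>x. discounted_step \<beta> w1 t n x - discounted_process \<beta> w1 t x) \<le> D1 * sqrt (\<delta> n)"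
    using discounted_step_approx[OF e(2) t, of \<beta>] unfolding \<delta>_def by blast
  obtain D2 where D2: "D2 \<ge> 0" "\<And>n. 0 < n \<Longrightarrow>
    l2norm mu (\<lambda>x. discounted_step \<beta> l t n x - discounted_process \<beta> l t x) \<le> D2 * sqrt (\<delta> n)"
    using discounted_step_approx[OF el t, of \<beta>] unfolding \<delta>_def by blast
  obtain D3 where D3: "D3 \<ge> 0"
    "\<And>a b. 0 \<le> a \<Longrightarrow> a < b \<Longrightarrow> b \<le> T \<Longrightarrow> L2 M (taylor_error \<beta> w w1 w2 a b) \<and>
      l2norm M (taylor_error \<beta> w w1 w2 a b) \<le> D3 * (b - a) * sqrt (b - a)"
    using ito_local_error[OF d1 d2 e, of \<beta>] by blast
  obtain D4 where D4: "D4 \<ge> 0" "\<And>s. 0 \<le> s \<Longrightarrow> s \<le> T \<Longrightarrow> L2 M (\<lambda>\<omega>. discounted \<beta> w2 s (B s \<omega>)) \<and> l2norm M (\<lambda>\<omega>. discounted \<beta> w2 s (B s \<omega>)) \<le> D4"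
    using discounted_L2[OF e(3), of \<beta>] by blast
  \<comment> \<open>The variance of the square of a standard normal variable.\<close>
  define \<kappa> where "\<kappa> = (\<integral>x. (x\<^sup>2 - 1)\<^sup>2 \<partial>std_normal_distribution)"
  have \<kappa>0: "\<kappa> \<ge> 0" by (simp add: \<kappa>_def)
  have LX: "L2 M X"
    unfolding X_def[abs_def] using discounted_L2[OF e(1), of \<beta>] t L2_time_integral[OF L2_discounted_process[OF el]]
    by (intro L2_diff) (auto, (metis less_imp_le order_refl order_trans)+)
  have bound: "l2norm M (\<lambda>\<omega>. J n \<omega> - X \<omega>) \<le> (D3 * (T - t) + sqrt ((T - t) * (D4\<^sup>2 * \<kappa>)) + sqrt T * D2) * sqrt (\<delta> n)"
    if n: "0 < n" for n
  proof -
    have \<delta>: "0 < \<delta> n" "real n * \<delta> n = T - t" using t n by (auto simp: \<delta>_def)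
    have gs: "g n 0 = t" "g n n = T" "\<And>i. g n (Suc i) - g n i = \<delta> n"
      using grid_simps[OF t n] by (auto simp: g_def \<delta>_def)
    have gr: "0 \<le> g n i" "g n i < g n (Suc i)" "g n (Suc i) \<le> T" "g n i \<le> T" if "i < n" for i
      using grid_range[OF t n, of i] grid_range[OF t n, of "Suc i"] grid_mono(2)[OF t n, of i "Suc i"] that
      by (auto simp: g_def)
    define E where "E i = taylor_error \<beta> w w1 w2 (g n i) (g n (Suc i))" for i
    define \<eta> where "\<eta> i \<omega> = discounted \<beta> w2 (g n i) (B (g n i) \<omega>) / 2" for i \<omega>
    define Q where "Q i \<omega> = \<eta> i \<omega> * ((B (g n (Suc i)) \<omega> - B (g n i) \<omega>)\<^sup>2 - \<delta> n)" for i \<omega>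
    have LE: "L2 M (E i)" "l2norm M (E i) \<le> D3 * \<delta> n * sqrt (\<delta> n)" if "i < n" for i
      using D3(2)[OF gr(1-3)[OF that]] unfolding gs(3) E_def by auto
    have m\<eta>: "\<eta> i \<in> borel_measurable (F (g n i))" if "i < n" for i
      using measurable_discounted_F[OF t n e(3) that, of \<beta>] unfolding \<eta>_def[abs_def] g_def by simp
    have L\<eta>: "L2 M (\<eta> i)" if "i < n" for i
      using L2_cmult[of M _ "1/2"] D4(2)[OF gr(1)[OF that] gr(4)[OF that]] unfolding \<eta>_def[abs_def] by fastforce
    have n\<eta>: "expectation (\<lambda>\<omega>. (\<eta> i \<omega>)\<^sup>2) \<le> D4\<^sup>2" if "i < n" for i
    proof -
      have "l2norm M (\<eta> i) \<le> D4"
        using D4(2)[OF gr(1)[OF that] gr(4)[OF that]] l2norm_cmult[of M "1/2" "\<lambda>\<omega>. discounted \<beta> w2 (g n i) (B (g n i) \<omega>)"]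
          l2norm_nonneg[of M "\<lambda>\<omega>. discounted \<beta> w2 (g n i) (B (g n i) \<omega>)"]
        unfolding \<eta>_def[abs_def] by (simp del: l2norm_nonneg)
      then show ?thesis unfolding l2norm_power2[symmetric] by (intro power_mono) auto
    qed
    have mQf: "(\<lambda>x::real. (x\<^sup>2 - \<delta> n)) \<in> borel_measurable borel" "(\<lambda>x::real. (x\<^sup>2 - \<delta> n)\<^sup>2) \<in> borel_measurable borel"
      by measurable
    have ints: "integrable std_normal_distribution (\<lambda>x. (sqrt (g n (Suc i) - g n i) * x)\<^sup>2 - \<delta> n)"
      "integrable std_normal_distribution (\<lambda>x. ((sqrt (g n (Suc i) - g n i) * x)\<^sup>2 - \<delta> n)\<^sup>2)" for i
      by (rule integrable_std_normal_polynomial)+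
    have z1: "(\<integral>x. (sqrt (g n (Suc i) - g n i) * x)\<^sup>2 - \<delta> n \<partial>std_normal_distribution) = 0" for i
    proof -
      interpret G: prob_space std_normal_distribution by (rule prob_space_std_normal)
      have "(\<integral>x. (sqrt (g n (Suc i) - g n i) * x)\<^sup>2 - \<delta> n \<partial>std_normal_distribution)
        = (\<integral>x. (sqrt (g n (Suc i) - g n i) * x)\<^sup>2 \<partial>std_normal_distribution) - (\<integral>x. \<delta> n \<partial>std_normal_distribution)"
        by (intro Bochner_Integration.integral_diff integrable_std_normal_polynomial G.integrable_const)
      also have "(\<integral>x. \<delta> n \<partial>std_normal_distribution) = \<delta> n"
        using lebesgue_integral_const[of std_normal_distribution "\<delta> n"] G.prob_space
        by (simp del: lebesgue_integral_const space_density)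
      finally show ?thesis unfolding std_normal_variance gs(3) using \<delta> by simp
    qed
    have z2: "(\<integral>x. ((sqrt (g n (Suc i) - g n i) * x)\<^sup>2 - \<delta> n)\<^sup>2 \<partial>std_normal_distribution) = (\<delta> n)\<^sup>2 * \<kappa>" for i
    proof -
      have "((sqrt (g n (Suc i) - g n i) * x)\<^sup>2 - \<delta> n)\<^sup>2 = (\<delta> n)\<^sup>2 * (x\<^sup>2 - 1)\<^sup>2" for x
      proof -
        have "(sqrt (g n (Suc i) - g n i) * x)\<^sup>2 - \<delta> n = \<delta> n * (x\<^sup>2 - 1)"
          unfolding gs(3) using \<delta> by (simp add: power_mult_distrib algebra_simps)
        then show ?thesis by (simp add: power_mult_distrib)
      qed
      then show ?thesis unfolding \<kappa>_def by simp
    qed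
    have LQ: "L2 M (Q i)" "(l2norm M (Q i))\<^sup>2 \<le> (\<delta> n)\<^sup>2 * (D4\<^sup>2 * \<kappa>)" if i: "i < n" for i
    proof -
      have m2: "(\<lambda>\<omega>. (\<eta> i \<omega>)\<^sup>2) \<in> borel_measurable (F (g n i))" using m\<eta>[OF i] by measurable
      have i2: "integrable M (\<lambda>\<omega>. (\<eta> i \<omega>)\<^sup>2)" using L\<eta>[OF i] by (simp add: L2_def)
      have mQ: "Q i \<in> borel_measurable M"
        unfolding Q_def[abs_def] using measurable_F_M[OF m\<eta>[OF i]] measurable_B[of "g n i"] measurable_B[of "g n (Suc i)"] gr[OF i]
        by auto
      have eqQ: "(Q i \<omega>)\<^sup>2 = (\<eta> i \<omega>)\<^sup>2 * ((B (g n (Suc i)) \<omega> - B (g n i) \<omega>)\<^sup>2 - \<delta> n)\<^sup>2" for \<omega>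
        unfolding Q_def by (rule power_mult_distrib)
      show "L2 M (Q i)" unfolding L2_def eqQ
        using mQ integrable_mult_increment[OF gr(1,2)[OF i] mQf(2) ints(2) m2 i2] by simp
      have "(l2norm M (Q i))\<^sup>2 = expectation (\<lambda>\<omega>. (\<eta> i \<omega>)\<^sup>2) * ((\<delta> n)\<^sup>2 * \<kappa>)"
        unfolding l2norm_power2 eqQ z2[of i, symmetric]
        by (rule expectation_mult_increment[OF gr(1,2)[OF i] mQf(2) ints(2) m2 i2])
      also have "\<dots> \<le> D4\<^sup>2 * ((\<delta> n)\<^sup>2 * \<kappa>)"
        using n\<eta>[OF i] \<kappa>0 by (intro mult_right_mono) auto
      finally show "(l2norm M (Q i))\<^sup>2 \<le> (\<delta> n)\<^sup>2 * (D4\<^sup>2 * \<kappa>)" by (simp add: mult_ac)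
    qed
    have orth: "expectation (\<lambda>\<omega>. Q i \<omega> * Q j \<omega>) = 0" if ij: "i < j" "j < n" for i j
    proof -
      have i: "i < n" using ij by simp
      have le: "g n (Suc i) \<le> g n j" using grid_mono(1)[OF t n, of "Suc i" j] ij by (simp add: g_def)
      have "Q i \<in> borel_measurable (F (g n j))"
        unfolding Q_def[abs_def]
        using measurable_F_mono[OF m\<eta>[OF i], of "g n j"] measurable_increment_F[of "g n i" "g n (Suc i)" "g n j"] le gr[OF i]
        by auto
      then have mm: "(\<lambda>\<omega>. Q i \<omega> * \<eta> j \<omega>) \<in> borel_measurable (F (g n j))" using m\<eta>[OF ij(2)] by auto
      have ii: "integrable M (\<lambda>\<omega>. Q i \<omega> * \<eta> j \<omega>)" by (rule L2_mult_integrable[OF LQ(1)[OF i] L\<eta>[OF ij(2)]])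
      have "expectation (\<lambda>\<omega>. Q i \<omega> * \<eta> j \<omega> * ((B (g n (Suc j)) \<omega> - B (g n j) \<omega>)\<^sup>2 - \<delta> n)) = 0"
        unfolding expectation_mult_increment[OF gr(1,2)[OF ij(2)] mQf(1) ints(1) mm ii] z1 by simp
      then show ?thesis unfolding Q_def[of j] by (simp only: mult.assoc)
    qed
    have LS: "L2 mu (discounted_step \<beta> l t n)" using simple_ito_L2[OF simple_ito_discounted_step[OF t n el] t(1)] by auto
    have LP: "L2 mu (discounted_process \<beta> l t)" by (rule L2_discounted_process[OF el])
    have LR: "L2 M (time_integral (\<lambda>x. discounted_step \<beta> l t n x - discounted_process \<beta> l t x))"
      by (rule L2_time_integral[OF L2_diff[OF LS LP]])
    have LsE: "L2 M (\<lambda>\<omega>. \<Sum>i<n. E i \<omega>)" and LsQ: "L2 M (\<lambda>\<omega>. \<Sum>i<n. Q i \<omega>)"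
      using LE LQ by (auto intro!: L2_sum)
    have eq: "AE \<omega> in M. J n \<omega> - X \<omega> = - ((\<Sum>i<n. E i \<omega>) + ((\<Sum>i<n. Q i \<omega>)
        + time_integral (\<lambda>x. discounted_step \<beta> l t n x - discounted_process \<beta> l t x) \<omega>))"
      using time_integral_diff[OF LS LP]
    proof eventually_elim
      case (elim \<omega>)
      have "E i \<omega> + Q i \<omega> = (discounted \<beta> w (g n (Suc i)) (B (g n (Suc i)) \<omega>) - discounted \<beta> w (g n i) (B (g n i) \<omega>))
         - discounted \<beta> w1 (g n i) (B (g n i) \<omega>) * (B (g n (Suc i)) \<omega> - B (g n i) \<omega>)
         - discounted \<beta> l (g n i) (B (g n i) \<omega>) * \<delta> n" for i
        unfolding E_def taylor_error_def Q_def \<eta>_def gs(3) by (simp add: discounted_def l_def algebra_simps)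
      then have "(\<Sum>i<n. E i \<omega>) + (\<Sum>i<n. Q i \<omega>) = (\<Sum>i<n. discounted \<beta> w (g n (Suc i)) (B (g n (Suc i)) \<omega>) - discounted \<beta> w (g n i) (B (g n i) \<omega>))
         - J n \<omega> - (\<Sum>i<n. discounted \<beta> l (g n i) (B (g n i) \<omega>) * \<delta> n)"
        unfolding J_def by (simp add: sum.distrib[symmetric] sum_subtractf[symmetric])
      also have "(\<Sum>i<n. discounted \<beta> w (g n (Suc i)) (B (g n (Suc i)) \<omega>) - discounted \<beta> w (g n i) (B (g n i) \<omega>))
        = discounted \<beta> w T (B T \<omega>) - discounted \<beta> w t (B t \<omega>)"
        using sum_lessThan_telescope[of "\<lambda>i. discounted \<beta> w (g n i) (B (g n i) \<omega>)" n] gs by simp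
      also have "(\<Sum>i<n. discounted \<beta> l (g n i) (B (g n i) \<omega>) * \<delta> n) = time_integral (discounted_step \<beta> l t n) \<omega>"
        using time_integral_discounted_step[OF t n] by (simp add: g_def \<delta>_def)
      finally show ?case unfolding X_def using elim by simp
    qed
    have LJ: "L2 M (J n)" using simple_ito_L2[OF simple_ito_discounted_step[OF t n e(2)] t(1)]
      by (auto simp: J_def[abs_def] g_def)
    note LL = L2_minus[OF L2_add[OF LsE L2_add[OF LsQ LR]]]
    have "l2norm M (\<lambda>\<omega>. J n \<omega> - X \<omega>) = l2norm M (\<lambda>\<omega>. - ((\<Sum>i<n. E i \<omega>) + ((\<Sum>i<n. Q i \<omega>)
        + time_integral (\<lambda>x. discounted_step \<beta> l t n x - discounted_process \<beta> l t x) \<omega>)))"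
      by (rule l2norm_cong_AE[OF L2_measurable[OF L2_diff[OF LJ LX]] L2_measurable[OF LL] eq])
    also have "\<dots> \<le> l2norm M (\<lambda>\<omega>. \<Sum>i<n. E i \<omega>) + (l2norm M (\<lambda>\<omega>. \<Sum>i<n. Q i \<omega>)
        + l2norm M (time_integral (\<lambda>x. discounted_step \<beta> l t n x - discounted_process \<beta> l t x)))"
      unfolding l2norm_minus using l2norm_triangle[OF LsE L2_add[OF LsQ LR]] l2norm_triangle[OF LsQ LR] by simp
    also have "\<dots> \<le> D3 * (T - t) * sqrt (\<delta> n) + (sqrt ((T - t) * (D4\<^sup>2 * \<kappa>)) * sqrt (\<delta> n) + sqrt T * (D2 * sqrt (\<delta> n)))"
    proof (intro add_mono)
      have "l2norm M (\<lambda>\<omega>. \<Sum>i<n. E i \<omega>) \<le> (\<Sum>i<n. l2norm M (E i))" by (rule l2norm_sum) (use LE in auto)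
      also have "\<dots> \<le> (\<Sum>i<n. D3 * \<delta> n * sqrt (\<delta> n))" by (intro sum_mono LE) auto
      also have "\<dots> = D3 * (real n * \<delta> n) * sqrt (\<delta> n)" by simp
      finally show "l2norm M (\<lambda>\<omega>. \<Sum>i<n. E i \<omega>) \<le> D3 * (T - t) * sqrt (\<delta> n)" unfolding \<delta>(2) .
      have "(l2norm M (\<lambda>\<omega>. \<Sum>i<n. Q i \<omega>))\<^sup>2 \<le> real n * ((\<delta> n)\<^sup>2 * (D4\<^sup>2 * \<kappa>))"
        by (rule l2norm_sum_orthogonal) (use LQ orth in auto)
      also have "\<dots> = (real n * \<delta> n) * (D4\<^sup>2 * \<kappa>) * \<delta> n" by (simp add: power2_eq_square mult_ac)
      also have "\<dots> = (sqrt ((T - t) * (D4\<^sup>2 * \<kappa>)) * sqrt (\<delta> n))\<^sup>2"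
        unfolding \<delta>(2) using \<delta>(1) t \<kappa>0 by (simp add: power_mult_distrib)
      finally show "l2norm M (\<lambda>\<omega>. \<Sum>i<n. Q i \<omega>) \<le> sqrt ((T - t) * (D4\<^sup>2 * \<kappa>)) * sqrt (\<delta> n)"
        by (rule power2_le_imp_le) (use \<delta>(1) t \<kappa>0 in simp)
      show "l2norm M (time_integral (\<lambda>x. discounted_step \<beta> l t n x - discounted_process \<beta> l t x)) \<le> sqrt T * (D2 * sqrt (\<delta> n))"
        using l2norm_time_integral[OF L2_diff[OF LS LP]] D2(2)[OF n] T_pos
        by (auto intro: order_trans mult_left_mono)
    qed
    finally show ?thesis by (simp add: algebra_simps)
  qed
  have \<delta>lim: "(\<lambda>n. r * sqrt (\<delta> (Suc n))) \<longlonglongrightarrow> 0" for r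
  proof -
    have "(\<lambda>n. (T - t) * inverse (real (Suc n))) \<longlonglongrightarrow> (T - t) * 0"
      by (intro tendsto_mult tendsto_const LIMSEQ_inverse_real_of_nat)
    then have "(\<lambda>n. \<delta> (Suc n)) \<longlonglongrightarrow> 0" by (simp add: \<delta>_def divide_inverse)
    from tendsto_mult[OF tendsto_const tendsto_real_sqrt[OF this]] show ?thesis by simp
  qed
  have "(\<lambda>n. l2norm M (\<lambda>\<omega>. J (Suc n) \<omega> - X \<omega>)) \<longlonglongrightarrow> 0"
    by (rule Lim_null_comparison[OF _ \<delta>lim[of "D3 * (T - t) + sqrt ((T - t) * (D4\<^sup>2 * \<kappa>)) + sqrt T * D2"]])
      (use bound in auto)
  moreover have "(\<lambda>n. l2norm mu (\<lambda>x. discounted_step \<beta> w1 t (Suc n) x - discounted_process \<beta> w1 t x)) \<longlonglongrightarrow> 0"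
    by (rule Lim_null_comparison[OF _ \<delta>lim[of D1]]) (use D1 in auto)
  moreover have "simple_ito t (discounted_step \<beta> w1 t (Suc n)) (J (Suc n))" for n
    unfolding J_def[abs_def] g_def by (rule simple_ito_discounted_step[OF t zero_less_Suc e(2)])
  ultimately have "ito_limit t (discounted_process \<beta> w1 t) X"
    unfolding ito_limit_def using LX L2_discounted_process[OF e(2)]
    by (intro conjI exI[of _ "\<lambda>n. discounted_step \<beta> w1 t (Suc n)"] exI[of _ "\<lambda>n. J (Suc n)"]) auto
  then show ?thesis unfolding X_def[abs_def] l_def[abs_def] .
qed

end

section \<open>Eigenfunctions of the drifted generator\<close>

lemma abs_derivative:
  fixes y :: real assumes "y \<noteq> 0" shows "(abs has_real_derivative sgn y) (at y)"
proof (rule has_field_derivative_transform_within_open[where f="\<lambda>z. sgn y * z" and S="if y > 0 then {0<..} else {..<0}"])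
  show "((\<lambda>z. sgn y * z) has_real_derivative sgn y) (at y)" by (auto intro!: derivative_eq_intros)
qed (use assms in \<open>auto split: if_splits\<close>)

text \<open>Extending a function of \<open>\<bar>y\<bar>\<close> evenly creates no kink at \<open>0\<close> if the derivative vanishes there,
  and extending it oddly creates none if the function vanishes there. The eigenfunction and its derivative
  are of these two forms.\<close>

lemma even_extension_derivative:
  fixes f f' :: "real \<Rightarrow> real"
  assumes f: "\<And>x. (f has_real_derivative f' x) (at x)" and "f' 0 = 0"
  shows "((\<lambda>y. f \<bar>y\<bar>) has_real_derivative sgn y * f' \<bar>y\<bar>) (at y)"
proof (cases "y = 0")
  case False
  have "(abs has_real_derivative sgn y) (at y)" using False by (rule abs_derivative)
  from DERIV_chain2[OF f this] show ?thesis by (simp add: mult.commute)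
next
  case True
  have "((\<lambda>h. (f h - f 0) / h) \<longlongrightarrow> 0) (at 0)"
    using f[of 0] assms(2) by (simp add: DERIV_def)
  moreover have "filterlim abs (at (0::real)) (at 0)"
    by (auto simp: filterlim_at eventually_at intro!: exI[of _ 1] tendsto_rabs_zero)
  ultimately have "((\<lambda>h. (f \<bar>h\<bar> - f 0) / \<bar>h\<bar>) \<longlongrightarrow> 0) (at 0)"
    by (rule filterlim_compose)
  then have "((\<lambda>h. (f \<bar>h\<bar> - f 0) / h) \<longlongrightarrow> 0) (at 0)"
    by (rule Lim_null_comparison[rotated, OF tendsto_rabs_zero]) (simp add: abs_divide)
  then show ?thesis using True by (simp add: DERIV_def)
qed

lemma odd_extension_derivative:
  fixes f f' :: "real \<Rightarrow> real"
  assumes f: "\<And>x. (f has_real_derivative f' x) (at x)" and "f 0 = 0"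
  shows "((\<lambda>y. sgn y * f \<bar>y\<bar>) has_real_derivative f' \<bar>y\<bar>) (at y)"
proof (cases "y = 0")
  case False
  have d: "(abs has_real_derivative sgn y) (at y)" using False by (rule abs_derivative)
  have "((\<lambda>z. sgn y * f \<bar>z\<bar>) has_real_derivative sgn y * (f' \<bar>y\<bar> * sgn y)) (at y)"
    by (intro DERIV_cmult DERIV_chain2[OF f d])
  moreover have "sgn y * (f' \<bar>y\<bar> * sgn y) = f' \<bar>y\<bar>" using False by (simp add: sgn_if)
  ultimately have d': "((\<lambda>z. sgn y * f \<bar>z\<bar>) has_real_derivative f' \<bar>y\<bar>) (at y)" by simp
  show ?thesis
    by (rule has_field_derivative_transform_within_open[OF d', where S="if y > 0 then {0<..} else {..<0}"])
      (use False in \<open>auto split: if_splits\<close>)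
next
  case True
  have "((\<lambda>h. f h / h) \<longlongrightarrow> f' 0) (at 0)"
    using f[of 0] assms(2) by (simp add: DERIV_def)
  moreover have "filterlim abs (at (0::real)) (at 0)"
    by (auto simp: filterlim_at eventually_at intro!: exI[of _ 1] tendsto_rabs_zero)
  ultimately have "((\<lambda>h. f \<bar>h\<bar> / \<bar>h\<bar>) \<longlongrightarrow> f' 0) (at 0)"
    by (rule filterlim_compose)
  then have "((\<lambda>h. sgn h * f \<bar>h\<bar> / h) \<longlongrightarrow> f' 0) (at 0)"
    by (rule Lim_transform_eventually) (auto simp: eventually_at sgn_if intro!: exI[of _ 1])
  then show ?thesis using True assms(2) by (simp add: DERIV_def)
qed

text \<open>An antiderivative of $e^{-\kappa|y|} \sin(l y)$: an even eigenfunction of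
  $w \mapsto \frac12 w'' + \kappa\,\mathrm{sgn}(y)\, w'$, followed by its first two derivatives.\<close>

definition eigen :: "real \<Rightarrow> real \<Rightarrow> real \<Rightarrow> real" where
  "eigen \<kappa> l y = (- 1 / (\<kappa>\<^sup>2 + l\<^sup>2)) * ((l * cos (l * \<bar>y\<bar>) + \<kappa> * sin (l * \<bar>y\<bar>)) * exp (- \<kappa> * \<bar>y\<bar>))"

definition eigen' :: "real \<Rightarrow> real \<Rightarrow> real \<Rightarrow> real" where
  "eigen' \<kappa> l y = exp (- \<kappa> * \<bar>y\<bar>) * sin (l * y)"

definition eigen'' :: "real \<Rightarrow> real \<Rightarrow> real \<Rightarrow> real" where
  "eigen'' \<kappa> l y = exp (- \<kappa> * \<bar>y\<bar>) * (l * cos (l * \<bar>y\<bar>) - \<kappa> * sin (l * \<bar>y\<bar>))"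

lemma sin_abs_sgn: "sgn y * sin (l * \<bar>y\<bar>) = sin (l * y)" for y l :: real
  by (cases "y = 0") (auto simp: sgn_if abs_if)

lemma eigen'_alt: "eigen' \<kappa> l y = sgn y * (exp (- \<kappa> * \<bar>y\<bar>) * sin (l * \<bar>y\<bar>))"
  unfolding eigen'_def sin_abs_sgn[of y l, symmetric] by (rule mult.left_commute)

lemma eigen_derivative:
  assumes "l > 0" shows "(eigen \<kappa> l has_real_derivative eigen' \<kappa> l y) (at y)"
proof -
  have pos: "\<kappa>\<^sup>2 + l\<^sup>2 \<noteq> 0" using assms by (simp add: add_nonneg_eq_0_iff)
  define r where "r = - 1 / (\<kappa>\<^sup>2 + l\<^sup>2)"
  have r: "r * - ((\<kappa>\<^sup>2 + l\<^sup>2) * a) = a" for a unfolding r_def using pos by (simp add: field_simps)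
  have "((\<lambda>y. r * ((l * cos (l * \<bar>y\<bar>) + \<kappa> * sin (l * \<bar>y\<bar>)) * exp (- \<kappa> * \<bar>y\<bar>)))
      has_real_derivative sgn y * (exp (- \<kappa> * \<bar>y\<bar>) * sin (l * \<bar>y\<bar>))) (at y)"
  proof (rule even_extension_derivative[where f="\<lambda>z. r * ((l * cos (l * z) + \<kappa> * sin (l * z)) * exp (- \<kappa> * z))"
        and f'="\<lambda>z. exp (- \<kappa> * z) * sin (l * z)"])
    fix z :: real
    have "((\<lambda>z. (l * cos (l * z) + \<kappa> * sin (l * z)) * exp (- \<kappa> * z)) has_real_derivative
       - ((\<kappa>\<^sup>2 + l\<^sup>2) * (exp (- \<kappa> * z) * sin (l * z)))) (at z)"
      by (auto intro!: derivative_eq_intros simp: algebra_simps power2_eq_square)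
    from DERIV_cmult[OF this, of r]
    show "((\<lambda>z. r * ((l * cos (l * z) + \<kappa> * sin (l * z)) * exp (- \<kappa> * z))) has_real_derivative
       exp (- \<kappa> * z) * sin (l * z)) (at z)" unfolding r .
  qed simp
  moreover have "sgn y * (exp (- \<kappa> * \<bar>y\<bar>) * sin (l * \<bar>y\<bar>)) = eigen' \<kappa> l y"
    by (rule eigen'_alt[symmetric])
  ultimately show ?thesis unfolding eigen_def[abs_def] r_def[symmetric] by simp
qed

lemma eigen'_derivative: "(eigen' \<kappa> l has_real_derivative eigen'' \<kappa> l y) (at y)"
proof -
  have "((\<lambda>y. sgn y * (exp (- \<kappa> * \<bar>y\<bar>) * sin (l * \<bar>y\<bar>))) has_real_derivative
      exp (- \<kappa> * \<bar>y\<bar>) * (l * cos (l * \<bar>y\<bar>) - \<kappa> * sin (l * \<bar>y\<bar>))) (at y)"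
    by (rule odd_extension_derivative[where f="\<lambda>z. exp (- \<kappa> * z) * sin (l * z)"
        and f'="\<lambda>z. exp (- \<kappa> * z) * (l * cos (l * z) - \<kappa> * sin (l * z))"])
      (auto intro!: derivative_eq_intros simp: algebra_simps)
  moreover have "(\<lambda>y. sgn y * (exp (- \<kappa> * \<bar>y\<bar>) * sin (l * \<bar>y\<bar>))) = eigen' \<kappa> l"
    by (simp only: eigen'_alt[abs_def])
  ultimately show ?thesis unfolding eigen''_def by simp
qed

text \<open>In Ito's formula with \<open>\<beta> = (\<kappa>\<^sup>2 + l\<^sup>2) / 2\<close> the left-hand side is the drift, and the right-hand
  side is minus the driver of the linear equation.\<close>

lemma eigen_equation:
  assumes "l > 0"
  shows "(\<kappa>\<^sup>2 + l\<^sup>2) / 2 * eigen \<kappa> l y + eigen'' \<kappa> l y / 2 = - \<kappa> * sgn y * eigen' \<kappa> l y"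
proof -
  have pos: "\<kappa>\<^sup>2 + l\<^sup>2 \<noteq> 0" using assms by (simp add: add_nonneg_eq_0_iff)
  have "D / 2 * ((- 1 / D) * a) = - a / 2" if "D \<noteq> 0" for a D :: real using that by simp
  from this[OF pos] have p1: "(\<kappa>\<^sup>2 + l\<^sup>2) / 2 * eigen \<kappa> l y
    = - ((l * cos (l * \<bar>y\<bar>) + \<kappa> * sin (l * \<bar>y\<bar>)) * exp (- \<kappa> * \<bar>y\<bar>)) / 2"
    unfolding eigen_def .
  have "sgn y * eigen' \<kappa> l y = exp (- \<kappa> * \<bar>y\<bar>) * sin (l * \<bar>y\<bar>)"
    unfolding eigen'_alt by (cases "y = 0") (auto simp: sgn_if)
  then have p2: "- \<kappa> * sgn y * eigen' \<kappa> l y = - \<kappa> * (exp (- \<kappa> * \<bar>y\<bar>) * sin (l * \<bar>y\<bar>))" by (simp add: mult.assoc)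
  show ?thesis unfolding p1 p2 eigen''_def by (simp add: field_simps)
qed

lemma lipschitz_sin: "\<bar>sin u - sin v\<bar> \<le> \<bar>u - v\<bar>" for u v :: real
proof -
  have "norm (sin u - sin v) \<le> 1 * norm (u - v)"
    by (rule field_differentiable_bound[of UNIV _ cos]) (auto intro!: derivative_eq_intros)
  then show ?thesis by simp
qed

lemma lipschitz_cos: "\<bar>cos u - cos v\<bar> \<le> \<bar>u - v\<bar>" for u v :: real
  using lipschitz_sin[of "pi / 2 - u" "pi / 2 - v"] by (simp add: cos_sin_eq abs_minus_commute)

lemma exp_lipschitz_trig:
  "exp_lipschitz (\<lambda>x. sin (l * (x - c)))" "exp_lipschitz (\<lambda>x. sin (l * \<bar>x - c\<bar>))"
  "exp_lipschitz (\<lambda>x. cos (l * \<bar>x - c\<bar>))"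
proof -
  have b: "\<bar>l * \<bar>x + y - c\<bar> - l * \<bar>x - c\<bar>\<bar> \<le> \<bar>l\<bar> * \<bar>y\<bar>" for x y
    unfolding right_diff_distrib[symmetric] abs_mult by (intro mult_left_mono) auto
  have b': "\<bar>l * (x + y - c) - l * (x - c)\<bar> \<le> \<bar>l\<bar> * \<bar>y\<bar>" for x y
    unfolding right_diff_distrib[symmetric] abs_mult by (intro mult_left_mono) auto
  show "exp_lipschitz (\<lambda>x. sin (l * (x - c)))" "exp_lipschitz (\<lambda>x. sin (l * \<bar>x - c\<bar>))"
    "exp_lipschitz (\<lambda>x. cos (l * \<bar>x - c\<bar>))"
    using order_trans[OF lipschitz_sin b'] order_trans[OF lipschitz_sin b] order_trans[OF lipschitz_cos b]
    by (auto intro!: exp_lipschitz_lipschitz[of _ "\<bar>l\<bar>"])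
qed

lemma exp_lipschitz_eigen:
  "exp_lipschitz (\<lambda>x. eigen \<kappa> l (x - c))" "exp_lipschitz (\<lambda>x. eigen' \<kappa> l (x - c))"
  "exp_lipschitz (\<lambda>x. eigen'' \<kappa> l (x - c))"
proof -
  note e = exp_lipschitz_exp_abs[of "- \<kappa>" c]
  show "exp_lipschitz (\<lambda>x. eigen' \<kappa> l (x - c))"
    unfolding eigen'_def by (intro exp_lipschitz_mult e exp_lipschitz_trig)
  show "exp_lipschitz (\<lambda>x. eigen \<kappa> l (x - c))" unfolding eigen_def
    by (intro exp_lipschitz_const exp_lipschitz_mult exp_lipschitz_add e exp_lipschitz_trig)
  have "exp_lipschitz (\<lambda>x. exp (- \<kappa> * \<bar>x - c\<bar>) * (l * cos (l * \<bar>x - c\<bar>) + (- \<kappa>) * sin (l * \<bar>x - c\<bar>)))"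
    by (intro exp_lipschitz_const exp_lipschitz_mult exp_lipschitz_add e exp_lipschitz_trig)
  then show "exp_lipschitz (\<lambda>x. eigen'' \<kappa> l (x - c))" unfolding eigen''_def by simp
qed

section \<open>Approximation by sine sums\<close>

inductive sine_sum :: "(real \<Rightarrow> real) \<Rightarrow> bool" where
  zero: "sine_sum (\<lambda>_. 0)"
| add: "sine_sum g \<Longrightarrow> 0 < l \<Longrightarrow> sine_sum (\<lambda>y. a * sin (l * y) + g y)"

lemma sine_sum_sin: "0 < l \<Longrightarrow> sine_sum (\<lambda>y. sin (l * y))"
  using sine_sum.add[OF sine_sum.zero, of l 1] by simp

text \<open>Sine sums whose frequencies are multiples of \<open>l\<close>. This subclass is closed under multiplication by
  \<open>cos (l * y)\<close>, by the addition theorem, and hence contains every polynomial in \<open>cos (l * y)\<close> times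
  \<open>sin (l * y)\<close>.\<close>

inductive harmonic_sum :: "real \<Rightarrow> (real \<Rightarrow> real) \<Rightarrow> bool" for l where
  zero: "harmonic_sum l (\<lambda>_. 0)"
| add: "harmonic_sum l g \<Longrightarrow> harmonic_sum l (\<lambda>y. a * sin (real (Suc j) * l * y) + g y)"

lemma harmonic_sum_sine_sum: "harmonic_sum l g \<Longrightarrow> 0 < l \<Longrightarrow> sine_sum g"
  by (induction rule: harmonic_sum.induct) (auto intro: sine_sum.intros)

lemma harmonic_sum_mult_cos:
  assumes "harmonic_sum l g" shows "harmonic_sum l (\<lambda>y. g y * cos (l * y))"
  using assms
proof (induction rule: harmonic_sum.induct)
  case (add g a j)
  have eq: "(a * sin (real (Suc j) * l * y) + g y) * cos (l * y)
      = (a/2) * sin (real (Suc (Suc j)) * l * y) + ((a/2) * sin (real j * l * y) + g y * cos (l * y))" for y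
  proof -
    have "real (Suc (Suc j)) * l * y = real (Suc j) * l * y + l * y" "real j * l * y = real (Suc j) * l * y - l * y"
      by (simp_all add: algebra_simps)
    then show ?thesis by (simp only: sin_add sin_diff) (simp add: algebra_simps)
  qed
  have "harmonic_sum l (\<lambda>y. (a/2) * sin (real j * l * y) + g y * cos (l * y))"
  proof (cases j)
    case 0
    then show ?thesis using add.IH by simp
  next
    case (Suc i)
    show ?thesis unfolding Suc by (rule harmonic_sum.add[OF add.IH])
  qed
  then show ?case unfolding eq by (rule harmonic_sum.add)
qed (simp add: harmonic_sum.zero)

lemma harmonic_sum_polynomial: "harmonic_sum l (\<lambda>y. sin (l * y) * (\<Sum>i\<le>n. a i * cos (l * y) ^ i))"
proof (induction n arbitrary: a)
  case 0
  show ?case using harmonic_sum.add[OF harmonic_sum.zero, of l "a 0" 0] by (simp add: mult.commute)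
next
  case (Suc n)
  have "harmonic_sum l (\<lambda>y. a 0 * sin (real (Suc 0) * l * y) + sin (l * y) * (\<Sum>i\<le>n. a (Suc i) * cos (l * y) ^ i) * cos (l * y))"
    by (intro harmonic_sum.add harmonic_sum_mult_cos Suc)
  moreover have "sin (l * y) * (\<Sum>i\<le>Suc n. a i * cos (l * y) ^ i)
     = a 0 * sin (real (Suc 0) * l * y) + sin (l * y) * (\<Sum>i\<le>n. a (Suc i) * cos (l * y) ^ i) * cos (l * y)" for y
    unfolding sum.atMost_Suc_shift by (simp add: algebra_simps sum_distrib_left sum_distrib_right)
  ultimately show ?case by simp
qed

lemma Weierstrass_polynomial:
  fixes f :: "real \<Rightarrow> real"
  assumes "continuous_on {-1..1} f" "0 < e"
  obtains a and n :: nat where "\<And>x. x \<in> {-1..1} \<Longrightarrow> \<bar>f x - (\<Sum>i\<le>n. a i * x ^ i)\<bar> < e"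
proof -
  obtain g where g: "real_polynomial_function g" "\<And>x. x \<in> {-1..1} \<Longrightarrow> \<bar>f x - g x\<bar> < e"
    using Stone_Weierstrass_real_polynomial_function[OF compact_Icc assms(1) assms(2)] by metis
  from g(1) obtain a n where "g = (\<lambda>x. \<Sum>i\<le>n. a i * x ^ i)"
    by (auto simp: real_polynomial_function_iff_sum)
  then show ?thesis using that[of a n] g(2) by simp
qed

lemma arccos_cos_le: assumes "0 \<le> x" shows "arccos (cos x) \<le> x"
proof (cases "x \<le> pi")
  case True
  then show ?thesis using assms by (simp add: arccos_cos)
next
  case False
  then show ?thesis using arccos_bounded[of "cos x"] by simp
qed

text \<open>On \<open>[0, R]\<close> the quotient of \<open>g\<close> by \<open>sin (pi / R * y)\<close> is a function of \<open>cos (pi / R * y)\<close>,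
  approximable by polynomials once the denominator is bounded below by \<open>\<eta>\<close>; the factor \<open>min 1 _\<close> is the price of
  this truncation. Periodicity folds every other argument back to \<open>[0, R]\<close> without increasing its
  absolute value, so bounds on \<open>[0, R]\<close> extend to the real line.\<close>

lemma sine_sum_approx_step:
  assumes g: "continuous_on UNIV g" and R: "0 < R" and \<eta>: "0 < \<eta>" and e: "0 < e"
  obtains h where "sine_sum h" "\<And>y. 0 \<le> y \<Longrightarrow> y \<le> R \<Longrightarrow> \<bar>h y - g y * min 1 (sin (pi / R * y) / \<eta>)\<bar> \<le> e"
    "\<And>y. \<exists>y'. 0 \<le> y' \<and> y' \<le> R \<and> y' \<le> \<bar>y\<bar> \<and> \<bar>h y\<bar> = \<bar>h y'\<bar>"
proof -
  define l where "l = pi / R"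
  have l: "0 < l" "l * R = pi" using R by (auto simp: l_def)
  define f where "f z = g (arccos z / l) / max (sqrt (1 - z\<^sup>2)) \<eta>" for z
  have "continuous_on {-1..1} f"
    unfolding f_def using \<eta> l
    by (intro continuous_intros continuous_on_compose2[OF g] continuous_on_arccos') (auto simp: max_def)
  from Weierstrass_polynomial[OF this e] obtain a n
    where a: "\<And>x. x \<in> {-1..1} \<Longrightarrow> \<bar>f x - (\<Sum>i\<le>n. a i * x ^ i)\<bar> < e" by blast
  define P where "P z = (\<Sum>i\<le>n. a i * z ^ i)" for z
  define h where "h y = sin (l * y) * P (cos (l * y))" for y
  have "harmonic_sum l h" unfolding h_def[abs_def] P_def by (rule harmonic_sum_polynomial)
  then have h: "sine_sum h" using harmonic_sum_sine_sum l(1) by blast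
  have approx: "\<bar>h y - g y * min 1 (sin (pi / R * y) / \<eta>)\<bar> \<le> e" if y: "0 \<le> y" "y \<le> R" for y
  proof -
    have ly: "0 \<le> l * y" "l * y \<le> pi" using y l mult_left_mono[of y R l] by auto
    have s: "sin (l * y) \<ge> 0" using ly by (rule sin_ge_zero)
    have sq: "sqrt (1 - (cos (l * y))\<^sup>2) = sin (l * y)"
      using s by (simp add: sin_squared_eq[symmetric])
    have "f (cos (l * y)) = g y / max (sin (l * y)) \<eta>"
      unfolding f_def sq using ly l by (simp add: arccos_cos)
    then have "sin (l * y) * f (cos (l * y)) = g y * min 1 (sin (l * y) / \<eta>)"
      using \<eta> s by (auto simp: max_def min_def divide_simps mult.commute)
    then have "h y - g y * min 1 (sin (l * y) / \<eta>) = - sin (l * y) * (f (cos (l * y)) - P (cos (l * y)))"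
      unfolding h_def by (simp add: algebra_simps)
    also have "\<bar>\<dots>\<bar> \<le> 1 * e"
      unfolding abs_mult using a[of "cos (l * y)"] by (intro mult_mono) (auto simp: P_def)
    finally show ?thesis by (simp add: l_def)
  qed
  have fold: "\<exists>y'. 0 \<le> y' \<and> y' \<le> R \<and> y' \<le> \<bar>y\<bar> \<and> \<bar>h y\<bar> = \<bar>h y'\<bar>" for y
  proof (intro exI conjI)
    let ?y = "arccos (cos (l * y)) / l"
    have b: "0 \<le> arccos (cos (l * y))" "arccos (cos (l * y)) \<le> pi" using arccos_bounded[of "cos (l * y)"] by auto
    show "0 \<le> ?y" using b l by simp
    show "?y \<le> R" using b l by (simp add: field_simps)
    have "arccos (cos (l * y)) \<le> l * \<bar>y\<bar>"
    proof -
      have "cos (l * \<bar>y\<bar>) = cos (l * y)" by (cases "0 \<le> y") auto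
      then show ?thesis using arccos_cos_le[of "l * \<bar>y\<bar>"] l by simp
    qed
    then show "?y \<le> \<bar>y\<bar>" using l by (simp add: field_simps)
    have c: "cos (l * ?y) = cos (l * y)" using l by simp
    have "\<bar>sin (l * ?y)\<bar> = \<bar>sin (l * y)\<bar>"
    proof -
      have "(sin (l * ?y))\<^sup>2 = (sin (l * y))\<^sup>2" unfolding sin_squared_eq c ..
      then show ?thesis using power2_eq_iff[of "sin (l * ?y)" "sin (l * y)"] by auto
    qed
    then show "\<bar>h y\<bar> = \<bar>h ?y\<bar>" unfolding h_def abs_mult c by simp
  qed
  show ?thesis by (rule that[OF h approx fold])
qed

text \<open>The half period \<open>R = n + 2\<close> tends to infinity and the truncation level \<open>\<eta> = 1 / R\<^sup>2\<close> to \<open>0\<close> faster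
  than \<open>sin (pi / R * y)\<close>, so at every fixed argument the truncation is eventually inactive. Uniform
  approximation on the real line is impossible for growing functions; the pointwise limit with a common
  exponential bound is what dominated convergence requires.\<close>

lemma sine_sum_approximation:
  assumes g: "continuous_on UNIV g" and odd: "\<And>y. g (- y) = - g y"
    and A: "A \<ge> 0" "K \<ge> 0" "\<And>y. \<bar>g y\<bar> \<le> A * exp (K * \<bar>y\<bar>)"
  obtains h where "\<And>n. sine_sum (h n)" "\<And>y. (\<lambda>n::nat. h n y) \<longlonglongrightarrow> g y"
    "\<And>n y. \<bar>h n y\<bar> \<le> (A + 1) * exp (K * \<bar>y\<bar>)"
proof -
  have "\<exists>h. sine_sum h \<and> (\<forall>y. 0 \<le> y \<longrightarrow> y \<le> real n + 2 \<longrightarrow>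
      \<bar>h y - g y * min 1 (sin (pi / (real n + 2) * y) / (1 / (real n + 2)\<^sup>2))\<bar> \<le> 1 / (real n + 2)) \<and>
      (\<forall>y. \<exists>y'. 0 \<le> y' \<and> y' \<le> real n + 2 \<and> y' \<le> \<bar>y\<bar> \<and> \<bar>h y\<bar> = \<bar>h y'\<bar>)" for n :: nat
  proof -
    have "0 < real n + 2" "0 < 1 / (real n + 2)\<^sup>2" "0 < 1 / (real n + 2)" by auto
    from sine_sum_approx_step[OF g this] show ?thesis by metis
  qed
  then obtain h where h: "\<And>n. sine_sum (h n)"
    and ap: "\<And>n y. 0 \<le> y \<Longrightarrow> y \<le> real n + 2 \<Longrightarrow>
      \<bar>h n y - g y * min 1 (sin (pi / (real n + 2) * y) / (1 / (real n + 2)\<^sup>2))\<bar> \<le> 1 / (real n + 2)"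
    and fold: "\<And>n y. \<exists>y'. 0 \<le> y' \<and> y' \<le> real n + 2 \<and> y' \<le> \<bar>y\<bar> \<and> \<bar>h n y\<bar> = \<bar>h n y'\<bar>"
    by metis
  have hodd: "h n (- y) = - h n y" for n y
    using h[of n] by (induction rule: sine_sum.induct) auto
  have bound: "\<bar>h n y\<bar> \<le> (A + 1) * exp (K * \<bar>y\<bar>)" for n y
  proof -
    obtain y' where y': "0 \<le> y'" "y' \<le> real n + 2" "y' \<le> \<bar>y\<bar>" "\<bar>h n y\<bar> = \<bar>h n y'\<bar>" using fold by blast
    let ?m = "min 1 (sin (pi / (real n + 2) * y') / (1 / (real n + 2)\<^sup>2))"
    have "0 \<le> pi / (real n + 2) * y'" using y' by simp
    moreover have "pi / (real n + 2) * y' \<le> pi"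
      using mult_left_mono[OF y'(2), of "pi / (real n + 2)"] by simp
    ultimately have s: "0 \<le> sin (pi / (real n + 2) * y')" by (rule sin_ge_zero)
    have m: "0 \<le> ?m" "?m \<le> 1" using s by auto
    have "\<bar>h n y'\<bar> \<le> \<bar>g y' * ?m\<bar> + 1 / (real n + 2)" using ap[OF y'(1,2)] by linarith
    also have "\<dots> \<le> \<bar>g y'\<bar> * 1 + 1"
      unfolding abs_mult using m by (intro add_mono mult_left_mono) auto
    also have "\<dots> \<le> A * exp (K * \<bar>y\<bar>) + exp (K * \<bar>y\<bar>)"
    proof (intro add_mono)
      have "\<bar>g y'\<bar> \<le> A * exp (K * \<bar>y'\<bar>)" by (rule A(3))
      also have "\<dots> \<le> A * exp (K * \<bar>y\<bar>)" using A y' by (intro mult_left_mono) (auto intro: mult_left_mono)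
      finally show "\<bar>g y'\<bar> * 1 \<le> A * exp (K * \<bar>y\<bar>)" by simp
    qed (use A in auto)
    finally show ?thesis using y'(4) by (simp add: algebra_simps)
  qed
  have lim_pos: "(\<lambda>n. h n y) \<longlonglongrightarrow> g y" if y: "0 \<le> y" for y
  proof -
    have ev: "\<forall>\<^sub>F n in sequentially. \<bar>h n y - g y\<bar> \<le> 1 / (real n + 2)"
    proof (cases "y = 0")
      case True
      have "g 0 = 0" using odd[of 0] by simp
      moreover have "h n 0 = 0" for n using hodd[of n 0] by simp
      ultimately show ?thesis using True by simp
    next
      case False
      with y have y: "0 < y" by simp
      have "\<forall>\<^sub>F n in sequentially. y \<le> real n" by real_asymp
      moreover have "\<forall>\<^sub>F n in sequentially. 1 \<le> (real n + 2)\<^sup>2 * sin (pi / (real n + 2) * y)"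
        using y by real_asymp
      ultimately show ?thesis
      proof eventually_elim
        case (elim n)
        let ?R = "real n + 2"
        have R: "y \<le> ?R" using elim(1) by simp
        from elim(2) have "1 / ?R\<^sup>2 \<le> sin (pi / ?R * y)" by (simp add: field_simps)
        then have "min 1 (sin (pi / ?R * y) / (1 / ?R\<^sup>2)) = 1"
          by (simp add: min_def field_simps)
        then show ?case using ap[OF less_imp_le[OF y] R] by simp
      qed
    qed
    have "(\<lambda>n. 1 / (real n + 2)) \<longlonglongrightarrow> 0" by real_asymp
    from Lim_null_comparison[OF _ this, of "\<lambda>n. h n y - g y"] ev
    show ?thesis by (intro LIM_zero_cancel[of "\<lambda>n. h n y"]) simp
  qed
  have "(\<lambda>n. h n y) \<longlonglongrightarrow> g y" for y
  proof (cases "0 \<le> y")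
    case False
    then have "(\<lambda>n. - h n (- y)) \<longlonglongrightarrow> - g (- y)" by (intro tendsto_minus lim_pos) simp
    then show ?thesis by (simp add: hodd odd)
  qed (rule lim_pos)
  then show ?thesis using that h bound by blast
qed

section \<open>Gaussian averages\<close>

lemma sine_sum_regular:
  assumes "sine_sum g"
  shows "continuous_on UNIV g \<and> (\<exists>C\<ge>0. \<forall>y. \<bar>g y\<bar> \<le> C)"
  using assms
proof (induction rule: sine_sum.induct)
  case (add g l a)
  then obtain C where C: "C \<ge> 0" "\<And>y. \<bar>g y\<bar> \<le> C" by blast
  have "\<bar>a * sin (l * y) + g y\<bar> \<le> \<bar>a\<bar> + C" for y
  proof -
    have "\<bar>a * sin (l * y)\<bar> \<le> \<bar>a\<bar> * 1" unfolding abs_mult by (intro mult_left_mono) auto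
    then show ?thesis using C(2)[of y] by linarith
  qed
  moreover have "continuous_on UNIV (\<lambda>y. a * sin (l * y) + g y)" using add.IH by (intro continuous_intros) auto
  ultimately show ?case using C(1) by (intro conjI exI[of _ "\<bar>a\<bar> + C"]) auto
qed (auto intro!: exI[of _ 0])

lemma integrable_gauss_shift:
  assumes g: "g \<in> borel_measurable borel" and A: "A \<ge> 0" "K \<ge> 0" "\<And>y. \<bar>g y\<bar> \<le> A * exp (K * \<bar>y\<bar>)" and r: "0 \<le> r" "r \<le> R"
  shows "integrable std_normal_distribution (\<lambda>y. g (x + r * y))"
    and "\<bar>\<integral>y. g (x + r * y) \<partial>std_normal_distribution\<bar> \<le> A * gauss_exp_moment (K * R) 0 * exp (K * \<bar>x\<bar>)"
proof -
  note ig = integrable_mult_right[OF integrable_gauss_exp_moment[of "K * R" 0], of "A * exp (K * \<bar>x\<bar>)"]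
  have b: "\<bar>g (x + r * y)\<bar> \<le> A * exp (K * \<bar>x\<bar>) * (exp (K * R * \<bar>y\<bar>) * \<bar>y\<bar> ^ 0)" for y
  proof -
    have "\<bar>r * y\<bar> \<le> R * \<bar>y\<bar>" unfolding abs_mult using r by (intro mult_right_mono) auto
    then have "\<bar>x + r * y\<bar> \<le> \<bar>x\<bar> + R * \<bar>y\<bar>" using abs_triangle_ineq[of x "r * y"] by linarith
    then have "K * \<bar>x + r * y\<bar> \<le> K * (\<bar>x\<bar> + R * \<bar>y\<bar>)" using A(2) by (rule mult_left_mono)
    then have "exp (K * \<bar>x + r * y\<bar>) \<le> exp (K * (\<bar>x\<bar> + R * \<bar>y\<bar>))" by simp
    also have "\<dots> = exp (K * \<bar>x\<bar>) * exp (K * R * \<bar>y\<bar>)" by (simp add: exp_add[symmetric] algebra_simps)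
    finally have "A * exp (K * \<bar>x + r * y\<bar>) \<le> A * (exp (K * \<bar>x\<bar>) * exp (K * R * \<bar>y\<bar>))"
      using A(1) by (rule mult_left_mono)
    then show ?thesis using A(3)[of "x + r * y"] by (simp add: mult.assoc)
  qed
  have m: "(\<lambda>y. g (x + r * y)) \<in> borel_measurable std_normal_distribution" using g by measurable
  show i: "integrable std_normal_distribution (\<lambda>y. g (x + r * y))"
    by (rule Bochner_Integration.integrable_bound[OF ig m])
      (use b A(1) in \<open>auto intro!: AE_I2 order_trans[OF b] simp del: power_0\<close>)
  have "\<bar>\<integral>y. g (x + r * y) \<partial>std_normal_distribution\<bar> \<le> (\<integral>y. \<bar>g (x + r * y)\<bar> \<partial>std_normal_distribution)"
    by (rule integral_abs_bound)
  also have "\<dots> \<le> (\<integral>y. A * exp (K * \<bar>x\<bar>) * (exp (K * R * \<bar>y\<bar>) * \<bar>y\<bar> ^ 0) \<partial>std_normal_distribution)"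
    by (rule integral_mono[OF integrable_abs[OF i] ig b])
  also have "\<dots> = A * gauss_exp_moment (K * R) 0 * exp (K * \<bar>x\<bar>)"
    by (simp add: gauss_exp_moment_def)
  finally show "\<bar>\<integral>y. g (x + r * y) \<partial>std_normal_distribution\<bar> \<le> A * gauss_exp_moment (K * R) 0 * exp (K * \<bar>x\<bar>)" .
qed

lemma gauss_average_odd:
  fixes g :: "real \<Rightarrow> real"
  assumes g: "g \<in> borel_measurable borel" and odd: "\<And>y. g (- y) = - g y"
  shows "(\<integral>y. g (- x + r * y) \<partial>std_normal_distribution) = - (\<integral>y. g (x + r * y) \<partial>std_normal_distribution)"
proof -
  have "(\<integral>y. g (- x + r * y) \<partial>std_normal_distribution) = (\<integral>y. std_normal_density y * g (- x + r * y) \<partial>lborel)"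
    using g by (subst integral_density) auto
  also have "\<dots> = (\<integral>y. std_normal_density (0 + (-1) * y) * g (- x + r * (0 + (-1) * y)) \<partial>lborel)"
    using lborel_integral_real_affine[of "-1" "\<lambda>y. std_normal_density y * g (- x + r * y)" 0] by simp
  also have "\<dots> = (\<integral>y. - (std_normal_density y * g (x + r * y)) \<partial>lborel)"
  proof (rule Bochner_Integration.integral_cong[OF refl])
    fix y
    have "g (- x + r * (0 + (-1) * y)) = - g (x + r * y)" using odd[of "x + r * y"] by simp
    moreover have "std_normal_density (0 + (-1) * y) = std_normal_density y" by (simp add: std_normal_density_def)
    ultimately show "std_normal_density (0 + (-1) * y) * g (- x + r * (0 + (-1) * y)) = - (std_normal_density y * g (x + r * y))"
      by simp
  qed
  also have "\<dots> = - (\<integral>y. g (x + r * y) \<partial>std_normal_distribution)"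
    using g by (subst integral_density) auto
  finally show ?thesis .
qed

text \<open>Symmetrising \<open>g z * q ((z - x) / r)\<close>, with the standard normal density \<open>q\<close>, in \<open>z\<close> yields the
  integrand \<open>g z * (q ((z - x) / r) - q ((z + x) / r))\<close>. For \<open>x > 0\<close> both factors are odd in \<open>z\<close> and
  nonnegative for \<open>z > 0\<close>, and the second one is strictly positive there.\<close>

lemma gauss_average_odd_pos:
  assumes g: "continuous_on UNIV g" and odd: "\<And>y. g (- y) = - g y" and nonneg: "\<And>y. 0 < y \<Longrightarrow> 0 \<le> g y"
    and nz: "0 < y0" "g y0 \<noteq> 0" and A: "A \<ge> 0" "K \<ge> 0" "\<And>y. \<bar>g y\<bar> \<le> A * exp (K * \<bar>y\<bar>)"
    and r: "0 < r" and x: "0 < x"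
  shows "0 < (\<integral>y. g (x + r * y) \<partial>std_normal_distribution)"
proof -
  let ?q = std_normal_density
  define f where "f z = g z * ?q ((z - x) / r)" for z
  define F where "F z = g z * (?q ((z - x) / r) - ?q ((z + x) / r))" for z
  have gm: "g \<in> borel_measurable borel" using g by (rule borel_measurable_continuous_onI)
  have fm: "f \<in> borel_measurable borel" unfolding f_def[abs_def] using gm by measurable
  have "integrable std_normal_distribution (\<lambda>y. g (x + r * y))"
    using integrable_gauss_shift(1)[OF gm A, of r r] r by simp
  then have iq: "integrable lborel (\<lambda>y. ?q y * g (x + r * y))"
    using gm by (subst (asm) integrable_density) auto
  have fq: "f (x + r * y) = ?q y * g (x + r * y)" for y using r by (simp add: f_def)
  have if1: "integrable lborel f"
    using lborel_integrable_real_affine_iff[of r f x] r iq by (simp add: fq)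
  have if2: "integrable lborel (\<lambda>z. f (0 + (-1) * z))"
    using if1 lborel_integrable_real_affine_iff[of "-1" f 0] by simp
  have I: "(\<integral>y. g (x + r * y) \<partial>std_normal_distribution) = (\<integral>z. f z \<partial>lborel) / r"
    using lborel_integral_real_affine[of r f x] r gm by (subst integral_density) (auto simp: fq)
  have "2 * (\<integral>z. f z \<partial>lborel) = (\<integral>z. f z \<partial>lborel) + (\<integral>z. f (0 + (-1) * z) \<partial>lborel)"
    using lborel_integral_real_affine[of "-1" f 0] by simp
  also have "\<dots> = (\<integral>z. f z + f (0 + (-1) * z) \<partial>lborel)"
    by (rule Bochner_Integration.integral_add[symmetric, OF if1 if2])
  also have "(\<lambda>z. f z + f (0 + (-1) * z)) = F"
  proof
    fix z
    have "?q ((- z - x) / r) = ?q ((z + x) / r)"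
      by (simp add: std_normal_density_def power_divide power2_eq_square algebra_simps)
    then show "f z + f (0 + (-1) * z) = F z" unfolding f_def F_def by (simp add: odd algebra_simps)
  qed
  finally have IF: "2 * (\<integral>z. f z \<partial>lborel) = (\<integral>z. F z \<partial>lborel)" .
  have iF: "integrable lborel F"
    using Bochner_Integration.integrable_add[OF if1 if2] \<open>(\<lambda>z. f z + f (0 + (-1) * z)) = F\<close> by simp
  have qdiff: "?q ((z + x) / r) < ?q ((z - x) / r)" if z: "0 < z" for z
  proof -
    have "(z - x)\<^sup>2 < (z + x)\<^sup>2" using z x by (simp add: power2_sum power2_diff)
    then have "((z - x) / r)\<^sup>2 < ((z + x) / r)\<^sup>2" using r by (simp add: power_divide divide_strict_right_mono)
    then show ?thesis by (simp add: std_normal_density_def divide_strict_right_mono)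
  qed
  have F_even: "F (- z) = F z" for z
  proof -
    have "?q ((- z - x) / r) = ?q ((z + x) / r)" "?q ((- z + x) / r) = ?q ((z - x) / r)"
      by (simp_all add: std_normal_density_def power_divide power2_eq_square algebra_simps)
    then show ?thesis unfolding F_def by (simp add: odd algebra_simps)
  qed
  have g0: "g 0 = 0" using odd[of 0] by simp
  have F_pos: "0 \<le> F z" if "0 < z" for z
    unfolding F_def using nonneg[OF that] qdiff[OF that] by simp
  have F_nonneg: "0 \<le> F z" for z
  proof (cases "z = 0")
    case True
    then show ?thesis by (simp add: F_def g0)
  next
    case False
    then show ?thesis using F_pos[of z] F_pos[of "- z"] F_even[of z] by (cases "0 < z") auto
  qed
  have "(\<integral>z. F z \<partial>lborel) \<noteq> 0"
  proof
    assume "(\<integral>z. F z \<partial>lborel) = 0"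
    then have ae: "AE z in lborel. F z = 0"
      using integral_nonneg_eq_0_iff_AE[OF iF] F_nonneg by simp
    have "isCont g y0" using g by (simp add: continuous_on_eq_continuous_at)
    then have "\<forall>\<^sub>F z in nhds y0. g z \<noteq> 0"
      using nz(2) tendsto_imp_eventually_ne[of g "g y0" "at y0" 0] by (simp add: isCont_def eventually_nhds_conv_at)
    then obtain d where d: "d > 0" "\<And>z. \<bar>z - y0\<bar> < d \<Longrightarrow> g z \<noteq> 0"
      unfolding eventually_nhds_metric by (auto simp: dist_real_def)
    define b where "b = y0 + d"
    have "AE z in lborel. z \<notin> {y0<..<b}"
      using ae
    proof eventually_elim
      case (elim z)
      show ?case
      proof
        assume z: "z \<in> {y0<..<b}"
        then have "g z \<noteq> 0" "0 < z" using d(2)[of z] nz(1) by (auto simp: b_def)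
        then show False using elim qdiff[of z] by (simp add: F_def)
      qed
    qed
    moreover have e: "{z \<in> space lborel. \<not> z \<notin> {y0<..<b}} = {y0<..<b}" by auto
    moreover have "{y0<..<b} \<in> sets lborel" by simp
    ultimately have "emeasure lborel {y0<..<b} = 0" using AE_iff_measurable[OF _ e] by blast
    then show False using d(1) by (simp add: b_def)
  qed
  then have "0 < (\<integral>z. F z \<partial>lborel)" using Bochner_Integration.integral_nonneg[of lborel F] F_nonneg by (simp add: less_le)
  then show ?thesis using IF r unfolding I by simp
qed

section \<open>Representation for sine sums\<close>

context bm_horizon
begin

text \<open>The heat flow run for the remaining time \<open>T - s\<close>; \<open>value_grad\<close> is the gradient $v$ of the value
  function of the linear equation, and \<open>signed\<close> multiplies an integrand by the drift coefficient
  $\kappa\,\mathrm{sgn}(B - c)$.\<close>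

definition heat :: "(real \<Rightarrow> real) \<Rightarrow> real \<Rightarrow> real \<Rightarrow> real" where
  "heat g s x = (\<integral>y. g (x + sqrt (T - s) * y) \<partial>std_normal_distribution)"

definition value_grad :: "real \<Rightarrow> real \<Rightarrow> (real \<Rightarrow> real) \<Rightarrow> real \<Rightarrow> real \<Rightarrow> real" where
  "value_grad \<kappa> c g s x = exp (- \<kappa> * \<bar>x - c\<bar> - \<kappa>\<^sup>2 * (T - s) / 2) * heat g s (x - c)"

definition value_process :: "real \<Rightarrow> real \<Rightarrow> (real \<Rightarrow> real) \<Rightarrow> real \<Rightarrow> real \<times> 'a \<Rightarrow> real" where
  "value_process \<kappa> c g t x = value_grad \<kappa> c g (fst x) (W (fst x) (snd x)) * indicator {t<..T} (fst x)"

definition signed :: "real \<Rightarrow> real \<Rightarrow> (real \<times> 'a \<Rightarrow> real) \<Rightarrow> real \<times> 'a \<Rightarrow> real" where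
  "signed \<kappa> c V x = \<kappa> * sgn (W (fst x) (snd x) - c) * V x"

lemma L2_signed:
  assumes "L2 mu V" shows "L2 mu (signed \<kappa> c V)" "l2norm mu (signed \<kappa> c V) \<le> \<bar>\<kappa>\<bar> * l2norm mu V"
proof -
  have [measurable]: "(\<lambda>x. W (fst x) (snd x)) \<in> borel_measurable mu"
    using measurable_W_joint[of T] by (simp add: lam_def)
  have [measurable]: "V \<in> borel_measurable mu" using L2_measurable[OF assms] .
  have [measurable]: "(sgn :: real \<Rightarrow> real) \<in> borel_measurable borel" by simp
  have m: "signed \<kappa> c V \<in> borel_measurable mu" unfolding signed_def[abs_def] by measurable
  have b: "AE x in mu. \<bar>signed \<kappa> c V x\<bar> \<le> \<bar>\<kappa> * V x\<bar>"
    by (auto simp: signed_def abs_mult abs_sgn_eq mult_left_mono)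
  show "L2 mu (signed \<kappa> c V)" by (rule L2_bound[OF m L2_cmult[OF assms] b])
  show "l2norm mu (signed \<kappa> c V) \<le> \<bar>\<kappa>\<bar> * l2norm mu V"
    using l2norm_mono[OF m L2_cmult[OF assms] b] by (simp add: l2norm_cmult)
qed

text \<open>The linear equation with terminal function \<open>\<Phi>\<close> is solved by the pair of a function \<open>u\<close> of \<open>B t\<close> and
  the gradient process. The terminal function enters through its derivative, which fixes it up to a
  constant.\<close>

definition represented :: "real \<Rightarrow> real \<Rightarrow> (real \<Rightarrow> real) \<Rightarrow> bool" where
  "represented \<kappa> c g \<longleftrightarrow> (\<exists>\<Phi>. (\<forall>x. (\<Phi> has_real_derivative exp (- \<kappa> * \<bar>x - c\<bar>) * g (x - c)) (at x)) \<and>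
     L2 M (\<lambda>\<omega>. \<Phi> (B T \<omega>)) \<and>
     (\<forall>t. 0 \<le> t \<longrightarrow> t < T \<longrightarrow> (\<exists>u\<in>borel_measurable borel. L2 M (\<lambda>\<omega>. u (B t \<omega>)) \<and>
        ito_limit t (value_process \<kappa> c g t)
          (\<lambda>\<omega>. \<Phi> (B T \<omega>) + time_integral (signed \<kappa> c (value_process \<kappa> c g t)) \<omega> - u (B t \<omega>)))))"

lemma represented_sin:
  assumes l: "l > 0" shows "represented \<kappa> c (\<lambda>y. sin (l * y))"
  unfolding represented_def
proof (rule exI[of _ "\<lambda>x. eigen \<kappa> l (x - c)"], intro conjI allI impI)
  define \<beta> where "\<beta> = (\<kappa>\<^sup>2 + l\<^sup>2) / 2"
  have sh: "((\<lambda>x. x - c) has_real_derivative 1) (at x)" for x by (auto intro!: derivative_eq_intros)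
  have d1: "((\<lambda>x. eigen \<kappa> l (x - c)) has_real_derivative eigen' \<kappa> l (x - c)) (at x)" for x
    using DERIV_chain2[OF eigen_derivative[OF l] sh] by simp
  have d2: "((\<lambda>x. eigen' \<kappa> l (x - c)) has_real_derivative eigen'' \<kappa> l (x - c)) (at x)" for x
    using DERIV_chain2[OF eigen'_derivative sh] by simp
  show "((\<lambda>x. eigen \<kappa> l (x - c)) has_real_derivative exp (- \<kappa> * \<bar>x - c\<bar>) * sin (l * (x - c))) (at x)" for x
    using d1[of x] by (simp add: eigen'_def)
  have L: "L2 M (\<lambda>\<omega>. eigen \<kappa> l (B s \<omega> - c))" if "0 \<le> s" "s \<le> T" for s
    using discounted_L2[OF exp_lipschitz_eigen(1)[of \<kappa> l c], of 0] that by (auto simp: discounted_def)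
  then show "L2 M (\<lambda>\<omega>. eigen \<kappa> l (B T \<omega> - c))" using T_pos by simp
  fix t assume t: "0 \<le> t" "t < T"
  let ?u = "\<lambda>x. exp (- \<beta> * (T - t)) * eigen \<kappa> l (x - c)"
  let ?P = "discounted_process \<beta> (\<lambda>x. eigen' \<kappa> l (x - c)) t"
  have Veq: "value_process \<kappa> c (\<lambda>y. sin (l * y)) t x = exp (- \<beta> * T) * ?P x" for x
  proof (cases "fst x \<in> {t<..T}")
    case True
    have "l\<^sup>2 * (sqrt (T - fst x))\<^sup>2 = l\<^sup>2 * (T - fst x)" using True by simp
    then have "heat (\<lambda>y. sin (l * y)) (fst x) z = exp (- (l\<^sup>2 * (T - fst x)) / 2) * sin (l * z)" for z
      unfolding heat_def gauss_expectation_sin by simp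
    then have "value_grad \<kappa> c (\<lambda>y. sin (l * y)) (fst x) z = exp (- \<beta> * T) * (exp (\<beta> * fst x) * eigen' \<kappa> l (z - c))" for z
      unfolding value_grad_def eigen'_def
      by (simp add: exp_add[symmetric] mult.assoc[symmetric]) (simp add: \<beta>_def field_simps)
    then show ?thesis by (simp add: value_process_def discounted_process_def discounted_def)
  qed (simp add: value_process_def discounted_process_def)
  have Leq: "discounted_process \<beta> (\<lambda>x. \<beta> * eigen \<kappa> l (x - c) + eigen'' \<kappa> l (x - c) / 2) t x = signed (- \<kappa>) c ?P x" for x
    using eigen_equation[OF l, of \<kappa> "W (fst x) (snd x) - c"]
    by (simp add: discounted_process_def discounted_def signed_def \<beta>_def mult_ac)
  have il: "ito_limit t (\<lambda>x. exp (- \<beta> * T) * ?P x) (\<lambda>\<omega>. exp (- \<beta> * T) *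
      (discounted \<beta> (\<lambda>x. eigen \<kappa> l (x - c)) T (B T \<omega>) - discounted \<beta> (\<lambda>x. eigen \<kappa> l (x - c)) t (B t \<omega>)
      - time_integral (discounted_process \<beta> (\<lambda>x. \<beta> * eigen \<kappa> l (x - c) + eigen'' \<kappa> l (x - c) / 2) t) \<omega>))"
    by (intro ito_limit_cmult ito_formula[OF d1 d2 exp_lipschitz_eigen t])
  have Xeq: "exp (- \<beta> * T) * (discounted \<beta> (\<lambda>x. eigen \<kappa> l (x - c)) T (B T \<omega>) - discounted \<beta> (\<lambda>x. eigen \<kappa> l (x - c)) t (B t \<omega>)
      - time_integral (discounted_process \<beta> (\<lambda>x. \<beta> * eigen \<kappa> l (x - c) + eigen'' \<kappa> l (x - c) / 2) t) \<omega>)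
    = eigen \<kappa> l (B T \<omega> - c) + time_integral (signed \<kappa> c (value_process \<kappa> c (\<lambda>y. sin (l * y)) t)) \<omega> - ?u (B t \<omega>)" for \<omega>
  proof -
    have 1: "time_integral (signed \<kappa> c (value_process \<kappa> c (\<lambda>y. sin (l * y)) t)) \<omega>
      = - exp (- \<beta> * T) * time_integral (signed (- \<kappa>) c ?P) \<omega>"
    proof -
      have "signed \<kappa> c (value_process \<kappa> c (\<lambda>y. sin (l * y)) t) = (\<lambda>x. - exp (- \<beta> * T) * signed (- \<kappa>) c ?P x)"
        by (rule ext) (simp only: signed_def Veq, simp)
      then show ?thesis by (simp only: time_integral_cmult)
    qed
    have 2: "exp (- \<beta> * T) * discounted \<beta> (\<lambda>x. eigen \<kappa> l (x - c)) s y = exp (- \<beta> * (T - s)) * eigen \<kappa> l (y - c)" for s y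
      unfolding discounted_def mult.assoc[symmetric] exp_add[symmetric] by (simp add: algebra_simps)
    show ?thesis unfolding 1 right_diff_distrib 2 Leq[abs_def] by simp
  qed
  have Veq': "value_process \<kappa> c (\<lambda>y. sin (l * y)) t = (\<lambda>x. exp (- \<beta> * T) * ?P x)" by (rule ext) (rule Veq)
  have "ito_limit t (value_process \<kappa> c (\<lambda>y. sin (l * y)) t)
     (\<lambda>\<omega>. eigen \<kappa> l (B T \<omega> - c) + time_integral (signed \<kappa> c (value_process \<kappa> c (\<lambda>y. sin (l * y)) t)) \<omega> - ?u (B t \<omega>))"
    using il unfolding Xeq Veq'[symmetric] .
  moreover have "?u \<in> borel_measurable borel"
    using exp_lipschitz_measurable[OF exp_lipschitz_eigen(1)] by measurable
  moreover have "L2 M (\<lambda>\<omega>. ?u (B t \<omega>))" using L2_cmult[OF L[of t]] t by simp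
  ultimately show "\<exists>u\<in>borel_measurable borel. L2 M (\<lambda>\<omega>. u (B t \<omega>)) \<and>
        ito_limit t (value_process \<kappa> c (\<lambda>y. sin (l * y)) t)
          (\<lambda>\<omega>. eigen \<kappa> l (B T \<omega> - c) + time_integral (signed \<kappa> c (value_process \<kappa> c (\<lambda>y. sin (l * y)) t)) \<omega> - u (B t \<omega>))"
    by (intro bexI[of _ ?u]) auto
qed

lemma integrable_heat_sine_sum:
  assumes "sine_sum g" "s \<le> T"
  shows "integrable std_normal_distribution (\<lambda>y. g (x + sqrt (T - s) * y))"
proof -
  obtain C where C: "C \<ge> 0" "\<And>y. \<bar>g y\<bar> \<le> C" and g: "continuous_on UNIV g" using sine_sum_regular[OF assms(1)] by blast
  show ?thesis
    using integrable_gauss_shift(1)[of g C 0 "sqrt (T - s)" "sqrt (T - s)"] C assms(2) borel_measurable_continuous_onI[OF g] by simp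
qed

lemma represented_sine_sum:
  assumes "sine_sum g" shows "represented \<kappa> c g"
  using assms
proof (induction rule: sine_sum.induct)
  case zero
  have "value_process \<kappa> c (\<lambda>_. 0) t = (\<lambda>_. 0)" for t by (simp add: value_process_def value_grad_def heat_def fun_eq_iff)
  then show ?case unfolding represented_def
    by (intro exI[of _ "\<lambda>_. 0"]) (auto intro!: bexI[of _ "\<lambda>_. 0"] ito_limit_zero simp: signed_def[abs_def] time_integral_def)
next
  case (add g l a)
  let ?s = "\<lambda>y. sin (l * y)" and ?g = "\<lambda>y. a * sin (l * y) + g y"
  obtain \<Phi> where \<Phi>: "\<And>x. (\<Phi> has_real_derivative exp (- \<kappa> * \<bar>x - c\<bar>) * g (x - c)) (at x)" "L2 M (\<lambda>\<omega>. \<Phi> (B T \<omega>))"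
    and r\<Phi>: "\<And>t. 0 \<le> t \<Longrightarrow> t < T \<Longrightarrow> \<exists>u\<in>borel_measurable borel. L2 M (\<lambda>\<omega>. u (B t \<omega>)) \<and> ito_limit t (value_process \<kappa> c g t)
          (\<lambda>\<omega>. \<Phi> (B T \<omega>) + time_integral (signed \<kappa> c (value_process \<kappa> c g t)) \<omega> - u (B t \<omega>))"
    using add.IH unfolding represented_def by blast
  obtain \<Psi> where \<Psi>: "\<And>x. (\<Psi> has_real_derivative exp (- \<kappa> * \<bar>x - c\<bar>) * ?s (x - c)) (at x)" "L2 M (\<lambda>\<omega>. \<Psi> (B T \<omega>))"
    and r\<Psi>: "\<And>t. 0 \<le> t \<Longrightarrow> t < T \<Longrightarrow> \<exists>u\<in>borel_measurable borel. L2 M (\<lambda>\<omega>. u (B t \<omega>)) \<and> ito_limit t (value_process \<kappa> c ?s t)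
          (\<lambda>\<omega>. \<Psi> (B T \<omega>) + time_integral (signed \<kappa> c (value_process \<kappa> c ?s t)) \<omega> - u (B t \<omega>))"
    using represented_sin[OF add.hyps(2), of \<kappa> c] unfolding represented_def by blast
  have Veq: "value_process \<kappa> c ?g t x = a * value_process \<kappa> c ?s t x + value_process \<kappa> c g t x" for t x
  proof (cases "fst x \<in> {t<..T}")
    case True
    then have s: "fst x \<le> T" by simp
    have "heat ?g (fst x) z = a * heat ?s (fst x) z + heat g (fst x) z" for z
      unfolding heat_def
      using integrable_heat_sine_sum[OF sine_sum_sin[OF add.hyps(2)] s, of z] integrable_heat_sine_sum[OF add.hyps(1) s, of z] by simp
    then show ?thesis unfolding value_process_def value_grad_def by (simp add: algebra_simps)
  qed (simp add: value_process_def)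
  show ?case unfolding represented_def
  proof (rule exI[of _ "\<lambda>x. a * \<Psi> x + \<Phi> x"], intro conjI allI impI)
    show "((\<lambda>x. a * \<Psi> x + \<Phi> x) has_real_derivative exp (- \<kappa> * \<bar>x - c\<bar>) * ?g (x - c)) (at x)" for x
      using DERIV_add[OF DERIV_cmult[OF \<Psi>(1)[of x], of a] \<Phi>(1)[of x]] by (simp add: algebra_simps)
    show "L2 M (\<lambda>\<omega>. a * \<Psi> (B T \<omega>) + \<Phi> (B T \<omega>))" by (intro L2_add L2_cmult \<Psi> \<Phi>)
    fix t assume t: "0 \<le> t" "t < T"
    obtain u where u: "u \<in> borel_measurable borel" "L2 M (\<lambda>\<omega>. u (B t \<omega>))" "ito_limit t (value_process \<kappa> c g t)
          (\<lambda>\<omega>. \<Phi> (B T \<omega>) + time_integral (signed \<kappa> c (value_process \<kappa> c g t)) \<omega> - u (B t \<omega>))" using r\<Phi>[OF t] by blast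
    obtain v where v: "v \<in> borel_measurable borel" "L2 M (\<lambda>\<omega>. v (B t \<omega>))" "ito_limit t (value_process \<kappa> c ?s t)
          (\<lambda>\<omega>. \<Psi> (B T \<omega>) + time_integral (signed \<kappa> c (value_process \<kappa> c ?s t)) \<omega> - v (B t \<omega>))" using r\<Psi>[OF t] by blast
    let ?u = "\<lambda>x. a * v x + u x"
    have um: "?u \<in> borel_measurable borel" using u v by measurable
    have Lu: "L2 M (\<lambda>\<omega>. ?u (B t \<omega>))" by (intro L2_add L2_cmult u v)
    note L1 = ito_limit_L2(1)[OF v(3)] and L2' = ito_limit_L2(1)[OF u(3)]
    note S1 = L2_signed(1)[OF L1, of \<kappa> c] and S2 = L2_signed(1)[OF L2', of \<kappa> c]
    have V: "value_process \<kappa> c ?g t = (\<lambda>x. a * value_process \<kappa> c ?s t x + value_process \<kappa> c g t x)" using Veq by (simp add: fun_eq_iff)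
    have SV: "signed \<kappa> c (value_process \<kappa> c ?g t)
        = (\<lambda>x. a * signed \<kappa> c (value_process \<kappa> c ?s t) x + signed \<kappa> c (value_process \<kappa> c g t) x)"
      unfolding V by (simp add: signed_def fun_eq_iff algebra_simps)
    note il = ito_limit_add[OF t(1) ito_limit_cmult[OF v(3), of a] u(3)]
    have "ito_limit t (value_process \<kappa> c ?g t)
          (\<lambda>\<omega>. (a * \<Psi> (B T \<omega>) + \<Phi> (B T \<omega>)) + time_integral (signed \<kappa> c (value_process \<kappa> c ?g t)) \<omega> - ?u (B t \<omega>))"
    proof (rule ito_limit_cong_AE[OF il t(1)])
      show "AE x in mu. a * value_process \<kappa> c ?s t x + value_process \<kappa> c g t x = value_process \<kappa> c ?g t x" by (simp add: Veq)
      show "AE \<omega> in M. a * (\<Psi> (B T \<omega>) + time_integral (signed \<kappa> c (value_process \<kappa> c ?s t)) \<omega> - v (B t \<omega>)) +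
          (\<Phi> (B T \<omega>) + time_integral (signed \<kappa> c (value_process \<kappa> c g t)) \<omega> - u (B t \<omega>))
        = (a * \<Psi> (B T \<omega>) + \<Phi> (B T \<omega>)) + time_integral (signed \<kappa> c (value_process \<kappa> c ?g t)) \<omega> - ?u (B t \<omega>)"
        using time_integral_add[OF L2_cmult[OF S1, of a] S2]
      proof eventually_elim
        case (elim \<omega>)
        show ?case unfolding SV elim time_integral_cmult by (simp add: algebra_simps)
      qed
      have Lg: "L2 mu (value_process \<kappa> c ?g t)" unfolding V using L1 L2' by (intro L2_add L2_cmult)
      then show "value_process \<kappa> c ?g t \<in> borel_measurable mu" by (rule L2_measurable)
      have "L2 M (\<lambda>\<omega>. (a * \<Psi> (B T \<omega>) + \<Phi> (B T \<omega>)) + time_integral (signed \<kappa> c (value_process \<kappa> c ?g t)) \<omega> - ?u (B t \<omega>))"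
        by (intro L2_diff[OF _ Lu] L2_add L2_cmult \<Psi> \<Phi> L2_time_integral L2_signed(1) Lg)
      then show "(\<lambda>\<omega>. (a * \<Psi> (B T \<omega>) + \<Phi> (B T \<omega>)) + time_integral (signed \<kappa> c (value_process \<kappa> c ?g t)) \<omega> - ?u (B t \<omega>)) \<in> borel_measurable M"
        by (rule L2_measurable)
    qed
    then show "\<exists>u\<in>borel_measurable borel. L2 M (\<lambda>\<omega>. u (B t \<omega>)) \<and> ito_limit t (value_process \<kappa> c ?g t)
          (\<lambda>\<omega>. a * \<Psi> (B T \<omega>) + \<Phi> (B T \<omega>) + time_integral (signed \<kappa> c (value_process \<kappa> c ?g t)) \<omega> - u (B t \<omega>))"
      using um Lu by (intro bexI[of _ ?u]) auto
  qed
qed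

end

section \<open>Growth and antiderivatives\<close>

lemma polynomial_growth_exp:
  assumes "polynomial_growth f" obtains A where "A \<ge> 0" "\<And>x. \<bar>f x\<bar> \<le> A * exp \<bar>x\<bar>"
proof -
  obtain C and p :: nat where C: "\<And>x. \<bar>f x\<bar> \<le> C * (1 + \<bar>x\<bar> ^ p)"
    using assms unfolding polynomial_growth_def by blast
  have "\<bar>f x\<bar> \<le> (\<bar>C\<bar> * (1 + fact p)) * exp \<bar>x\<bar>" for x
  proof -
    have "\<bar>f x\<bar> \<le> \<bar>C\<bar> * (1 + \<bar>x\<bar> ^ p)"
      using C[of x] by (rule order_trans) (intro mult_right_mono, auto)
    also have "\<dots> \<le> \<bar>C\<bar> * (exp \<bar>x\<bar> + fact p * exp \<bar>x\<bar>)"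
      by (intro mult_left_mono add_mono power_le_fact_exp) auto
    finally show ?thesis by (simp add: algebra_simps)
  qed
  then show ?thesis using that[of "\<bar>C\<bar> * (1 + fact p)"] by simp
qed

text \<open>The approximating terminal functions are controlled through their derivatives, by dominated
  convergence on the interval between \<open>c\<close> and \<open>x\<close>.\<close>

lemma antiderivative_convergence:
  assumes D: "\<And>n x. (D n has_real_derivative d n x) (at x)" "\<And>n. D n c = 0"
    and d: "\<And>n x. isCont (d n) x" "\<And>n x. \<bar>d n x\<bar> \<le> A * exp (K * \<bar>x - c\<bar>)" "\<And>x. (\<lambda>n::nat. d n x) \<longlonglongrightarrow> 0"
    and A: "A \<ge> 0" "K \<ge> 0"
  shows "\<bar>D n x\<bar> \<le> A * exp ((K + 1) * \<bar>x - c\<bar>)" "(\<lambda>n. D n x) \<longlonglongrightarrow> 0"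
proof -
  define a where "a = min c x"
  define b where "b = max c x"
  define R where "R = A * exp (K * \<bar>x - c\<bar>)"
  have ab: "a \<le> b" by (simp add: a_def b_def)
  have R: "\<bar>d n z\<bar> \<le> R" if "z \<in> {a..b}" for n z
  proof -
    have "\<bar>z - c\<bar> \<le> \<bar>x - c\<bar>" using that by (auto simp: a_def b_def)
    then have "A * exp (K * \<bar>z - c\<bar>) \<le> R" unfolding R_def using A by (intro mult_left_mono) (auto intro: mult_left_mono)
    then show ?thesis using d(2)[of n z] by linarith
  qed
  have R0: "R \<ge> 0" using A by (simp add: R_def)
  have I: "has_bochner_integral lborel (\<lambda>z. indicator {a..b} z *\<^sub>R d n z) (D n b - D n a)" for n
    using has_bochner_integral_FTC_Icc_real[OF ab, of "D n" "d n"] D(1)[where n=n] d(1)[where n=n]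
    by (simp add: mult.commute)
  have DI: "\<bar>D n x\<bar> = \<bar>\<integral>z. indicator {a..b} z *\<^sub>R d n z \<partial>lborel\<bar>" for n
    using has_bochner_integral_integral_eq[OF I[of n]] D(2)[of n] by (cases "c \<le> x") (auto simp: a_def b_def)
  have iR: "integrable lborel (\<lambda>z. R * indicator {a..b} z)"
    using ab by (intro integrable_mult_right integrable_real_indicator) auto
  have "\<bar>D n x\<bar> \<le> R * (b - a)" for n
  proof -
    have "\<bar>D n x\<bar> \<le> (\<integral>z. \<bar>indicator {a..b} z *\<^sub>R d n z\<bar> \<partial>lborel)" unfolding DI by (rule integral_abs_bound)
    also have "\<dots> \<le> (\<integral>z. R * indicator {a..b} z \<partial>lborel)"
      using I[of n] iR R by (intro integral_mono integrable_abs) (auto simp: has_bochner_integral_iff indicator_def)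
    also have "\<dots> = R * (b - a)" using ab by simp
    finally show ?thesis .
  qed
  moreover have "b - a = \<bar>x - c\<bar>" by (auto simp: a_def b_def)
  moreover have "R * \<bar>x - c\<bar> \<le> R * exp \<bar>x - c\<bar>" using abs_le_exp[of "x - c"] R0 by (rule mult_left_mono)
  moreover have "R * exp \<bar>x - c\<bar> = A * exp ((K + 1) * \<bar>x - c\<bar>)" by (simp add: R_def exp_add[symmetric] algebra_simps)
  ultimately show "\<bar>D n x\<bar> \<le> A * exp ((K + 1) * \<bar>x - c\<bar>)" by (metis order_trans)
  have "(\<lambda>n. \<integral>z. indicator {a..b} z *\<^sub>R d n z \<partial>lborel) \<longlonglongrightarrow> (\<integral>z. 0 \<partial>(lborel :: real measure))"
  proof (rule integral_dominated_convergence[where w="\<lambda>z. R * indicator {a..b} z"])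
    show "AE z in lborel. (\<lambda>n. indicator {a..b} z *\<^sub>R d n z) \<longlonglongrightarrow> 0"
    proof (rule AE_I2)
      fix z show "(\<lambda>n. indicator {a..b} z *\<^sub>R d n z) \<longlonglongrightarrow> 0"
        using tendsto_mult[OF tendsto_const d(3)[of z], of "indicator {a..b} z"] by simp
    qed
    show "(\<lambda>z. indicator {a..b} z *\<^sub>R d n z) \<in> borel_measurable lborel" for n
      using I[of n] by (auto simp: has_bochner_integral_iff)
    show "AE z in lborel. norm (indicator {a..b} z *\<^sub>R d n z) \<le> R * indicator {a..b} z" for n
      using R R0 by (auto simp: indicator_def)
  qed (use iR in auto)
  then have "(\<lambda>n. \<bar>\<integral>z. indicator {a..b} z *\<^sub>R d n z \<partial>lborel\<bar>) \<longlonglongrightarrow> 0"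
    by (intro tendsto_rabs_zero) simp
  then show "(\<lambda>n. D n x) \<longlonglongrightarrow> 0" unfolding DI[symmetric] by (rule tendsto_rabs_zero_cancel)
qed

section \<open>Convergence and sign of the gradient\<close>

context bm_horizon
begin

lemma AE_mu_fst_neq: "AE x in mu. fst x \<noteq> a"
proof -
  have "AE s in lam. s \<noteq> a"
    unfolding lam_def by (subst AE_restrict_space_iff) (auto intro: AE_lborel_singleton[THEN eventually_mono])
  then have "AE s in lam. AE \<omega> in M. s \<noteq> a" by eventually_elim simp
  moreover have "{x \<in> space mu. fst x \<noteq> a} \<in> sets mu"
    using measurable_mu_fst by measurable
  ultimately show ?thesis by (intro pm.AE_pair_measure) auto
qed

lemma measurable_value_process:
  assumes g: "g \<in> borel_measurable borel"
  shows "value_process \<kappa> c g t \<in> borel_measurable mu"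
proof -
  interpret G: prob_space std_normal_distribution by (rule prob_space_std_normal)
  have [measurable]: "(\<lambda>x. W (fst x) (snd x)) \<in> borel_measurable mu"
    using measurable_W_joint[of T] by (simp add: lam_def)
  have [measurable]: "fst \<in> borel_measurable mu" by (rule measurable_mu_fst)
  note [measurable] = g
  have f1: "(\<lambda>p. fst (fst p)) \<in> borel_measurable (mu \<Otimes>\<^sub>M std_normal_distribution)"
    by (rule measurable_compose[OF measurable_fst measurable_mu_fst])
  have f2: "(\<lambda>p. W (fst (fst p)) (snd (fst p))) \<in> borel_measurable (mu \<Otimes>\<^sub>M std_normal_distribution)"
    by (rule measurable_compose[OF measurable_fst, of "\<lambda>x. W (fst x) (snd x)"]) measurable
  have f3: "snd \<in> borel_measurable (mu \<Otimes>\<^sub>M std_normal_distribution)"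
    using measurable_snd[of mu std_normal_distribution] by (simp add: measurable_cong_sets[OF refl sets_density])
  have "(\<lambda>x. heat g (fst x) (W (fst x) (snd x) - c)) \<in> borel_measurable mu"
    unfolding heat_def
  proof (rule G.borel_measurable_lebesgue_integral)
    have "(\<lambda>p. g (W (fst (fst p)) (snd (fst p)) - c + sqrt (T - fst (fst p)) * snd p)) \<in> borel_measurable (mu \<Otimes>\<^sub>M std_normal_distribution)"
      by (rule measurable_compose[OF _ g]) (use f1 f2 f3 in measurable)
    then show "(\<lambda>(x, y). g (W (fst x) (snd x) - c + sqrt (T - fst x) * y)) \<in> borel_measurable (mu \<Otimes>\<^sub>M std_normal_distribution)"
      by (simp add: case_prod_beta')
  qed
  note [measurable] = this measurable_mu_indicator[of "{t<..T}"]
  show ?thesis unfolding value_process_def[abs_def] value_grad_def by measurable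
qed

lemma value_process_convergence:
  assumes h: "\<And>n. h n \<in> borel_measurable borel" "\<And>n y. \<bar>h n y\<bar> \<le> A * exp (K * \<bar>y\<bar>)" "\<And>y. (\<lambda>n. h n y) \<longlonglongrightarrow> g y"
    and g: "g \<in> borel_measurable borel" and A: "A \<ge> 0" "K \<ge> 0"
  shows "L2 mu (value_process \<kappa> c g t)"
    "(\<lambda>n. l2norm mu (\<lambda>x. value_process \<kappa> c (h n) t x - value_process \<kappa> c g t x)) \<longlonglongrightarrow> 0"
proof -
  define N where "N = \<bar>\<kappa>\<bar> + K"
  define R where "R = A * gauss_exp_moment (K * sqrt T) 0 * exp (N * \<bar>c\<bar>)"
  have R0: "R \<ge> 0" using A(1) gauss_exp_moment_nonneg by (simp add: R_def)
  have N0: "N \<ge> 0" using A(2) by (simp add: N_def)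
  have Ldom: "L2 mu (\<lambda>x. R * exp (N * \<bar>W (fst x) (snd x)\<bar>))"
    using L2_cmult[OF L2_mu_discounted[OF exp_lipschitz_exp_abs[of N 0], of 0], of R] by (simp add: discounted_def)
  have bound: "\<bar>value_process \<kappa> c (h n) t x\<bar> \<le> R * exp (N * \<bar>W (fst x) (snd x)\<bar>)" if x: "x \<in> space mu" for n x
  proof -
    define s where "s = fst x"
    define z where "z = W (fst x) (snd x)"
    have s: "0 \<le> s" "s \<le> T" using x by (auto simp: space_mu s_def)
    have "\<bar>heat (h n) s (z - c)\<bar> \<le> A * gauss_exp_moment (K * sqrt T) 0 * exp (K * \<bar>z - c\<bar>)"
      unfolding heat_def using s by (intro integrable_gauss_shift(2)[OF h(1) A h(2)]) auto
    moreover have "exp (- \<kappa> * \<bar>z - c\<bar> - \<kappa>\<^sup>2 * (T - s) / 2) \<le> exp (\<bar>\<kappa>\<bar> * \<bar>z - c\<bar>)"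
    proof -
      have "- \<kappa> * \<bar>z - c\<bar> \<le> \<bar>\<kappa>\<bar> * \<bar>z - c\<bar>" by (intro mult_right_mono) auto
      moreover have "0 \<le> \<kappa>\<^sup>2 * (T - s) / 2" using s by simp
      ultimately show ?thesis by (subst exp_le_cancel_iff) linarith
    qed
    ultimately have "\<bar>value_grad \<kappa> c (h n) s z\<bar>
        \<le> exp (\<bar>\<kappa>\<bar> * \<bar>z - c\<bar>) * (A * gauss_exp_moment (K * sqrt T) 0 * exp (K * \<bar>z - c\<bar>))"
      unfolding value_grad_def abs_mult abs_exp_cancel by (intro mult_mono) auto
    also have "\<dots> = A * gauss_exp_moment (K * sqrt T) 0 * exp (N * \<bar>z - c\<bar>)"
    proof -
      have "exp (N * \<bar>z - c\<bar>) = exp (\<bar>\<kappa>\<bar> * \<bar>z - c\<bar>) * exp (K * \<bar>z - c\<bar>)"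
        unfolding N_def distrib_right exp_add ..
      then show ?thesis by simp
    qed
    also have "\<dots> \<le> A * gauss_exp_moment (K * sqrt T) 0 * exp (N * (\<bar>c\<bar> + \<bar>z\<bar>))"
      using A(1) N0 gauss_exp_moment_nonneg by (intro mult_left_mono) (auto intro!: mult_left_mono)
    also have "\<dots> = R * exp (N * \<bar>z\<bar>)" by (simp add: R_def distrib_left exp_add mult_ac)
    finally show ?thesis unfolding value_process_def using R0
      by (auto simp: s_def z_def indicator_def)
  qed
  have conv: "(\<lambda>n. value_process \<kappa> c (h n) t x) \<longlonglongrightarrow> value_process \<kappa> c g t x" if x: "x \<in> space mu" for x
  proof -
    have s: "0 \<le> fst x" "fst x \<le> T" using x by (auto simp: space_mu)
    have "(\<lambda>n. heat (h n) (fst x) z) \<longlonglongrightarrow> heat g (fst x) z" for z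
      unfolding heat_def
    proof (rule integral_dominated_convergence[where w="\<lambda>y. A * exp (K * \<bar>z + sqrt (T - fst x) * y\<bar>)"])
      show "integrable std_normal_distribution (\<lambda>y. A * exp (K * \<bar>z + sqrt (T - fst x) * y\<bar>))"
        using s A by (intro integrable_gauss_shift(1)[of "\<lambda>y. A * exp (K * \<bar>y\<bar>)" A K _ "sqrt T"]) auto
      show "AE y in std_normal_distribution. (\<lambda>n. h n (z + sqrt (T - fst x) * y)) \<longlonglongrightarrow> g (z + sqrt (T - fst x) * y)"
        using h(3) by simp
      show "AE y in std_normal_distribution. norm (h n (z + sqrt (T - fst x) * y)) \<le> A * exp (K * \<bar>z + sqrt (T - fst x) * y\<bar>)" for n
        using h(2) by simp
    qed (use h(1) g in measurable)
    then show ?thesis unfolding value_process_def value_grad_def by (intro tendsto_mult tendsto_const)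
  qed
  note dc = l2norm_dominated_convergence[where f="\<lambda>n. value_process \<kappa> c (h n) t" and g="value_process \<kappa> c g t",
      OF measurable_value_process[OF h(1)] measurable_value_process[OF g] Ldom]
  have 1: "AE x in mu. \<bar>value_process \<kappa> c (h n) t x\<bar> \<le> R * exp (N * \<bar>W (fst x) (snd x)\<bar>)" for n
    using bound by (rule AE_I2)
  have 2: "AE x in mu. (\<lambda>n. value_process \<kappa> c (h n) t x) \<longlonglongrightarrow> value_process \<kappa> c g t x"
    using conv by (rule AE_I2)
  show "L2 mu (value_process \<kappa> c g t)"
    "(\<lambda>n. l2norm mu (\<lambda>x. value_process \<kappa> c (h n) t x - value_process \<kappa> c g t x)) \<longlonglongrightarrow> 0"
    using dc[OF 1 2] by auto
qed

text \<open>At time \<open>T\<close> the gradient is the derivative of the terminal function, which may vanish away from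
  \<open>c\<close>; the strict statement therefore excludes \<open>s = T\<close>.\<close>

lemma value_grad_sign:
  assumes g: "continuous_on UNIV g" "\<And>y. g (- y) = - g y" "\<And>y. 0 < y \<Longrightarrow> 0 \<le> \<sigma> * g y"
    and nz: "0 < y0" "g y0 \<noteq> 0" and \<sigma>: "\<bar>\<sigma>\<bar> = 1"
    and A: "A \<ge> 0" "K \<ge> 0" "\<And>y. \<bar>g y\<bar> \<le> A * exp (K * \<bar>y\<bar>)"
  shows "s < T \<Longrightarrow> sgn (\<sigma> * value_grad \<kappa> c g s x) = sgn (x - c)"
    and "s \<le> T \<Longrightarrow> \<sigma> * sgn (x - c) * value_grad \<kappa> c g s x = \<bar>value_grad \<kappa> c g s x\<bar>"
proof -
  have gm: "g \<in> borel_measurable borel" using g(1) by (rule borel_measurable_continuous_onI)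
  have pos: "0 < \<sigma> * heat g s z" if "0 < z" "s < T" for z s
  proof -
    have "0 < (\<integral>y. (\<lambda>y. \<sigma> * g y) (z + sqrt (T - s) * y) \<partial>std_normal_distribution)"
      using that \<sigma> nz by (intro gauss_average_odd_pos[where ?y0.0=y0, OF _ _ g(3) _ _ A(1,2)])
        (auto simp: g(2) abs_mult intro!: continuous_intros g(1) A(3))
    then show ?thesis unfolding heat_def by simp
  qed
  have odd: "heat g s (- z) = - heat g s z" for s z
    unfolding heat_def by (rule gauss_average_odd[OF gm g(2)])
  have zero: "heat g s 0 = 0" for s using odd[of s 0] by simp
  show *: "sgn (\<sigma> * value_grad \<kappa> c g s x) = sgn (x - c)" if "s < T" for s
  proof -
    have "sgn (\<sigma> * value_grad \<kappa> c g s x) = sgn (\<sigma> * heat g s (x - c))"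
      unfolding value_grad_def by (simp add: sgn_mult)
    also have "\<dots> = sgn (x - c)"
    proof (rule linorder_cases[of x c])
      assume "x < c"
      then have "0 < \<sigma> * heat g s (- (x - c))" using pos that by simp
      then show ?thesis using \<open>x < c\<close> unfolding odd by simp
    next
      assume "c < x"
      then show ?thesis using pos[of "x - c" s] that by simp
    qed (simp add: zero)
    finally show ?thesis .
  qed
  show "\<sigma> * sgn (x - c) * value_grad \<kappa> c g s x = \<bar>value_grad \<kappa> c g s x\<bar>" if "s \<le> T" for s
  proof (cases "s < T")
    case True
    have "\<bar>value_grad \<kappa> c g s x\<bar> = \<bar>\<sigma> * value_grad \<kappa> c g s x\<bar>" using \<sigma> by (simp add: abs_mult)
    also have "\<dots> = sgn (x - c) * (\<sigma> * value_grad \<kappa> c g s x)"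
      unfolding *[OF True, symmetric] by (simp add: sgn_mult_self_eq abs_sgn mult.commute)
    finally show ?thesis by (simp add: mult_ac)
  next
    case False
    interpret G: prob_space std_normal_distribution by (rule prob_space_std_normal)
    have "heat g s z = g z" for z
      using False that lebesgue_integral_const[of std_normal_distribution "g z"] G.prob_space
      unfolding heat_def by (simp del: lebesgue_integral_const space_density)
    then have v: "value_grad \<kappa> c g s x = exp (- \<kappa> * \<bar>x - c\<bar>) * g (x - c)"
      using False that by (simp add: value_grad_def)
    have "\<sigma> * sgn z * g z = \<bar>g z\<bar>" for z
    proof (rule linorder_cases[of z 0])
      assume "z < 0"
      then have "0 \<le> \<sigma> * g (- z)" by (intro g(3)) simp
      then have "0 \<le> - (\<sigma> * g z)" by (simp add: g(2))
      moreover have "\<bar>\<sigma> * g z\<bar> = \<bar>g z\<bar>" using \<sigma> by (simp add: abs_mult)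
      ultimately show ?thesis using \<open>z < 0\<close> by simp
    next
      assume "0 < z"
      moreover have "\<bar>\<sigma> * g z\<bar> = \<bar>g z\<bar>" using \<sigma> by (simp add: abs_mult)
      ultimately show ?thesis using g(3)[of z] by simp
    qed (use g(2)[of 0] in simp)
    from this[of "x - c"] show ?thesis unfolding v by (simp add: abs_mult mult_ac)
  qed
qed

text \<open>\<open>G\<close> is the sum of the orthogonal variables \<open>X\<close> and \<open>U\<close>, and \<open>X\<close> has the norm of its
  integrand.\<close>

lemma ito_limit_norm_le:
  assumes "ito_limit t V X" "0 \<le> t" "U \<in> borel_measurable (F t)" "L2 M G" "AE \<omega> in M. X \<omega> = G \<omega> - U \<omega>"
  shows "l2norm mu V \<le> l2norm M G"
proof -
  note LX = ito_limit_L2(2)[OF assms(1)]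
  have LU: "L2 M U"
  proof (rule L2_bound[OF measurable_F_M[OF assms(3)] L2_diff[OF assms(4) LX]])
    show "AE \<omega> in M. \<bar>U \<omega>\<bar> \<le> \<bar>G \<omega> - X \<omega>\<bar>" using assms(5) by eventually_elim simp
  qed
  have orth: "expectation (\<lambda>\<omega>. X \<omega> * U \<omega>) = 0" by (rule ito_limit_orthogonal[OF assms(1-3) LU])
  have "(l2norm M G)\<^sup>2 = (l2norm M (\<lambda>\<omega>. X \<omega> + U \<omega>))\<^sup>2"
    using assms(5) L2_measurable[OF assms(4)] L2_measurable[OF L2_add[OF LX LU]]
    by (intro arg_cong[where f="\<lambda>x. x\<^sup>2"] l2norm_cong_AE) (auto elim: eventually_mono)
  also have "\<dots> = expectation (\<lambda>\<omega>. (X \<omega>)\<^sup>2 + 2 * (X \<omega> * U \<omega>) + (U \<omega>)\<^sup>2)"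
    unfolding l2norm_power2 by (intro Bochner_Integration.integral_cong) (auto simp: power2_sum algebra_simps)
  also have "\<dots> = (l2norm M X)\<^sup>2 + (l2norm M U)\<^sup>2"
    using LX LU L2_mult_integrable[OF LX LU] orth by (simp add: L2_def l2norm_power2)
  finally have "(l2norm M X)\<^sup>2 \<le> (l2norm M G)\<^sup>2" by simp
  then have "l2norm M X \<le> l2norm M G" by (rule power2_le_imp_le) simp
  then show ?thesis using ito_limit_isometry[OF assms(1,2)] by simp
qed

end

section \<open>Uniqueness and the comparison argument\<close>

context bm_horizon
begin

definition after :: "real \<Rightarrow> (real \<times> 'a \<Rightarrow> real) \<Rightarrow> real \<times> 'a \<Rightarrow> real" where
  "after t V x = V x * indicator {t<..T} (fst x)"

lemma L2_after: "L2 mu V \<Longrightarrow> L2 mu (after t V)"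
  unfolding after_def[abs_def] by (rule L2_mu_indicator) auto

lemma after_value_process: "0 \<le> t \<Longrightarrow> after t (value_process \<kappa> c g 0) = value_process \<kappa> c g t"
  by (auto simp: after_def value_process_def fun_eq_iff indicator_def)

lemma l2norm_time_integral_add:
  assumes "L2 mu V" "L2 mu V'"
  shows "l2norm M (time_integral (\<lambda>x. V x + V' x)) \<le> l2norm M (time_integral V) + l2norm M (time_integral V')"
proof -
  note L = L2_time_integral[OF assms(1)] L2_time_integral[OF assms(2)]
  have "l2norm M (time_integral (\<lambda>x. V x + V' x)) = l2norm M (\<lambda>\<omega>. time_integral V \<omega> + time_integral V' \<omega>)"
    using L2_measurable[OF L2_time_integral[OF L2_add[OF assms]]] L2_measurable[OF L2_add[OF L]] time_integral_add[OF assms]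
    by (rule l2norm_cong_AE)
  also have "\<dots> \<le> l2norm M (time_integral V) + l2norm M (time_integral V')" by (rule l2norm_triangle[OF L])
  finally show ?thesis .
qed

text \<open>If \<open>D\<close> vanishes after \<open>t0\<close>, then so does \<open>E\<close>, and the hypothesis on \<open>(t, t0]\<close> reads
  \<open>norm D \<le> L * sqrt (t0 - t) * norm D\<close>. On intervals of length \<open>T / N\<close> with \<open>L\<^sup>2 * T < N\<close> the factor is less
  than \<open>1\<close>.\<close>

lemma backward_uniqueness:
  assumes D: "L2 mu D" and E: "L2 mu E" and lip: "AE x in mu. \<bar>E x\<bar> \<le> L * \<bar>D x\<bar>" and L: "0 \<le> L"
    and ineq: "\<And>t. 0 \<le> t \<Longrightarrow> t < T \<Longrightarrow> l2norm mu (after t D) \<le> l2norm M (time_integral (after t E))"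
  shows "AE x in mu. D x = 0"
proof -
  have step: "l2norm mu (after t D) = 0"
    if t: "0 \<le> t" "t < t0" "t0 \<le> T" and small: "L * sqrt (t0 - t) < 1" and z: "l2norm mu (after t0 D) = 0" for t t0
  proof -
    define E1 where "E1 x = after t E x * indicator {t..t0} (fst x)" for x
    define E2 where "E2 x = after t E x * indicator {t0<..T} (fst x)" for x
    have L1: "L2 mu E1" and L2': "L2 mu E2" unfolding E1_def[abs_def] E2_def[abs_def]
      using L2_after[OF E] by (auto intro!: L2_mu_indicator)
    have split: "after t E = (\<lambda>x. E1 x + E2 x)"
      using t by (auto simp: E1_def E2_def after_def fun_eq_iff indicator_def)
    have "AE x in mu. after t0 D x = 0" using z l2norm_eq_0_iff[OF L2_after[OF D]] by simp
    then have "AE x in mu. E2 x = 0"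
      using lip by eventually_elim (auto simp: E2_def after_def indicator_def split: if_splits)
    then have "l2norm mu E2 = 0" using l2norm_eq_0_iff[OF L2'] by simp
    then have e2: "l2norm M (time_integral E2) = 0"
      using l2norm_time_integral[OF L2'] l2norm_nonneg[of M "time_integral E2"] by simp
    have "l2norm M (time_integral E1) \<le> sqrt (t0 - t) * l2norm mu E1"
      by (rule l2norm_time_integral_support[OF L1]) (use t in \<open>auto simp: E1_def\<close>)
    also have "\<dots> \<le> sqrt (t0 - t) * (L * l2norm mu (after t D))"
    proof (rule mult_left_mono)
      have "AE x in mu. \<bar>E1 x\<bar> \<le> \<bar>L * after t D x\<bar>"
        using lip by eventually_elim (use L in \<open>auto simp: E1_def after_def indicator_def abs_mult\<close>)
      then have "l2norm mu E1 \<le> l2norm mu (\<lambda>x. L * after t D x)"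
        by (intro l2norm_mono L2_measurable[OF L1] L2_cmult L2_after D)
      then show "l2norm mu E1 \<le> L * l2norm mu (after t D)" using L by (simp add: l2norm_cmult)
    qed (use t in simp)
    finally have e1: "l2norm M (time_integral E1) \<le> (L * sqrt (t0 - t)) * l2norm mu (after t D)" by (simp add: mult_ac)
    have "l2norm mu (after t D) \<le> l2norm M (time_integral (after t E))" using t by (intro ineq) auto
    also have "\<dots> \<le> l2norm M (time_integral E1) + l2norm M (time_integral E2)"
      unfolding split by (rule l2norm_time_integral_add[OF L1 L2'])
    finally have le: "l2norm mu (after t D) \<le> (L * sqrt (t0 - t)) * l2norm mu (after t D)" using e1 e2 by simp
    show ?thesis
    proof (rule ccontr)
      assume "l2norm mu (after t D) \<noteq> 0"
      then have "0 < l2norm mu (after t D)" using l2norm_nonneg[of mu "after t D"] by linarith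
      then have "(L * sqrt (t0 - t)) * l2norm mu (after t D) < 1 * l2norm mu (after t D)"
        using small by (rule mult_strict_right_mono[rotated])
      then show False using le by simp
    qed
  qed
  obtain N :: nat where N: "L\<^sup>2 * T < real N" using reals_Archimedean2 by blast
  have N0: "0 < N" using N L T_pos by (cases N) (auto simp: mult_less_0_iff not_less)
  have small: "L * sqrt (T / real N) < 1"
  proof -
    have "(L * sqrt (T / real N))\<^sup>2 = L\<^sup>2 * T / real N" using T_pos by (simp add: power_mult_distrib)
    also have "\<dots> < 1" using N N0 by (simp add: field_simps)
    finally have "(L * sqrt (T / real N))\<^sup>2 < 1\<^sup>2" by simp
    then show ?thesis by (rule power2_less_imp_less) simp
  qed
  have "l2norm mu (after (T - real j * (T / real N)) D) = 0" if "j \<le> N" for j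
    using that
  proof (induction j)
    case 0
    have "after T D = (\<lambda>x. 0)" by (auto simp: after_def fun_eq_iff)
    then show ?case by simp
  next
    case (Suc j)
    have j: "real (Suc j) * (T / real N) \<le> T"
    proof -
      have "real (Suc j) / real N \<le> 1" using Suc.prems N0 by simp
      then have "real (Suc j) / real N * T \<le> 1 * T" using T_pos by (intro mult_right_mono) auto
      then show ?thesis by simp
    qed
    have d: "(T - real j * (T / real N)) - (T - real (Suc j) * (T / real N)) = T / real N"
    proof -
      have "real (Suc j) * (T / real N) = T / real N + real j * (T / real N)"
        unfolding of_nat_Suc distrib_right by simp
      then show ?thesis by linarith
    qed
    have p: "0 < T / real N" using T_pos N0 by simp
    show ?case
    proof (rule step[of "T - real (Suc j) * (T / real N)" "T - real j * (T / real N)"])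
      show "0 \<le> T - real (Suc j) * (T / real N)" using j by linarith
      show "T - real (Suc j) * (T / real N) < T - real j * (T / real N)" using d p by linarith
      have "0 \<le> real j * (T / real N)" using p by (intro mult_nonneg_nonneg) auto
      then show "T - real j * (T / real N) \<le> T" by linarith
      show "L * sqrt (T - real j * (T / real N) - (T - real (Suc j) * (T / real N))) < 1" unfolding d by (rule small)
      show "l2norm mu (after (T - real j * (T / real N)) D) = 0" using Suc by simp
    qed
  qed
  from this[of N] have "l2norm mu (after 0 D) = 0" using N0 by simp
  then have "AE x in mu. after 0 D x = 0" using l2norm_eq_0_iff[OF L2_after[OF D]] by simp
  then show ?thesis
    using AE_mu_fst_neq[of 0] AE_space
    by eventually_elim (auto simp: after_def space_mu)
qed

text \<open>For the approximating sine sums the difference of the two equations expresses the difference of the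
  stochastic integrals as an error \<open>D n (B T)\<close> of the terminal values, plus a difference of time integrals,
  minus a variable from the past of \<open>t\<close>. Orthogonality removes the last term, and the first one
  tends to \<open>0\<close>.\<close>

lemma gradient_comparison:
  assumes Z: "L2 mu Z" and t: "0 \<le> t" "t < T"
    and I: "ito_limit t (after t Z) I"
    and Y: "Y \<in> borel_measurable (F t)"
    and eq: "AE \<omega> in M. Y \<omega> = \<phi> (B T \<omega>) + time_integral (after t (\<lambda>x. k * \<bar>Z x\<bar>)) \<omega> - I \<omega>"
    and \<phi>: "\<And>x. (\<phi> has_real_derivative exp (- \<kappa> * \<bar>x - c\<bar>) * g (x - c)) (at x)"
    and g: "continuous_on UNIV g" "\<And>y. g (- y) = - g y"
    and A: "A \<ge> 0" "K \<ge> 0" "\<And>y. \<bar>g y\<bar> \<le> A * exp (K * \<bar>y\<bar>)"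
  shows "l2norm mu (after t (\<lambda>x. Z x - value_process \<kappa> c g 0 x))
    \<le> l2norm M (time_integral (after t (\<lambda>x. k * \<bar>Z x\<bar> - signed \<kappa> c (value_process \<kappa> c g 0) x)))"
proof -
  obtain h where h: "\<And>n. sine_sum (h n)" "\<And>y. (\<lambda>n::nat. h n y) \<longlonglongrightarrow> g y"
    and hb: "\<And>n y. \<bar>h n y\<bar> \<le> (A + 1) * exp (K * \<bar>y\<bar>)"
    by (rule sine_sum_approximation[OF g A]) (rule that)
  have hc: "continuous_on UNIV (h n)" for n using sine_sum_regular[OF h(1)] by blast
  have hm: "h n \<in> borel_measurable borel" for n using hc by (rule borel_measurable_continuous_onI)
  have gm: "g \<in> borel_measurable borel" using g(1) by (rule borel_measurable_continuous_onI)
  have A1: "0 \<le> A + 1" using A by simp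
  define V where "V = value_process \<kappa> c g t"
  define Vn where "Vn n = value_process \<kappa> c (h n) t" for n
  note LV = value_process_convergence(1)[OF hm hb h(2) gm A1 A(2), of \<kappa> c t, folded V_def]
  note limV = value_process_convergence(2)[OF hm hb h(2) gm A1 A(2), of \<kappa> c t, folded V_def Vn_def]
  have LV0: "L2 mu (value_process \<kappa> c g 0)" by (rule value_process_convergence(1)[OF hm hb h(2) gm A1 A(2)])
  define P where "P n p \<longleftrightarrow> (\<forall>x. (fst p has_real_derivative exp (- \<kappa> * \<bar>x - c\<bar>) * h n (x - c)) (at x)) \<and>
      L2 M (\<lambda>\<omega>. fst p (B T \<omega>)) \<and> snd p \<in> borel_measurable borel \<and> L2 M (\<lambda>\<omega>. snd p (B t \<omega>)) \<and>
      ito_limit t (Vn n) (\<lambda>\<omega>. fst p (B T \<omega>) + time_integral (signed \<kappa> c (Vn n)) \<omega> - snd p (B t \<omega>))"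
    for n and p :: "(real \<Rightarrow> real) \<times> (real \<Rightarrow> real)"
  have "\<exists>p. P n p" for n
  proof -
    from represented_sine_sum[OF h(1), of \<kappa> c n, unfolded represented_def] obtain \<Phi>
      where 1: "\<forall>x. (\<Phi> has_real_derivative exp (- \<kappa> * \<bar>x - c\<bar>) * h n (x - c)) (at x)" "L2 M (\<lambda>\<omega>. \<Phi> (B T \<omega>))"
        and 2: "\<forall>t. 0 \<le> t \<longrightarrow> t < T \<longrightarrow> (\<exists>u\<in>borel_measurable borel. L2 M (\<lambda>\<omega>. u (B t \<omega>)) \<and>
          ito_limit t (value_process \<kappa> c (h n) t)
            (\<lambda>\<omega>. \<Phi> (B T \<omega>) + time_integral (signed \<kappa> c (value_process \<kappa> c (h n) t)) \<omega> - u (B t \<omega>)))"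
      by (elim exE conjE) (rule that)
    from 2[rule_format, OF t] obtain u where 3: "u \<in> borel_measurable borel" "L2 M (\<lambda>\<omega>. u (B t \<omega>))"
        "ito_limit t (value_process \<kappa> c (h n) t)
          (\<lambda>\<omega>. \<Phi> (B T \<omega>) + time_integral (signed \<kappa> c (value_process \<kappa> c (h n) t)) \<omega> - u (B t \<omega>))"
      by (elim bexE conjE) (rule that)
    have "P n (\<Phi>, u)" unfolding P_def Vn_def fst_conv snd_conv by (intro conjI 1 3)
    then show ?thesis by (rule exI)
  qed
  then have "\<forall>n. \<exists>p. P n p" by (rule allI)
  from choice[OF this] obtain p where p: "\<forall>n. P n (p n)" by (elim exE) (rule that)
  define \<Phi> where "\<Phi> n = fst (p n)" for n
  define u where "u n = snd (p n)" for n
  have \<Phi>: "(\<Phi> n has_real_derivative exp (- \<kappa> * \<bar>x - c\<bar>) * h n (x - c)) (at x)"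
    and u: "u n \<in> borel_measurable borel" "L2 M (\<lambda>\<omega>. u n (B t \<omega>))"
      "ito_limit t (Vn n) (\<lambda>\<omega>. \<Phi> n (B T \<omega>) + time_integral (signed \<kappa> c (Vn n)) \<omega> - u n (B t \<omega>))" for n x
    using p[rule_format, of n] unfolding P_def \<Phi>_def u_def by blast+
  \<comment> \<open>Antiderivatives are compared after subtracting their values at \<open>c\<close>; the constants
    \<open>\<phi> c - \<Phi> n c\<close> are moved to the variable \<open>U\<close> from the past.\<close>
  define D where "D n x = (\<Phi> n x - \<Phi> n c) - (\<phi> x - \<phi> c)" for n x
  define d where "d n x = exp (- \<kappa> * \<bar>x - c\<bar>) * (h n (x - c) - g (x - c))" for n x
  define K1 where "K1 = \<bar>\<kappa>\<bar> + K"
  have Dd: "(D n has_real_derivative d n x) (at x)" for n x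
  proof -
    have "((\<lambda>x. (\<Phi> n x - \<Phi> n c) - (\<phi> x - \<phi> c)) has_real_derivative
        (exp (- \<kappa> * \<bar>x - c\<bar>) * h n (x - c) - 0) - (exp (- \<kappa> * \<bar>x - c\<bar>) * g (x - c) - 0)) (at x)"
      by (intro DERIV_diff \<Phi> \<phi> DERIV_const)
    then show ?thesis unfolding D_def[abs_def] d_def by (simp add: algebra_simps)
  qed
  have dcont: "isCont (d n) x" for n x
  proof -
    have "continuous_on UNIV (d n)" unfolding d_def[abs_def]
      by (intro continuous_intros continuous_on_compose2[OF hc] continuous_on_compose2[OF g(1)]) auto
    then show ?thesis by (simp add: continuous_on_eq_continuous_at)
  qed
  have db: "\<bar>d n x\<bar> \<le> (2 * A + 1) * exp (K1 * \<bar>x - c\<bar>)" for n x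
  proof -
    have "- \<kappa> * \<bar>x - c\<bar> \<le> \<bar>\<kappa>\<bar> * \<bar>x - c\<bar>" by (intro mult_right_mono) auto
    then have "exp (- \<kappa> * \<bar>x - c\<bar>) \<le> exp (\<bar>\<kappa>\<bar> * \<bar>x - c\<bar>)" by simp
    moreover have "\<bar>h n (x - c) - g (x - c)\<bar> \<le> (2 * A + 1) * exp (K * \<bar>x - c\<bar>)"
      using hb[of n "x - c"] A(3)[of "x - c"] by (simp add: algebra_simps)
    ultimately have "\<bar>d n x\<bar> \<le> exp (\<bar>\<kappa>\<bar> * \<bar>x - c\<bar>) * ((2 * A + 1) * exp (K * \<bar>x - c\<bar>))"
      unfolding d_def abs_mult abs_exp_cancel by (intro mult_mono) auto
    also have "\<dots> = (2 * A + 1) * exp (K1 * \<bar>x - c\<bar>)" unfolding K1_def distrib_right[of _ _ "\<bar>x - c\<bar>"] exp_add by simp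
    finally show ?thesis .
  qed
  have dlim: "(\<lambda>n. d n x) \<longlonglongrightarrow> 0" for x
    unfolding d_def using h(2)[of "x - c"] by (auto intro!: tendsto_eq_intros)
  have K10: "0 \<le> K1" "0 \<le> 2 * A + 1" using A by (auto simp: K1_def)
  have D0: "D n c = 0" for n by (simp add: D_def)
  note DD = antiderivative_convergence[OF Dd D0 dcont db dlim K10(2,1)]
  have Dm: "D n \<in> borel_measurable borel" for n
    by (rule borel_measurable_continuous_onI) (meson Dd DERIV_continuous_on DERIV_subset subset_UNIV)
  define R where "R = (2 * A + 1) * exp ((K1 + 1) * \<bar>c\<bar>)"
  have Dbound: "\<bar>D n x\<bar> \<le> R * exp ((K1 + 1) * \<bar>x\<bar>)" for n x
  proof -
    have "\<bar>D n x\<bar> \<le> (2 * A + 1) * exp ((K1 + 1) * \<bar>x - c\<bar>)" by (rule DD(1))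
    also have "\<dots> \<le> (2 * A + 1) * exp ((K1 + 1) * (\<bar>c\<bar> + \<bar>x\<bar>))"
      using K10 by (intro mult_left_mono) (auto intro!: mult_left_mono)
    also have "\<dots> = R * exp ((K1 + 1) * \<bar>x\<bar>)" unfolding R_def distrib_left exp_add by simp
    finally show ?thesis .
  qed
  have mBT: "B T \<in> borel_measurable M" using measurable_B T_pos by simp
  have LR: "L2 M (\<lambda>\<omega>. R * exp ((K1 + 1) * \<bar>B T \<omega>\<bar>))"
    using L2_cmult[OF L2_exp_B[of T "K1 + 1"]] K10 T_pos by simp
  have DmB: "(\<lambda>\<omega>. D n (B T \<omega>)) \<in> borel_measurable M" for n by (rule measurable_compose[OF mBT Dm])
  have LD: "L2 M (\<lambda>\<omega>. D n (B T \<omega>))" for n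
    by (rule L2_bound[OF DmB LR]) (use Dbound in \<open>auto intro!: AE_I2 order_trans[OF Dbound]\<close>)
  have limD: "(\<lambda>n. l2norm M (\<lambda>\<omega>. D n (B T \<omega>))) \<longlonglongrightarrow> 0"
    using l2norm_dominated_convergence(2)[where f="\<lambda>n \<omega>. D n (B T \<omega>)" and g="\<lambda>_. 0", OF DmB _ LR] Dbound DD(2) by simp
  define Zt where "Zt = after t Z"
  define E where "E = after t (\<lambda>x. k * \<bar>Z x\<bar> - signed \<kappa> c (value_process \<kappa> c g 0) x)"
  define kZ where "kZ = after t (\<lambda>x. k * \<bar>Z x\<bar>)"
  have LZt: "L2 mu Zt" unfolding Zt_def by (rule L2_after[OF Z])
  have LaZ: "L2 mu (\<lambda>x. k * \<bar>Z x\<bar>)"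
    using L2_measurable[OF Z] by (intro L2_cmult L2_bound[OF _ Z]) auto
  have LkZ: "L2 mu kZ" unfolding kZ_def by (rule L2_after[OF LaZ])
  have LE: "L2 mu E" unfolding E_def by (intro L2_after L2_diff LaZ L2_signed(1) LV0)
  have LVn: "L2 mu (Vn n)" for n using ito_limit_L2(1)[OF u(3)] .
  have Eeq: "kZ x - signed \<kappa> c (Vn n) x = E x + signed \<kappa> c (\<lambda>x. V x - Vn n x) x" for n x
    unfolding kZ_def E_def V_def after_value_process[OF t(1), symmetric]
    by (simp add: after_def signed_def algebra_simps)
  have main: "l2norm mu (\<lambda>x. Zt x - Vn n x)
      \<le> l2norm M (\<lambda>\<omega>. D n (B T \<omega>)) + (l2norm M (time_integral E) + sqrt T * (\<bar>\<kappa>\<bar> * l2norm mu (\<lambda>x. Vn n x - V x)))" for n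
  proof -
    let ?S = "signed \<kappa> c (\<lambda>x. V x - Vn n x)"
    have LS: "L2 mu ?S" "l2norm mu ?S \<le> \<bar>\<kappa>\<bar> * l2norm mu (\<lambda>x. Vn n x - V x)"
      using L2_signed[OF L2_diff[OF LV LVn[of n]], of \<kappa> c] l2norm_minus_commute[of mu V "Vn n"] by auto
    define G where "G \<omega> = - D n (B T \<omega>) + time_integral (\<lambda>x. E x + ?S x) \<omega>" for \<omega>
    have LES: "L2 M (time_integral (\<lambda>x. E x + ?S x))" by (rule L2_time_integral[OF L2_add[OF LE LS(1)]])
    have LG: "L2 M G" unfolding G_def[abs_def] by (intro L2_add L2_minus LD LES)
    define U where "U \<omega> = Y \<omega> - u n (B t \<omega>) - (\<phi> c - \<Phi> n c)" for \<omega>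
    have mU: "U \<in> borel_measurable (F t)"
      unfolding U_def[abs_def] using Y measurable_compose[OF measurable_B_F[OF t(1) order_refl] u(1)[of n]] by auto
    have "l2norm mu (\<lambda>x. Zt x - Vn n x) \<le> l2norm M G"
    proof (rule ito_limit_norm_le[OF ito_limit_diff[OF t(1) I[folded Zt_def] u(3)[of n]] t(1) mU LG])
      show "AE \<omega> in M. I \<omega> - (\<Phi> n (B T \<omega>) + time_integral (signed \<kappa> c (Vn n)) \<omega> - u n (B t \<omega>)) = G \<omega> - U \<omega>"
        using eq time_integral_diff[OF LkZ L2_signed(1)[OF LVn[of n], of \<kappa> c]]
      proof eventually_elim
        case (elim \<omega>)
        have "time_integral (\<lambda>x. E x + ?S x) \<omega> = time_integral kZ \<omega> - time_integral (signed \<kappa> c (Vn n)) \<omega>"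
          using elim(2) unfolding Eeq .
        then show ?case using elim(1) unfolding G_def U_def D_def kZ_def by simp
      qed
    qed
    also have "\<dots> \<le> l2norm M (\<lambda>\<omega>. D n (B T \<omega>)) + l2norm M (time_integral (\<lambda>x. E x + ?S x))"
      unfolding G_def[abs_def] using l2norm_triangle[OF L2_minus[OF LD] LES] by (simp add: l2norm_minus)
    also have "l2norm M (time_integral (\<lambda>x. E x + ?S x)) \<le> l2norm M (time_integral E) + l2norm M (time_integral ?S)"
      by (rule l2norm_time_integral_add[OF LE LS(1)])
    also have "l2norm M (time_integral ?S) \<le> sqrt T * l2norm mu ?S" by (rule l2norm_time_integral[OF LS(1)])
    also have "sqrt T * l2norm mu ?S \<le> sqrt T * (\<bar>\<kappa>\<bar> * l2norm mu (\<lambda>x. Vn n x - V x))"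
      using LS(2) T_pos by (intro mult_left_mono) auto
    finally show ?thesis by simp
  qed
  have "(\<lambda>n. l2norm mu (\<lambda>x. (Zt x - Vn n x) - (Zt x - V x))) \<longlonglongrightarrow> 0"
    using limV by (simp add: l2norm_minus_commute[of mu V])
  then have lim1: "(\<lambda>n. l2norm mu (\<lambda>x. Zt x - Vn n x)) \<longlonglongrightarrow> l2norm mu (\<lambda>x. Zt x - V x)"
    by (intro l2norm_tendsto L2_diff LZt LV LVn)
  have lim2: "(\<lambda>n. l2norm M (\<lambda>\<omega>. D n (B T \<omega>)) + (l2norm M (time_integral E) + sqrt T * (\<bar>\<kappa>\<bar> * l2norm mu (\<lambda>x. Vn n x - V x))))
      \<longlonglongrightarrow> 0 + (l2norm M (time_integral E) + sqrt T * (\<bar>\<kappa>\<bar> * 0))"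
    by (intro tendsto_intros limD limV)
  have "l2norm mu (\<lambda>x. Zt x - V x) \<le> 0 + (l2norm M (time_integral E) + sqrt T * (\<bar>\<kappa>\<bar> * 0))"
    by (rule LIMSEQ_le[OF lim1 lim2]) (use main in auto)
  moreover have "(\<lambda>x. Zt x - V x) = after t (\<lambda>x. Z x - value_process \<kappa> c g 0 x)"
    unfolding Zt_def V_def after_value_process[OF t(1), symmetric] by (simp add: after_def fun_eq_iff algebra_simps)
  ultimately show ?thesis unfolding E_def by simp
qed

text \<open>With \<open>\<kappa> = \<sigma> * k\<close> the sign of the gradient process \<open>V\<close> gives \<open>signed \<kappa> c V = k * \<bar>V\<bar>\<close>, so \<open>V\<close>
  is compared with \<open>Z\<close> for the original nonlinear driver, which is Lipschitz with constant \<open>\<bar>k\<bar>\<close>.\<close>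

theorem gradient_sign:
  assumes Z: "L2 mu Z"
    and sol: "\<And>t. 0 \<le> t \<Longrightarrow> t < T \<Longrightarrow> Y t \<in> borel_measurable (F t) \<and> (\<exists>I. ito_limit t (after t Z) I \<and>
      (AE \<omega> in M. Y t \<omega> = \<phi> (B T \<omega>) + time_integral (after t (\<lambda>x. k * \<bar>Z x\<bar>)) \<omega> - I \<omega>))"
    and \<phi>: "\<And>x. (\<phi> has_real_derivative \<phi>' x) (at x)" "continuous_on UNIV \<phi>'" "polynomial_growth \<phi>'"
    and sym: "\<And>x. \<phi>' (c - x) = - \<phi>' (c + x)"
    and \<sigma>: "\<bar>\<sigma>\<bar> = 1" and mono: "\<And>x. c < x \<Longrightarrow> 0 \<le> \<sigma> * \<phi>' x" and nz: "c < x0" "\<phi>' x0 \<noteq> 0"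
  shows "AE x in mu. sgn (\<sigma> * Z x) = sgn (B (fst x) (snd x) - c)"
proof -
  define \<kappa> where "\<kappa> = \<sigma> * k"
  define g where "g y = exp (\<kappa> * \<bar>y\<bar>) * \<phi>' (c + y)" for y
  obtain A where A: "A \<ge> 0" "\<And>x. \<bar>\<phi>' x\<bar> \<le> A * exp \<bar>x\<bar>" using polynomial_growth_exp[OF \<phi>(3)] by blast
  have gc: "continuous_on UNIV g" unfolding g_def[abs_def]
    by (intro continuous_intros continuous_on_compose2[OF \<phi>(2)]) auto
  have godd: "g (- y) = - g y" for y using sym[of y] by (simp add: g_def)
  have gb: "\<bar>g y\<bar> \<le> (A * exp \<bar>c\<bar>) * exp ((\<bar>\<kappa>\<bar> + 1) * \<bar>y\<bar>)" for y
  proof -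
    have "\<kappa> * \<bar>y\<bar> \<le> \<bar>\<kappa>\<bar> * \<bar>y\<bar>" by (intro mult_right_mono) auto
    then have e: "exp (\<kappa> * \<bar>y\<bar>) \<le> exp (\<bar>\<kappa>\<bar> * \<bar>y\<bar>)" by simp
    have "\<bar>\<phi>' (c + y)\<bar> \<le> A * exp \<bar>c + y\<bar>" by (rule A(2))
    also have "\<dots> \<le> A * exp (\<bar>c\<bar> + \<bar>y\<bar>)" using A(1) by (intro mult_left_mono) auto
    finally have "\<bar>g y\<bar> \<le> exp (\<bar>\<kappa>\<bar> * \<bar>y\<bar>) * (A * exp (\<bar>c\<bar> + \<bar>y\<bar>))"
      unfolding g_def abs_mult abs_exp_cancel using e by (intro mult_mono) auto
    also have "\<dots> = (A * exp \<bar>c\<bar>) * exp ((\<bar>\<kappa>\<bar> + 1) * \<bar>y\<bar>)" by (simp add: distrib_right exp_add)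
    finally show ?thesis .
  qed
  have K0: "0 \<le> A * exp \<bar>c\<bar>" "0 \<le> \<bar>\<kappa>\<bar> + 1" using A(1) by auto
  have gpos: "0 \<le> \<sigma> * g y" if "0 < y" for y
    using mono[of "c + y"] that unfolding g_def by (simp add: mult.left_commute[of \<sigma>])
  have gnz: "0 < x0 - c" "g (x0 - c) \<noteq> 0" using nz by (auto simp: g_def)
  have d\<phi>: "(\<phi> has_real_derivative exp (- \<kappa> * \<bar>x - c\<bar>) * g (x - c)) (at x)" for x
  proof -
    have "exp (- \<kappa> * \<bar>x - c\<bar>) * g (x - c) = \<phi>' x"
      unfolding g_def mult.assoc[symmetric] exp_add[symmetric] by simp
    then show ?thesis using \<phi>(1)[of x] by simp
  qed
  define V where "V = value_process \<kappa> c g 0"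
  have vs1: "sgn (\<sigma> * value_grad \<kappa> c g s x) = sgn (x - c)" if "s < T" for s x
    by (rule value_grad_sign(1)[OF gc godd _ gnz \<sigma> K0 gb that]) (rule gpos)
  have vs2: "\<sigma> * sgn (x - c) * value_grad \<kappa> c g s x = \<bar>value_grad \<kappa> c g s x\<bar>" if "s \<le> T" for s x
    by (rule value_grad_sign(2)[OF gc godd _ gnz \<sigma> K0 gb that]) (rule gpos)
  have LV: "L2 mu V"
    unfolding V_def
    by (rule value_process_convergence(1)[where h="\<lambda>_. g" and A="A * exp \<bar>c\<bar>" and K="\<bar>\<kappa>\<bar> + 1"])
      (use gb K0 borel_measurable_continuous_onI[OF gc] in auto)
  have kV: "signed \<kappa> c V x = k * \<bar>V x\<bar>" if x: "x \<in> space mu" for x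
  proof -
    have "fst x \<le> T" using x by (auto simp: space_mu)
    from vs2[OF this, of "W (fst x) (snd x)"] show ?thesis
      unfolding V_def value_process_def signed_def \<kappa>_def by (auto simp: indicator_def mult_ac)
  qed
  have "AE x in mu. Z x - V x = 0"
  proof (rule backward_uniqueness[where E="\<lambda>x. k * \<bar>Z x\<bar> - signed \<kappa> c V x" and L="\<bar>k\<bar>"])
    have LaZ: "L2 mu (\<lambda>x. k * \<bar>Z x\<bar>)"
      using L2_measurable[OF Z] by (intro L2_cmult L2_bound[OF _ Z]) auto
    show "L2 mu (\<lambda>x. Z x - V x)" by (intro L2_diff Z LV)
    show "L2 mu (\<lambda>x. k * \<bar>Z x\<bar> - signed \<kappa> c V x)" by (intro L2_diff LaZ L2_signed(1) LV)
    show "AE x in mu. \<bar>k * \<bar>Z x\<bar> - signed \<kappa> c V x\<bar> \<le> \<bar>k\<bar> * \<bar>Z x - V x\<bar>"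
    proof (rule AE_I2)
      fix x assume "x \<in> space mu"
      then have "k * \<bar>Z x\<bar> - signed \<kappa> c V x = k * (\<bar>Z x\<bar> - \<bar>V x\<bar>)" by (simp add: kV right_diff_distrib)
      also have "\<bar>\<dots>\<bar> \<le> \<bar>k\<bar> * \<bar>Z x - V x\<bar>"
        unfolding abs_mult by (intro mult_left_mono abs_triangle_ineq3) auto
      finally show "\<bar>k * \<bar>Z x\<bar> - signed \<kappa> c V x\<bar> \<le> \<bar>k\<bar> * \<bar>Z x - V x\<bar>" .
    qed
    fix t assume t: "0 \<le> t" "t < T"
    obtain I where I: "ito_limit t (after t Z) I" "Y t \<in> borel_measurable (F t)"
      "AE \<omega> in M. Y t \<omega> = \<phi> (B T \<omega>) + time_integral (after t (\<lambda>x. k * \<bar>Z x\<bar>)) \<omega> - I \<omega>"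
      using sol[OF t] by blast
    show "l2norm mu (after t (\<lambda>x. Z x - V x)) \<le> l2norm M (time_integral (after t (\<lambda>x. k * \<bar>Z x\<bar> - signed \<kappa> c V x)))"
      unfolding V_def by (rule gradient_comparison[OF Z t I(1,2,3) d\<phi> gc godd K0 gb])
  qed simp
  then show ?thesis
    using AE_mu_fst_neq[of 0] AE_mu_fst_neq[of T] AE_mu_W_eq_B AE_space
  proof eventually_elim
    case (elim x)
    then have "fst x \<in> {0<..T}" "fst x < T" by (auto simp: space_mu)
    then have "Z x = value_grad \<kappa> c g (fst x) (B (fst x) (snd x))"
      using elim by (simp add: V_def value_process_def)
    then show ?case using vs1[OF \<open>fst x < T\<close>] by simp
  qed
qed

end

text \<open>Both cases are instances of \<open>gradient_sign\<close>, with \<open>\<sigma> = 1\<close> and \<open>\<sigma> = -1\<close>. The symmetry of \<open>\<phi>\<close> makes its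
  derivative odd about \<open>c\<close>. Time integrals over \<open>[t, T]\<close> and \<open>(t, T]\<close> agree since \<open>{t}\<close> is a null set.\<close>

theorem corollary6:
  fixes M :: "'a measure" and B Y Z :: "real \<Rightarrow> 'a \<Rightarrow> real"
    and T c k :: real and \<phi> :: "real \<Rightarrow> real"
  assumes "std_brownian_motion M B"
    and "T > 0"
    and "C_k 3 \<phi>"
    and "\<forall>x. \<phi> (c - x) = \<phi> (c + x)"
    and "mono_on {c..} \<phi> \<or> antimono_on {c..} \<phi>"
    and "polynomial_growth \<phi>" and "polynomial_growth (deriv \<phi>)"
    and "bsde_solution M B T k \<phi> Y Z"
  shows "((\<forall>x\<in>{c<..}. deriv \<phi> x \<ge> 0) \<and> (\<exists>x\<in>{c<..}. deriv \<phi> x \<noteq> 0) \<longrightarrow>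
            (AE (t, \<omega>) in restrict_space lborel {0..T} \<Otimes>\<^sub>M M. sgn (Z t \<omega>) = sgn (B t \<omega> - c))) \<and>
         ((\<forall>x\<in>{c<..}. deriv \<phi> x \<le> 0) \<and> (\<exists>x\<in>{c<..}. deriv \<phi> x \<noteq> 0) \<longrightarrow>
            (AE (t, \<omega>) in restrict_space lborel {0..T} \<Otimes>\<^sub>M M. sgn (- Z t \<omega>) = sgn (B t \<omega> - c)))"
proof -
  interpret bm_horizon M B T
    using assms(1,2) by (simp add: bm_horizon_def bm_horizon_axioms_def)
  define Zp where "Zp x = Z (fst x) (snd x)" for x
  have LZ: "L2 mu Zp"
    using L2_M2_process assms(8) unfolding Zp_def[abs_def] bsde_solution_def by blast
  have d1: "(\<phi> has_real_derivative deriv \<phi> x) (at x)" for x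
  proof -
    have "\<phi> field_differentiable at x" using assms(3) unfolding C_k_def by (auto dest: spec[of _ 0])
    then show ?thesis by (rule DERIV_deriv_iff_field_differentiable[THEN iffD2])
  qed
  have d2: "continuous_on UNIV (deriv \<phi>)"
  proof (rule continuous_at_imp_continuous_on, rule ballI)
    fix x
    have "(deriv ^^ 1) \<phi> field_differentiable at x" using assms(3) unfolding C_k_def by (metis one_less_numeral_iff semiring_norm(77))
    then have "deriv \<phi> field_differentiable at x" by simp
    then show "isCont (deriv \<phi>) x" by (rule field_differentiable_imp_continuous_at)
  qed
  have sym: "deriv \<phi> (c - x) = - deriv \<phi> (c + x)" for x
  proof -
    have "((\<lambda>x. \<phi> (c - x)) has_real_derivative deriv \<phi> (c - x) * (0 - 1)) (at x)"
      by (rule DERIV_chain2[OF d1]) (intro DERIV_diff DERIV_const DERIV_ident)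
    moreover have "((\<lambda>x. \<phi> (c + x)) has_real_derivative deriv \<phi> (c + x) * (0 + 1)) (at x)"
      by (rule DERIV_chain2[OF d1]) (intro DERIV_add DERIV_const DERIV_ident)
    moreover have "(\<lambda>x. \<phi> (c - x)) = (\<lambda>x. \<phi> (c + x))" using assms(4) by simp
    ultimately have "deriv \<phi> (c - x) * (0 - 1) = deriv \<phi> (c + x) * (0 + 1)" using DERIV_unique by metis
    then show ?thesis by simp
  qed
  have sol: "Y t \<in> borel_measurable (F t) \<and> (\<exists>I. ito_limit t (after t Zp) I \<and>
      (AE \<omega> in M. Y t \<omega> = \<phi> (B T \<omega>) + time_integral (after t (\<lambda>x. k * \<bar>Zp x\<bar>)) \<omega> - I \<omega>))"
    if t: "0 \<le> t" "t < T" for t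
  proof
    show "Y t \<in> borel_measurable (F t)"
      using assms(8) t unfolding bsde_solution_def M2_process_def by auto
    obtain I where I: "has_ito_integral M B t T Z I"
      "AE \<omega> in M. Y t \<omega> = \<phi> (B T \<omega>) + (LBINT s:{t..T}. k * \<bar>Z s \<omega>\<bar>) - I \<omega>"
      using assms(8) t unfolding bsde_solution_def by (meson atLeastAtMost_iff less_imp_le)
    have il: "ito_limit t (\<lambda>x. Z (fst x) (snd x) * indicator {t..T} (fst x)) I"
      using has_ito_integral_ito_limit[OF I(1) t(1)] t LZ unfolding Zp_def[abs_def] by simp
    have ia: "ito_limit t (after t Zp) I"
    proof (rule ito_limit_cong_AE[OF il t(1)])
      show "AE x in mu. Z (fst x) (snd x) * indicator {t..T} (fst x) = after t Zp x"
        using AE_mu_fst_neq[of t] by eventually_elim (auto simp: after_def Zp_def indicator_def)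
      show "after t Zp \<in> borel_measurable mu" by (rule L2_measurable[OF L2_after[OF LZ]])
      show "I \<in> borel_measurable M" by (rule L2_measurable[OF ito_limit_L2(2)[OF il]])
    qed simp
    have tie: "(LBINT s:{t..T}. k * \<bar>Z s \<omega>\<bar>) = time_integral (after t (\<lambda>x. k * \<bar>Zp x\<bar>)) \<omega>" if \<omega>: "\<omega> \<in> space M" for \<omega>
    proof -
      have mZ: "(\<lambda>s. Z s \<omega>) \<in> borel_measurable lam"
        using measurable_compose[OF measurable_Pair2'[OF \<omega>] L2_measurable[OF LZ]] by (simp add: Zp_def)
      then have m: "(\<lambda>s. indicator {0..T} s *\<^sub>R Z s \<omega>) \<in> borel_measurable lborel"
        unfolding lam_def by (subst (asm) borel_measurable_restrict_space_iff) auto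
      have "(LBINT s:{t..T}. k * \<bar>Z s \<omega>\<bar>) = (\<integral>s. indicator {t..T} s * (k * \<bar>indicator {0..T} s *\<^sub>R Z s \<omega>\<bar>) \<partial>lborel)"
        unfolding set_lebesgue_integral_def
        by (intro Bochner_Integration.integral_cong) (use t in \<open>auto simp: indicator_def\<close>)
      also have "\<dots> = (\<integral>s. indicator {t<..T} s * (k * \<bar>indicator {0..T} s *\<^sub>R Z s \<omega>\<bar>) \<partial>lborel)"
      proof (rule integral_cong_AE)
        show "AE s in lborel. indicator {t..T} s * (k * \<bar>indicator {0..T} s *\<^sub>R Z s \<omega>\<bar>)
            = indicator {t<..T} s * (k * \<bar>indicator {0..T} s *\<^sub>R Z s \<omega>\<bar>)"
          using AE_lborel_singleton[of t] by eventually_elim (auto simp: indicator_def)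
      qed (use m in measurable)
      also have "\<dots> = (\<integral>s. indicator {0..T} s *\<^sub>R (after t (\<lambda>x. k * \<bar>Zp x\<bar>) (s, \<omega>)) \<partial>lborel)"
        by (intro Bochner_Integration.integral_cong) (use t in \<open>auto simp: indicator_def after_def Zp_def\<close>)
      also have "\<dots> = time_integral (after t (\<lambda>x. k * \<bar>Zp x\<bar>)) \<omega>"
        unfolding time_integral_def lam_def by (rule integral_restrict_space[symmetric]) simp
      finally show ?thesis .
    qed
    have "AE \<omega> in M. Y t \<omega> = \<phi> (B T \<omega>) + time_integral (after t (\<lambda>x. k * \<bar>Zp x\<bar>)) \<omega> - I \<omega>"
      using I(2) AE_space
    proof eventually_elim
      case (elim \<omega>)
      show ?case using elim(1) unfolding tie[OF elim(2)] .
    qed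
    with ia show "\<exists>I. ito_limit t (after t Zp) I \<and>
      (AE \<omega> in M. Y t \<omega> = \<phi> (B T \<omega>) + time_integral (after t (\<lambda>x. k * \<bar>Zp x\<bar>)) \<omega> - I \<omega>)" by blast
  qed
  note sgn = gradient_sign[where Y=Y, OF LZ sol d1 d2 assms(7) sym]
  have up: "AE x in mu. sgn (Zp x) = sgn (B (fst x) (snd x) - c)"
    if mon: "\<forall>x\<in>{c<..}. deriv \<phi> x \<ge> 0" and nz: "\<exists>x\<in>{c<..}. deriv \<phi> x \<noteq> 0"
  proof -
    obtain x0 where "c < x0" "deriv \<phi> x0 \<noteq> 0" using nz by auto
    then show ?thesis using sgn[of 1 x0] mon by simp
  qed
  have down: "AE x in mu. sgn (- Zp x) = sgn (B (fst x) (snd x) - c)"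
    if mon: "\<forall>x\<in>{c<..}. deriv \<phi> x \<le> 0" and nz: "\<exists>x\<in>{c<..}. deriv \<phi> x \<noteq> 0"
  proof -
    obtain x0 where "c < x0" "deriv \<phi> x0 \<noteq> 0" using nz by auto
    then show ?thesis using sgn[of "-1" x0] mon by simp
  qed
  show ?thesis using up down unfolding Zp_def lam_def by (simp add: case_prod_beta')
qed

end
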